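(* There exist constants $c_{sh},C_{sh}>0$ and $\varepsilon_{sh}>0$, depending only on the geometric and analytic data of $M$, such that for every $x\in M$ and every $0<\varepsilon<\varepsilon_{sh}$, $$c_{sh}\,\kappa_d(\varepsilon)\le\lambda_{B_M(x,\varepsilon)}\le C_{sh}\,\kappa_d(\varepsilon).$$
   Context: Setting. $d\ge2$; $M\subset\mathbb R^d$ is the closure of a bounded connected open set. $d_M(x,y)$ is the infimum of the lengths of rectifiable curves in $M$ joining $x$ to $y$; $B_M(x,\varepsilon)=\{y\in M:d_M(x,y)<\varepsilon\}$; $\mu(A)=|A|/|M|$ is normalized Lebesgue measure on $M$. $M$ satisfies the following assumptions. (1) Positive reach: $\operatorname{reach}(M)>0$, i.e. every $z$ with $0<\operatorname{dist}(z,M)<\operatorname{reach}(M)$ has a unique nearest point in $M$. (2) There are $c_{ie}\ge1$, $\rho_{ie}>0$ with $d_M(x,y)\le c_{ie}|x-y|$ whenever $x,y\in M$, $|x-y|<\rho_{ie}$. (3) There are $c_{vol},C_{vol},\rho_{vol}>0$ with $c_{vol}\varepsilon^d\le\mu(B_M(x,\varepsilon))\le C_{vol}\varepsilon^d$ for all $x\in M$, $0<\varepsilon<\rho_{vol}$. (4) $M$ is an admissible reflecting domain: its boundary is regular enough that reflected Brownian motion in $M$ exists and is unique in law, has a symmetric Neumann heat kernel, the Neumann semigroup on $L^2(M,\mu)$ is compact, the Neumann spectrum is discrete with positive spectral gap, and there are $\rho_{ch}>0$, $L_{ch}\ge1$ such that every $x\in M$ has a neighbourhood $U_x\subset M$ and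 a chart $\Psi_x$ on $U_x$, bi-Lipschitz with constant $L_{ch}$ and with Jacobian determinants of $\Psi_x,\Psi_x^{-1}$ uniformly bounded above and below, mapping $U_x$ onto a Euclidean ball if $\operatorname{dist}(x,\partial M)\ge\rho_{ch}$ and onto a half-ball with $\partial M$ carried into the flat face if $\operatorname{dist}(x,\partial M)<\rho_{ch}$. The charts are used at a fixed geometric scale. (A compact connected Lipschitz domain with uniform chart constants suffices for (4).) Notation. $\mathcal E(f,g)=\frac12\int_M\nabla f\cdot\nabla g\,d\mu$ on $H^1(M)$ (the Dirichlet form of reflected Brownian motion in $M$). For $A\subset M$ of positive capacity, $\lambda_A=\inf\{\mathcal E(f,f)/\|f\|_{L^2(\mu)}^2: f\in H^1(M),\ f=0\text{ quasi-everywhere on }A,\ f\ne0\}$. $\kappa_2(\varepsilon)=(\log\varepsilon^{-1})^{-1}$ and $\kappa_d(\varepsilon)=\varepsilon^{d-2}$ for $d\ge3$. Note that $x$ ranges over all of $M$, including points on or near $\partial M$; the constants do not depend on $x$ or $\varepsilon$. *)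

theory Defs
  imports "HOL-Probability.Probability"
begin

section \<open>Intrinsic geometry\<close>

definition curve_length :: "(real \<Rightarrow> real^'n) \<Rightarrow> ennreal" where
  "curve_length g =
     (SUP (k, t) \<in> {(k :: nat, t :: nat \<Rightarrow> real). mono_on {..k} t \<and> t ` {..k} \<subseteq> {0..1}}.
        ennreal (\<Sum>i<k. dist (g (t i)) (g (t (Suc i)))))"

definition rectifiable :: "(real \<Rightarrow> real^'n) \<Rightarrow> bool" where
  "rectifiable g \<longleftrightarrow> path g \<and> curve_length g < \<infinity>"

definition intrinsic_dist :: "(real^'n) set \<Rightarrow> real^'n \<Rightarrow> real^'n \<Rightarrow> ennreal" where
  "intrinsic_dist M x y =
     (INF g \<in> {g. rectifiable g \<and> path_image g \<subseteq> M \<and> pathstart g = x \<and> pathfinish g = y}.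
        curve_length g)"

definition intrinsic_ball :: "(real^'n) set \<Rightarrow> real^'n \<Rightarrow> real \<Rightarrow> (real^'n) set" where
  "intrinsic_ball M x \<epsilon> = {y \<in> M. intrinsic_dist M x y < ennreal \<epsilon>}"

definition reach :: "(real^'n) set \<Rightarrow> ereal" where
  "reach M = Sup {ereal r | r :: real.
     \<forall>z. 0 < infdist z M \<and> infdist z M < r \<longrightarrow> (\<exists>!p. p \<in> M \<and> dist z p = infdist z M)}"

definition mu :: "(real^'n) set \<Rightarrow> (real^'n) measure" where
  "mu M = uniform_measure (lebesgue_on M) M"


section \<open>The Sobolev space and the Dirichlet form\<close>

text \<open>Elements of \<open>L\<^sup>2\<close> and of the Sobolev space are represented by functions on the whole
  space, of which only the restriction to \<open>M\<close> matters (\<open>space (mu M) = M\<close>).\<close>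

definition L2 :: "(real^'n) set \<Rightarrow> (real^'n \<Rightarrow> real) set" where
  "L2 M = {f. f \<in> borel_measurable (mu M) \<and> integrable (mu M) (\<lambda>x. (f x)\<^sup>2)}"

definition L2_inner :: "(real^'n) set \<Rightarrow> (real^'n \<Rightarrow> real) \<Rightarrow> (real^'n \<Rightarrow> real) \<Rightarrow> real" where
  "L2_inner M f g = (\<integral>x. f x * g x \<partial>mu M)"

definition L2_norm :: "(real^'n) set \<Rightarrow> (real^'n \<Rightarrow> real) \<Rightarrow> real" where
  "L2_norm M f = sqrt (\<integral>x. (f x)\<^sup>2 \<partial>mu M)"

definition partial_deriv :: "'n \<Rightarrow> (real^'n \<Rightarrow> real) \<Rightarrow> real^'n \<Rightarrow> real" where
  "partial_deriv i \<phi> x = deriv (\<lambda>t. \<phi> (x + t *\<^sub>R axis i 1)) 0"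

text \<open>All iterated partial derivatives, of every order, exist and are continuous.\<close>

definition smooth_fun :: "(real^'n \<Rightarrow> real) \<Rightarrow> bool" where
  "smooth_fun \<phi> \<longleftrightarrow>
     (\<forall>is. continuous_on UNIV (foldr partial_deriv is \<phi>) \<and>
        (\<forall>i x. (\<lambda>t. foldr partial_deriv is \<phi> (x + t *\<^sub>R axis i 1)) differentiable (at (0::real))))"

definition test_function :: "(real^'n) set \<Rightarrow> (real^'n \<Rightarrow> real) \<Rightarrow> bool" where
  "test_function \<Omega> \<phi> \<longleftrightarrow>
     smooth_fun \<phi> \<and> compact (closure {x. \<phi> x \<noteq> 0}) \<and> closure {x. \<phi> x \<noteq> 0} \<subseteq> \<Omega>"

text \<open>The distributional gradient lives on the interior of \<open>M\<close>. Normalising it to zero elsewhere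
  determines it up to null sets even when the boundary of \<open>M\<close> is not null (it is null for the
  domains considered, because of the charts below).\<close>

definition is_weak_gradient ::
  "(real^'n) set \<Rightarrow> (real^'n \<Rightarrow> real) \<Rightarrow> (real^'n \<Rightarrow> real^'n) \<Rightarrow> bool" where
  "is_weak_gradient M f g \<longleftrightarrow>
     (\<forall>i. (\<lambda>x. g x $ i) \<in> L2 M) \<and> (\<forall>x. x \<notin> interior M \<longrightarrow> g x = 0) \<and>
     (\<forall>\<phi> i. test_function (interior M) \<phi> \<longrightarrow>
        (\<integral>x\<in>interior M. f x * partial_deriv i \<phi> x \<partial>lebesgue)
          = - (\<integral>x\<in>interior M. g x $ i * \<phi> x \<partial>lebesgue))"

definition H1 :: "(real^'n) set \<Rightarrow> (real^'n \<Rightarrow> real) set" where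
  "H1 M = {f \<in> L2 M. \<exists>g. is_weak_gradient M f g}"

definition weak_gradient :: "(real^'n) set \<Rightarrow> (real^'n \<Rightarrow> real) \<Rightarrow> real^'n \<Rightarrow> real^'n" where
  "weak_gradient M f = (SOME g. is_weak_gradient M f g)"

definition dirichlet_form ::
  "(real^'n) set \<Rightarrow> (real^'n \<Rightarrow> real) \<Rightarrow> (real^'n \<Rightarrow> real) \<Rightarrow> real" where
  "dirichlet_form M f g = 1/2 * (\<integral>x. weak_gradient M f x \<bullet> weak_gradient M g x \<partial>mu M)"


section \<open>Capacity and the principal eigenvalue with killing on a set\<close>

definition open_capacity :: "(real^'n) set \<Rightarrow> (real^'n) set \<Rightarrow> ennreal" where
  "open_capacity M V =
     (INF u \<in> {u \<in> H1 M. AE x in mu M. x \<in> V \<longrightarrow> 1 \<le> u x}.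
        ennreal (dirichlet_form M u u + (L2_norm M u)\<^sup>2))"

definition capacity :: "(real^'n) set \<Rightarrow> (real^'n) set \<Rightarrow> ennreal" where
  "capacity M A = (INF V \<in> {V. openin (top_of_set M) V \<and> A \<subseteq> V}. open_capacity M V)"

definition quasi_continuous :: "(real^'n) set \<Rightarrow> (real^'n \<Rightarrow> real) \<Rightarrow> bool" where
  "quasi_continuous M f \<longleftrightarrow>
     (\<forall>\<eta>>0. \<exists>V. openin (top_of_set M) V \<and> capacity M V < ennreal \<eta> \<and> continuous_on (M - V) f)"

text \<open>As usual, a Sobolev class is evaluated quasi-everywhere through its quasi-continuous
  version.\<close>

definition vanishes_qe_on :: "(real^'n) set \<Rightarrow> (real^'n) set \<Rightarrow> (real^'n \<Rightarrow> real) \<Rightarrow> bool" where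
  "vanishes_qe_on M A f \<longleftrightarrow>
     (\<exists>h. quasi_continuous M h \<and> (AE x in mu M. h x = f x) \<and> capacity M {x \<in> A. h x \<noteq> 0} = 0)"

definition principal_eigenvalue :: "(real^'n) set \<Rightarrow> (real^'n) set \<Rightarrow> ereal" where
  "principal_eigenvalue M A =
     (INF f \<in> {f \<in> H1 M. vanishes_qe_on M A f \<and> \<not> (AE x in mu M. f x = 0)}.
        ereal (dirichlet_form M f f / (L2_norm M f)\<^sup>2))"

definition kappa :: "nat \<Rightarrow> real \<Rightarrow> real" where
  "kappa d \<epsilon> = (if d = 2 then inverse (ln (inverse \<epsilon>)) else \<epsilon> ^ (d - 2))"


section \<open>Neumann Laplacian, semigroup and heat kernel\<close>

text \<open>\<open>u\<close> lies in the domain of the self-adjoint operator associated with the Dirichlet form, which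
  is one half of the Neumann Laplacian, and is mapped by it to \<open>g\<close>.\<close>

definition neumann_generator ::
  "(real^'n) set \<Rightarrow> (real^'n \<Rightarrow> real) \<Rightarrow> (real^'n \<Rightarrow> real) \<Rightarrow> bool" where
  "neumann_generator M u g \<longleftrightarrow>
     u \<in> H1 M \<and> g \<in> L2 M \<and> (\<forall>v \<in> H1 M. dirichlet_form M u v = - L2_inner M g v)"

text \<open>The orbit \<open>t \<mapsto> u t\<close> of \<open>f\<close> under the Neumann semigroup, characterised as the solution of the
  abstract Cauchy problem in \<open>L\<^sup>2\<close>: the generator is self-adjoint and nonpositive, so for every
  \<open>f\<close> there is exactly one solution up to null sets.\<close>

definition neumann_orbit ::
  "(real^'n) set \<Rightarrow> (real^'n \<Rightarrow> real) \<Rightarrow> (real \<Rightarrow> real^'n \<Rightarrow> real) \<Rightarrow> bool" where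
  "neumann_orbit M f u \<longleftrightarrow>
     (\<forall>t\<ge>0. u t \<in> L2 M) \<and> (AE x in mu M. u 0 x = f x) \<and>
     ((\<lambda>t. L2_norm M (\<lambda>x. u t x - f x)) \<longlongrightarrow> 0) (at_right 0) \<and>
     (\<forall>t>0. \<exists>g. neumann_generator M (u t) g \<and>
        ((\<lambda>h. L2_norm M (\<lambda>x. (u (t + h) x - u t x) / h - g x)) \<longlongrightarrow> 0) (at 0))"

definition neumann_semigroup_compact :: "(real^'n) set \<Rightarrow> bool" where
  "neumann_semigroup_compact M \<longleftrightarrow>
     (\<forall>f \<in> L2 M. \<exists>u. neumann_orbit M f u) \<and>
     (\<forall>t>0. \<forall>F u. (\<forall>k :: nat. F k \<in> L2 M \<and> L2_norm M (F k) \<le> 1 \<and> neumann_orbit M (F k) (u k)) \<longrightarrow>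
        (\<exists>r w. strict_mono r \<and> w \<in> L2 M \<and>
           (\<lambda>k. L2_norm M (\<lambda>x. u (r k) t x - w x)) \<longlonglongrightarrow> 0))"

text \<open>Discreteness of the spectrum with spectral gap at least \<open>\<gamma>\<close>: an orthonormal basis of
  eigenfunctions whose eigenvalues, counted with multiplicity, satisfy
  \<open>0 = l 0 < \<gamma> \<le> l 1 \<le> l 2 \<le> \<dots>\<close> and tend to infinity.\<close>

definition neumann_spectrum_discrete_with_gap :: "(real^'n) set \<Rightarrow> real \<Rightarrow> bool" where
  "neumann_spectrum_discrete_with_gap M \<gamma> \<longleftrightarrow>
     (\<exists>(e :: nat \<Rightarrow> real^'n \<Rightarrow> real) (l :: nat \<Rightarrow> real).
        (\<forall>j k. L2_inner M (e j) (e k) = (if j = k then 1 else 0)) \<and>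
        (\<forall>f \<in> L2 M. (\<lambda>N. L2_norm M (\<lambda>x. f x - (\<Sum>k<N. L2_inner M f (e k) * e k x))) \<longlonglongrightarrow> 0) \<and>
        (\<forall>k. neumann_generator M (e k) (\<lambda>x. - l k * e k x)) \<and>
        mono l \<and> filterlim l at_top sequentially \<and> l 0 = 0 \<and> \<gamma> \<le> l 1)"


section \<open>Reflected Brownian motion\<close>

definition path_space :: "(real^'n) set \<Rightarrow> (real \<Rightarrow> real^'n) measure" where
  "path_space M =
     restrict_space (PiM {0..} (\<lambda>_. borel)) {\<omega>. continuous_on {0..} \<omega> \<and> \<omega> ` {0..} \<subseteq> M}"

definition past_events :: "(real^'n) set \<Rightarrow> real \<Rightarrow> (real \<Rightarrow> real^'n) set set" where
  "past_events M s =
     sigma_sets (space (path_space M))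
       {{\<omega> \<in> space (path_space M). \<omega> r \<in> B} | r B. 0 \<le> r \<and> r \<le> s \<and> B \<in> sets borel}"

text \<open>The law of reflected Brownian motion started at \<open>x\<close>, as the solution on the space of
  continuous paths in \<open>M\<close> of the martingale problem for half the Neumann Laplacian, restricted to
  continuous functions with continuous image.\<close>

definition is_reflected_BM_law ::
  "(real^'n) set \<Rightarrow> real^'n \<Rightarrow> (real \<Rightarrow> real^'n) measure \<Rightarrow> bool" where
  "is_reflected_BM_law M x Q \<longleftrightarrow>
     prob_space Q \<and> sets Q = sets (path_space M) \<and> (AE \<omega> in Q. \<omega> 0 = x) \<and>
     (\<forall>f g. continuous_on M f \<and> continuous_on M g \<and> neumann_generator M f g \<longrightarrow>
        (\<forall>s t. \<forall>A \<in> past_events M s. 0 \<le> s \<and> s \<le> t \<longrightarrow>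
           (\<integral>\<omega>\<in>A. (f (\<omega> t) - f (\<omega> 0) - integral {0..t} (\<lambda>r. g (\<omega> r))) \<partial>Q)
             = (\<integral>\<omega>\<in>A. (f (\<omega> s) - f (\<omega> 0) - integral {0..s} (\<lambda>r. g (\<omega> r))) \<partial>Q)))"

text \<open>A symmetric kernel that represents the Neumann semigroup and is the transition density, with
  respect to \<open>mu M\<close>, of reflected Brownian motion from every starting point.\<close>

definition is_neumann_heat_kernel ::
  "(real^'n) set \<Rightarrow> (real \<Rightarrow> real^'n \<Rightarrow> real^'n \<Rightarrow> real) \<Rightarrow> bool" where
  "is_neumann_heat_kernel M p \<longleftrightarrow>
     (\<forall>t>0. (\<lambda>(x, y). p t x y) \<in> borel_measurable borel) \<and>
     (\<forall>t>0. \<forall>x\<in>M. \<forall>y\<in>M. 0 \<le> p t x y \<and> p t x y = p t y x) \<and>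
     (\<forall>f \<in> L2 M.
        (\<forall>t>0. AE x in mu M. integrable (mu M) (\<lambda>y. p t x y * f y)) \<and>
        neumann_orbit M f (\<lambda>t x. if t > 0 then \<integral>y. p t x y * f y \<partial>mu M else f x)) \<and>
     (\<forall>x\<in>M. \<forall>Q. is_reflected_BM_law M x Q \<longrightarrow>
        (\<forall>t>0. \<forall>B \<in> sets borel.
           emeasure Q {\<omega> \<in> space Q. \<omega> t \<in> B} = (\<integral>\<^sup>+y\<in>B. ennreal (p t x y) \<partial>mu M)))"


section \<open>Standing assumptions\<close>

text \<open>The quantitative data on which constants may depend. \<open>rad_ch\<close> is the fixed scale of the
  charts, \<open>jlo_ch\<close> and \<open>jhi_ch\<close> bound the Jacobian determinants of the charts and of their inverses,
  and \<open>reach_lb\<close>, \<open>gap_lb\<close> are lower bounds for the reach and the Neumann spectral gap.\<close>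

record domain_data =
  reach_lb :: real
  c_ie :: real
  rho_ie :: real
  c_vol :: real
  C_vol :: real
  rho_vol :: real
  rho_ch :: real
  L_ch :: real
  rad_ch :: real
  jlo_ch :: real
  jhi_ch :: real
  gap_lb :: real

definition jacobian_bounds :: "real \<Rightarrow> real \<Rightarrow> (real^'n) set \<Rightarrow> (real^'n \<Rightarrow> real^'n) \<Rightarrow> bool" where
  "jacobian_bounds a b U \<Psi> \<longleftrightarrow>
     (AE y in lebesgue. y \<in> interior U \<longrightarrow>
        (\<exists>D. (\<Psi> has_derivative D) (at y) \<and> a \<le> \<bar>det (matrix D)\<bar> \<and> \<bar>det (matrix D)\<bar> \<le> b))"

definition is_chart ::
  "domain_data \<Rightarrow> (real^'n) set \<Rightarrow> real^'n \<Rightarrow> (real^'n) set \<Rightarrow> (real^'n \<Rightarrow> real^'n) \<Rightarrow> bool" where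
  "is_chart D M x U \<Psi> \<longleftrightarrow>
     U \<subseteq> M \<and> x \<in> top_of_set M interior_of U \<and>
     inj_on \<Psi> U \<and> (L_ch D)-lipschitz_on U \<Psi> \<and> (L_ch D)-lipschitz_on (\<Psi> ` U) (inv_into U \<Psi>) \<and>
     jacobian_bounds (jlo_ch D) (jhi_ch D) U \<Psi> \<and>
     jacobian_bounds (jlo_ch D) (jhi_ch D) (\<Psi> ` U) (inv_into U \<Psi>) \<and>
     (if infdist x (frontier M) \<ge> rho_ch D
      then \<exists>a. \<Psi> ` U = ball a (rad_ch D)
      else \<exists>a \<nu>. norm \<nu> = 1 \<and> \<Psi> ` U = {z \<in> ball a (rad_ch D). 0 \<le> (z - a) \<bullet> \<nu>} \<and>
             \<Psi> ` (U \<inter> frontier M) \<subseteq> {z. (z - a) \<bullet> \<nu> = 0})"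

definition admissible_reflecting_domain :: "domain_data \<Rightarrow> (real^'n) set \<Rightarrow> bool" where
  "admissible_reflecting_domain D M \<longleftrightarrow>
     (\<forall>x\<in>M. \<exists>!Q. is_reflected_BM_law M x Q) \<and>
     (\<exists>p. is_neumann_heat_kernel M p) \<and>
     neumann_semigroup_compact M \<and>
     0 < gap_lb D \<and> neumann_spectrum_discrete_with_gap M (gap_lb D) \<and>
     0 < rho_ch D \<and> 1 \<le> L_ch D \<and> 0 < rad_ch D \<and> 0 < jlo_ch D \<and>
     (\<forall>x\<in>M. \<exists>U \<Psi>. is_chart D M x U \<Psi>)"

definition standing_assumptions :: "domain_data \<Rightarrow> (real^'n) set \<Rightarrow> bool" where
  "standing_assumptions D M \<longleftrightarrow>
     (\<exists>\<Omega>. open \<Omega> \<and> connected \<Omega> \<and> bounded \<Omega> \<and> \<Omega> \<noteq> {} \<and> M = closure \<Omega>) \<and>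
     0 < reach_lb D \<and> ereal (reach_lb D) \<le> reach M \<and>
     1 \<le> c_ie D \<and> 0 < rho_ie D \<and>
     (\<forall>x\<in>M. \<forall>y\<in>M. dist x y < rho_ie D \<longrightarrow> intrinsic_dist M x y \<le> ennreal (c_ie D * dist x y)) \<and>
     0 < c_vol D \<and> 0 < C_vol D \<and> 0 < rho_vol D \<and>
     (\<forall>x\<in>M. \<forall>\<epsilon>. 0 < \<epsilon> \<and> \<epsilon> < rho_vol D \<longrightarrow>
        c_vol D * \<epsilon> ^ CARD('n) \<le> measure (mu M) (intrinsic_ball M x \<epsilon>) \<and>
        measure (mu M) (intrinsic_ball M x \<epsilon>) \<le> C_vol D * \<epsilon> ^ CARD('n)) \<and>
     admissible_reflecting_domain D M"

end

theory Submission
  imports Defs "HOL-Real_Asymp.Real_Asymp"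
begin

text \<open>
  Let \<open>B\<close> be the intrinsic ball of radius \<open>\<epsilon>\<close> around \<open>x\<close>, and let \<open>d\<close> be the dimension.

  Upper bound. A Euclidean ball of small radius \<open>s\<close> around \<open>x\<close> carries mass at most of order \<open>s\<^sup>d\<close>. For \<open>d \<ge> 3\<close> a
  function that rises from 0 to 1 between the radii \<open>\<epsilon>\<close> and \<open>2 \<epsilon>\<close> has energy of order
  \<open>\<epsilon>\<^sup>d\<^sup>-\<^sup>2\<close>. In the plane the rise is distributed evenly over the \<open>N\<close> dyadic annuli
  between \<open>\<epsilon>\<close> and a fixed radius. Each annulus then contributes energy of order \<open>N\<^sup>-\<^sup>2\<close>, which gives
  \<open>N\<^sup>-\<^sup>1\<close> in total, and \<open>N\<close> is of order \<open>log (1 / \<epsilon>)\<close>. Both cases are instances of one cut-off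
  (\<open>principal_eigenvalue_le_cutoff\<close>, \<open>cutoff_scale_exists\<close>).

  Lower bound. A chart parametrises a neighbourhood of \<open>x = \<Phi> z\<close> by a convex set \<open>W\<close>, a ball or a half-ball
  of fixed radius. Images of segments in \<open>W\<close> are curves in \<open>M\<close>, so for \<open>\<tau>\<close> of order \<open>\<epsilon>\<close> the image of
  \<open>z + \<tau> (W - z)\<close> lies in \<open>B\<close>, wherever \<open>z\<close> is in \<open>W\<close>. A function \<open>f\<close> that vanishes on \<open>B\<close> is therefore
  at \<open>\<Phi> y\<close> the integral of its derivative along the image of the segment from \<open>z + \<tau> (y - z)\<close> to \<open>y\<close>. The
  Cauchy--Schwarz inequality with weight \<open>t\<^sup>d\<^sup>-\<^sup>1\<close> and the substitution
  \<open>w = z + t (y - z)\<close> bound the integral of \<open>(f \<circ> \<Phi>)\<^sup>2\<close> over \<open>W\<close> by the integral of \<open>t\<^sup>1\<^sup>-\<^sup>d\<close> over \<open>[\<tau>, 1]\<close>,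
  which is of order \<open>1 / \<kappa>(\<epsilon>)\<close>, times the energy (\<open>cone_integral_le\<close>, \<open>cone_vanishing_estimate\<close>). The
  spectral gap bounds the variance of \<open>f\<close> by the energy (\<open>spectral_gap_Poincare\<close>). On the image of the
  chart, which has volume bounded below, \<open>f\<close> is small and also close to its mean; hence the mean
  is small, and with it the whole norm (\<open>chart_lower_bound\<close>).

  Sobolev functions are handled through mollification. Their mollifications are differentiable inside
  \<open>M\<close>, with the mollified weak gradient as derivative (\<open>moll_line_derivative\<close>), and converge almost
  everywhere (\<open>mollifiers_converge_AE\<close>). An upper gradient inequality along Lipschitz
  curves takes the place of a chain rule for the composition with a chart, and the bounded distortion
  of volume takes the place of its Jacobian (\<open>upper_gradient_Lipschitz_curve\<close>, \<open>nn_integral_expansive_le\<close>).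
  The same mollifications show that weak gradients are unique (\<open>weak_gradient_unique\<close>), which makes the energy of an explicit test function computable.
\<close>

section \<open>Smooth bump functions\<close>

text \<open>The functions \<open>p(t) (1 - t\<^sup>2)\<^sup>-\<^sup>k exp (- 1 / (1 - t\<^sup>2))\<close>, extended by zero, form a family that is closed under
  differentiation. Carrying the polynomial and the exponent along makes smoothness of every member
  an induction that needs no formula for higher derivatives.\<close>

definition bump_term :: "real poly \<Rightarrow> nat \<Rightarrow> real \<Rightarrow> real" where
  "bump_term p k t = (if \<bar>t\<bar> < 1 then poly p t / (1 - t\<^sup>2) ^ k * exp (- 1 / (1 - t\<^sup>2)) else 0)"

text \<open>The derivative of \<open>bump_term p k\<close> is again a member of the family, with exponent \<open>k + 2\<close> and this
  polynomial.\<close>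

definition bump_numerator :: "real poly \<Rightarrow> nat \<Rightarrow> real poly" where
  "bump_numerator p k =
     pderiv p * [:1, 0, -1:] ^ 2 + p * [:0, 2 * real k:] * [:1, 0, -1:] - [:0, 2:] * p"

text \<open>One term of the exponential series of \<open>1 / q\<close> suffices. With \<open>m = k + 2\<close> the bound absorbs the pole
  of \<open>bump_term p k\<close> and leaves a factor \<open>q\<^sup>2\<close>.\<close>

lemma exp_minus_inverse_le:
  fixes q :: real
  assumes "0 < q"
  shows "exp (- 1 / q) \<le> fact m * q ^ m"
proof -
  have "(1 / q) ^ m / fact m \<le> exp (1 / q)"
  proof -
    have s: "(\<lambda>n. (1 / q) ^ n /\<^sub>R fact n) sums exp (1 / q)"
      by (rule exp_converges)
    have "sum (\<lambda>n. (1 / q) ^ n /\<^sub>R fact n) {m} \<le> (\<Sum>n. (1 / q) ^ n /\<^sub>R fact n)"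
      using s assms by (intro sum_le_suminf sums_summable[OF s]) auto
    also have "\<dots> = exp (1 / q)" using sums_unique[OF s] by simp
    finally show ?thesis by (simp add: divide_inverse mult.commute)
  qed
  then have "1 / (fact m * q ^ m) \<le> exp (1 / q)"
    by (simp add: power_divide field_simps)
  then have "1 \<le> exp (1 / q) * (fact m * q ^ m)"
    using assms by (simp add: divide_le_eq)
  moreover have "exp (- 1 / q) = 1 / exp (1 / q)"
    by (simp add: exp_minus field_simps)
  ultimately show ?thesis
    by (simp add: divide_le_eq mult.commute)
qed

text \<open>Quadratic decay towards the points outside the open interval: there the derivative exists and is
  zero, which joins the two branches of the definition smoothly.\<close>

lemma bump_term_le_square:
  "\<exists>C\<ge>0. \<forall>s t. 1 \<le> \<bar>t\<bar> \<longrightarrow> \<bar>bump_term p k s\<bar> \<le> C * (s - t)\<^sup>2"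
proof -
  have "compact (poly p ` {-1..1})"
    by (intro compact_continuous_image continuous_intros) auto
  then obtain P where P: "\<And>s. s \<in> {-1..1} \<Longrightarrow> \<bar>poly p s\<bar> \<le> P"
    using compact_imp_bounded[THEN bounded_iff[THEN iffD1]] by fastforce
  have "0 \<le> P" using P[of 0] by auto
  show ?thesis
  proof (intro exI[of _ "4 * P * fact (k + 2)"] conjI allI impI)
    show "0 \<le> 4 * P * fact (k + 2)" using \<open>0 \<le> P\<close> by simp
    fix s t :: real assume t: "1 \<le> \<bar>t\<bar>"
    show "\<bar>bump_term p k s\<bar> \<le> 4 * P * fact (k + 2) * (s - t)\<^sup>2"
    proof (cases "\<bar>s\<bar> < 1")
      case True
      define q where "q = 1 - s\<^sup>2"
      have q: "0 < q" using True by (simp add: q_def abs_square_less_1)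
      have "q = (1 - \<bar>s\<bar>) * (1 + \<bar>s\<bar>)" by (simp add: q_def algebra_simps power2_eq_square)
      also have "\<dots> \<le> (1 - \<bar>s\<bar>) * 2" using True by (intro mult_left_mono) auto
      also have "\<dots> \<le> 2 * \<bar>s - t\<bar>" using t abs_triangle_ineq2[of t s] by (simp add: abs_minus_commute)
      finally have "q\<^sup>2 \<le> (2 * \<bar>s - t\<bar>)\<^sup>2" using q by (intro power_mono) auto
      then have q2: "q\<^sup>2 \<le> 4 * (s - t)\<^sup>2" by (simp add: power_mult_distrib)
      have "\<bar>bump_term p k s\<bar> = \<bar>poly p s\<bar> / q ^ k * exp (- 1 / q)"
        using True q by (simp add: bump_term_def q_def[symmetric] abs_mult)
      also have "\<dots> \<le> P / q ^ k * (fact (k + 2) * q ^ (k + 2))"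
      proof (intro mult_mono divide_right_mono)
        show "\<bar>poly p s\<bar> \<le> P" using True by (intro P) (simp add: abs_le_iff abs_less_iff)
        show "exp (- 1 / q) \<le> fact (k + 2) * q ^ (k + 2)" by (rule exp_minus_inverse_le[OF q])
      qed (use q \<open>0 \<le> P\<close> in auto)
      also have "\<dots> = P * fact (k + 2) * q\<^sup>2" using q by (simp add: power_add power2_eq_square)
      also have "\<dots> \<le> P * fact (k + 2) * (4 * (s - t)\<^sup>2)"
        using q2 \<open>0 \<le> P\<close> by (intro mult_left_mono) auto
      finally show ?thesis by (simp only: mult_ac)
    qed (use \<open>0 \<le> P\<close> in \<open>simp add: bump_term_def\<close>)
  qed
qed

lemma has_derivative_zero_of_le_square:
  fixes h :: "real \<Rightarrow> real"
  assumes "\<And>s. \<bar>h s - h t\<bar> \<le> C * (s - t)\<^sup>2"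
  shows "(h has_real_derivative 0) (at t)"
proof -
  have "((\<lambda>s. (h s - h t) / (s - t)) \<longlongrightarrow> 0) (at t)"
  proof (rule Lim_null_comparison)
    show "\<forall>\<^sub>F s in at t. norm ((h s - h t) / (s - t)) \<le> C * \<bar>s - t\<bar>"
      unfolding eventually_at_filter
    proof (rule always_eventually, intro allI impI)
      fix s assume "s \<noteq> t"
      then show "norm ((h s - h t) / (s - t)) \<le> C * \<bar>s - t\<bar>"
        using assms[of s] by (simp add: abs_divide divide_le_eq power2_eq_square mult_ac abs_mult_self_eq)

    qed
    have "((\<lambda>s. C * \<bar>s - t\<bar>) \<longlongrightarrow> C * \<bar>t - t\<bar>) (at t)" by (intro tendsto_intros)
    then show "((\<lambda>s. C * \<bar>s - t\<bar>) \<longlongrightarrow> 0) (at t)" by simp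
  qed
  then show ?thesis by (simp add: has_field_derivative_iff)
qed

lemma bump_term_has_derivative:
  "(bump_term p k has_real_derivative bump_term (bump_numerator p k) (k + 2) t) (at t)"
proof (cases "\<bar>t\<bar> < 1")
  case True
  define q where "q = 1 - t\<^sup>2"
  have q: "0 < q" using True by (simp add: q_def abs_square_less_1)
  have "((\<lambda>t. poly p t / (1 - t\<^sup>2) ^ k * exp (- 1 / (1 - t\<^sup>2))) has_real_derivative
          ((poly (pderiv p) t * q ^ k - poly p t * (real k * q ^ (k - 1) * (- 2 * t))) / (q ^ k * q ^ k)
             * exp (- 1 / q)
           + poly p t / q ^ k * (exp (- 1 / q) * ((- 2 * t) / (q * q))))) (at t)"
  proof -
    have dq: "((\<lambda>t. 1 - t\<^sup>2) has_real_derivative - 2 * t) (at t)"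
      by (auto intro!: derivative_eq_intros)
    have 1: "((\<lambda>t. poly p t / (1 - t\<^sup>2) ^ k) has_real_derivative
        (poly (pderiv p) t * q ^ k - poly p t * (real k * q ^ (k - 1) * (- 2 * t))) / (q ^ k * q ^ k)) (at t)"
      using DERIV_divide[OF poly_DERIV DERIV_power[OF dq], of k p] q
      by (simp add: q_def[symmetric] mult_ac)
    have 2: "((\<lambda>t. exp (- 1 / (1 - t\<^sup>2))) has_real_derivative exp (- 1 / q) * ((- 2 * t) / (q * q))) (at t)"
      using DERIV_chain2[OF DERIV_exp DERIV_divide[OF DERIV_const dq], of "- 1"] q
      by (simp add: q_def[symmetric])
    show ?thesis
      using DERIV_mult[OF 1 2] by (simp add: q_def add.commute mult_ac)
  qed
  moreover have "((poly (pderiv p) t * q ^ k - poly p t * (real k * q ^ (k - 1) * (- 2 * t))) / (q ^ k * q ^ k)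
             * exp (- 1 / q)
           + poly p t / q ^ k * (exp (- 1 / q) * ((- 2 * t) / (q * q))))
      = bump_term (bump_numerator p k) (k + 2) t"
  proof -
    have num: "poly (bump_numerator p k) t
        = poly (pderiv p) t * q\<^sup>2 + poly p t * (2 * real k * t) * q - 2 * t * poly p t"
      by (simp add: bump_numerator_def q_def algebra_simps power2_eq_square)
    have k: "real k * q ^ (k - 1) * q = real k * q ^ k"
      by (cases k) auto
    have kk: "real k * q ^ (k - 1) = real k * q ^ k / q"
      using k q by (simp add: field_simps)
    have "bump_term (bump_numerator p k) (k + 2) t
       = (poly (pderiv p) t * q\<^sup>2 + poly p t * (2 * real k * t) * q - 2 * t * poly p t) / (q ^ k * (q * q)) * exp (- 1 / q)"
      using True by (simp add: bump_term_def num q_def[symmetric] power_add power2_eq_square[of q])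
    moreover have "((d * Q - b * (r * Q / q * (- 2 * t))) / (Q * Q) * e
        + b / Q * (e * ((- 2 * t) / (q * q)))) =
        (d * q\<^sup>2 + b * (2 * r * t) * q - 2 * t * b) / (Q * (q * q)) * e"
      if "Q \<noteq> 0" for d b e Q r :: real
      using q that by (simp add: divide_simps power2_eq_square) (simp add: algebra_simps)
    note this[of "q ^ k" _ _ "real k"]
    ultimately show ?thesis unfolding kk using q by simp
  qed
  ultimately have "((\<lambda>t. poly p t / (1 - t\<^sup>2) ^ k * exp (- 1 / (1 - t\<^sup>2))) has_real_derivative
      bump_term (bump_numerator p k) (k + 2) t) (at t)" by simp
  moreover have "open {s::real. \<bar>s\<bar> < 1}" by (intro open_Collect_less continuous_intros)
  ultimately show ?thesis
    using True by (elim has_field_derivative_transform_within_open) (auto simp: bump_term_def)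
next
  case False
  obtain C where C: "\<And>s t. 1 \<le> \<bar>t\<bar> \<Longrightarrow> \<bar>bump_term p k s\<bar> \<le> C * (s - t)\<^sup>2"
    using bump_term_le_square by blast
  have "(bump_term p k has_real_derivative 0) (at t)"
    using False by (intro has_derivative_zero_of_le_square[of _ _ C])
      (use C[of t] in \<open>auto simp: bump_term_def\<close>)
  then show ?thesis using False by (simp add: bump_term_def)
qed

lemma continuous_bump_term: "continuous_on A (bump_term p k)"
  by (intro continuous_at_imp_continuous_on ballI DERIV_isCont[OF bump_term_has_derivative])

lemma continuous_bump_term' [continuous_intros]:
  "continuous_on A f \<Longrightarrow> continuous_on A (\<lambda>x. bump_term p k (f x))"
  by (rule continuous_on_compose2[OF continuous_bump_term[of UNIV]]) auto

lemma bump_term_bounded: "\<exists>C. \<forall>t. \<bar>bump_term p k t\<bar> \<le> C"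
proof -
  have "compact (bump_term p k ` {-1..1})"
    by (intro compact_continuous_image continuous_bump_term) auto
  then obtain P where P: "\<And>s. s \<in> {-1..1} \<Longrightarrow> \<bar>bump_term p k s\<bar> \<le> P"
    using compact_imp_bounded[THEN bounded_iff[THEN iffD1]] by fastforce
  have "\<bar>bump_term p k t\<bar> \<le> \<bar>P\<bar>" for t
  proof (cases "\<bar>t\<bar> < 1")
    case True
    then have "t \<in> {-1..1}" by auto
    then show ?thesis using P[of t] by simp
  qed (simp add: bump_term_def)
  then show ?thesis by blast
qed

text \<open>Products of one-dimensional bumps, one factor per coordinate: a partial derivative changes a single
  factor and stays within its family, so that all iterated partial derivatives are of this form.\<close>

definition tensor_bump ::
  "real \<Rightarrow> real^'n \<Rightarrow> real \<Rightarrow> ('n \<Rightarrow> real poly) \<Rightarrow> ('n \<Rightarrow> nat) \<Rightarrow> real^'n \<Rightarrow> real" where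
  "tensor_bump c a r p k y = c * (\<Prod>i\<in>UNIV. bump_term (p i) (k i) ((a $ i - y $ i) / r))"

lemma tensor_bump_coordinate_derivative:
  fixes a :: "real^'n"
  shows "((\<lambda>t. tensor_bump c a r p k (x + t *\<^sub>R axis j 1)) has_real_derivative
      tensor_bump (- c / r) a r (p(j := bump_numerator (p j) (k j))) (k(j := k j + 2)) x) (at 0)"
proof -
  let ?R = "\<Prod>i\<in>UNIV - {j}. bump_term (p i) (k i) ((a $ i - x $ i) / r)"
  have split: "tensor_bump c a r p k (x + t *\<^sub>R axis j 1)
      = c * (bump_term (p j) (k j) ((a $ j - x $ j - t) / r) * ?R)" for t
  proof -
    have "(\<Prod>i\<in>UNIV. bump_term (p i) (k i) ((a $ i - (x + t *\<^sub>R axis j 1) $ i) / r))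
       = bump_term (p j) (k j) ((a $ j - x $ j - t) / r) *
         (\<Prod>i\<in>UNIV - {j}. bump_term (p i) (k i) ((a $ i - (x + t *\<^sub>R axis j 1) $ i) / r))"
      by (subst prod.remove[of _ j]) (auto simp: axis_def diff_diff_eq)
    also have "(\<Prod>i\<in>UNIV - {j}. bump_term (p i) (k i) ((a $ i - (x + t *\<^sub>R axis j 1) $ i) / r)) = ?R"
      by (intro prod.cong) (auto simp: axis_def)
    finally show ?thesis by (simp add: tensor_bump_def)
  qed
  have "((\<lambda>t. c * (bump_term (p j) (k j) ((a $ j - x $ j - t) / r) * ?R)) has_real_derivative
     c * (bump_term (bump_numerator (p j) (k j)) (k j + 2) ((a $ j - x $ j - 0) / r) * (- 1 / r) * ?R)) (at 0)"
    by (rule DERIV_cmult DERIV_cmult_right DERIV_chain2[OF bump_term_has_derivative])+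
       (auto intro!: derivative_eq_intros simp: divide_inverse)
  also have "c * (bump_term (bump_numerator (p j) (k j)) (k j + 2) ((a $ j - x $ j - 0) / r) * (- 1 / r) * ?R)
    = tensor_bump (- c / r) a r (p(j := bump_numerator (p j) (k j))) (k(j := k j + 2)) x"
  proof -
    have "(\<Prod>i\<in>UNIV - {j}. bump_term ((p(j := bump_numerator (p j) (k j))) i) ((k(j := k j + 2)) i) ((a $ i - x $ i) / r)) = ?R"
      by (intro prod.cong) auto
    then show ?thesis
      unfolding tensor_bump_def
      by (subst prod.remove[of _ j]) (simp_all add: divide_inverse mult_ac)
  qed
  finally show ?thesis unfolding split .
qed

lemma partial_deriv_tensor_bump:
  "partial_deriv j (tensor_bump c a r p k) =
     tensor_bump (- c / r) a r (p(j := bump_numerator (p j) (k j))) (k(j := k j + 2))"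
  unfolding partial_deriv_def
  by (rule ext, rule DERIV_imp_deriv, rule tensor_bump_coordinate_derivative)

lemma smooth_tensor_bump: "smooth_fun (tensor_bump c a r p k)"
proof -
  have iter: "\<exists>c' p' k'. foldr partial_deriv is (tensor_bump c a r p k) = tensor_bump c' a r p' k'" for "is"
  proof (induction "is")
    case Nil
    show ?case by auto
  next
    case (Cons j js)
    then obtain c' p' k' where "foldr partial_deriv js (tensor_bump c a r p k) = tensor_bump c' a r p' k'"
      by blast
    then have "foldr partial_deriv (j # js) (tensor_bump c a r p k) =
        tensor_bump (- c' / r) a r (p'(j := bump_numerator (p' j) (k' j))) (k'(j := k' j + 2))"
      by (simp add: partial_deriv_tensor_bump)
    then show ?case by blast
  qed
  have cont: "continuous_on UNIV (tensor_bump c a r p k)" for c p k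
    unfolding tensor_bump_def divide_inverse by (intro continuous_intros)
  have diff: "(\<lambda>t. tensor_bump c a r p k (x + t *\<^sub>R axis i 1)) differentiable (at (0::real))" for c p k i x
    using tensor_bump_coordinate_derivative real_differentiable_def by blast
  show ?thesis
    unfolding smooth_fun_def
  proof (intro allI conjI)
    fix "is" i x
    obtain c' p' k' where *: "foldr partial_deriv is (tensor_bump c a r p k) = tensor_bump c' a r p' k'"
      using iter by blast
    show "continuous_on UNIV (foldr partial_deriv is (tensor_bump c a r p k))"
      unfolding * by (rule cont)
    show "(\<lambda>t. foldr partial_deriv is (tensor_bump c a r p k) (x + t *\<^sub>R axis i 1)) differentiable (at (0::real))"
      unfolding * by (rule diff)
  qed
qed

lemma nn_integral_lborel_affine:
  fixes h :: "'a::euclidean_space \<Rightarrow> ennreal"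
  assumes [measurable]: "h \<in> borel_measurable borel" and c: "c \<noteq> 0"
  shows "(\<integral>\<^sup>+x. h x \<partial>lborel) = ennreal (\<bar>c\<bar> ^ DIM('a)) * (\<integral>\<^sup>+x. h (t + c *\<^sub>R x) \<partial>lborel)"
proof -
  have "(\<integral>\<^sup>+x. h x \<partial>lborel) = (\<integral>\<^sup>+x. h x \<partial>density (distr lborel borel (\<lambda>x. t + c *\<^sub>R x)) (\<lambda>_. ennreal (\<bar>c\<bar> ^ DIM('a))))"
    using lborel_affine[OF c, of t] by simp
  also have "\<dots> = (\<integral>\<^sup>+x. ennreal (\<bar>c\<bar> ^ DIM('a)) * h (t + c *\<^sub>R x) \<partial>lborel)"
    by (simp add: nn_integral_density nn_integral_distr)
  finally show ?thesis by (simp add: nn_integral_cmult)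
qed

lemma nn_integral_lborel_translate:
  fixes h :: "'a::euclidean_space \<Rightarrow> ennreal"
  assumes "h \<in> borel_measurable borel"
  shows "(\<integral>\<^sup>+x. h (x - y) \<partial>lborel) = (\<integral>\<^sup>+x. h x \<partial>lborel)"
    and "(\<integral>\<^sup>+x. h (y - x) \<partial>lborel) = (\<integral>\<^sup>+x. h x \<partial>lborel)"
  using nn_integral_lborel_affine[OF assms, of 1 "- y"] nn_integral_lborel_affine[OF assms, of "-1" y]
  by auto

text \<open>A smooth probability density of small support, with its gradient. The last two assumptions say that
  the reflected translates of the density are test functions, with the expected derivatives; through
  them the weak gradient acquires a classical meaning after mollification.\<close>

locale mollifier =
  fixes r :: real and \<rho> :: "real^'n \<Rightarrow> real" and \<rho>' :: "real^'n \<Rightarrow> real^'n"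
  assumes nonneg: "0 \<le> \<rho> x"
    and support: "r \<le> norm x \<Longrightarrow> \<rho> x = 0"
    and mass: "(\<integral>\<^sup>+x. ennreal (\<rho> x) \<partial>lborel) = 1"
    and bounded_by: "\<exists>B. \<forall>x. \<bar>\<rho> x\<bar> \<le> B" "\<exists>B. \<forall>x. norm (\<rho>' x) \<le> B"
    and continuous_gradient: "continuous_on UNIV \<rho>'"
    and derivative: "(\<rho> has_derivative (\<lambda>v. \<rho>' x \<bullet> v)) (at x)"
    and test_function: "cball a r \<subseteq> \<Omega> \<Longrightarrow> test_function \<Omega> (\<lambda>y. \<rho> (a - y))"
    and partial_deriv: "partial_deriv i (\<lambda>y. \<rho> (a - y)) y = - \<rho>' (a - y) $ i"

text \<open>The cube of half side \<open>\<delta> / n\<close> lies in the ball of radius \<open>\<delta>\<close>, because the Euclidean norm is at most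
  the sum of the absolute values of the coordinates. So a normalised product of bumps on that cube
  has the right support.\<close>

lemma mollifier_exists:
  assumes "0 < \<delta>"
  shows "\<exists>\<rho> \<rho>'. mollifier \<delta> (\<rho> :: real^'n \<Rightarrow> real) \<rho>'"
proof -
  define b where "b = bump_term [:1:] 0"
  define s where "s = \<delta> / real CARD('n)"
  have s: "0 < s" using assms by (simp add: s_def)
  define \<rho>0 where "\<rho>0 x = (\<Prod>i\<in>UNIV. b (x $ i / s))" for x :: "real^'n"
  have b0: "0 \<le> b t" for t by (simp add: b_def bump_term_def)
  have bz: "b t = 0" if "1 \<le> \<bar>t\<bar>" for t using that by (simp add: b_def bump_term_def)
  have bp: "0 < b 0" by (simp add: b_def bump_term_def)
  have nonneg0: "0 \<le> \<rho>0 x" for x by (simp add: \<rho>0_def b0 prod_nonneg)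
  have supp0: "\<rho>0 x = 0" if "\<delta> \<le> norm x" for x
  proof -
    have "\<exists>i. s \<le> \<bar>x $ i\<bar>"
    proof (rule ccontr)
      assume "\<not> ?thesis"
      then have "(\<Sum>i\<in>UNIV. \<bar>x $ i\<bar>) < (\<Sum>i\<in>(UNIV::'n set). s)"
        by (intro sum_strict_mono) (auto simp: not_le)
      then have "(\<Sum>i\<in>UNIV. \<bar>x $ i\<bar>) < \<delta>" by (simp add: s_def)
      then show False using norm_le_l1_cart[of x] that by simp
    qed
    then obtain i where "s \<le> \<bar>x $ i\<bar>" by blast
    then have "b (x $ i / s) = 0" using s by (intro bz) (simp add: abs_divide)
    then show ?thesis unfolding \<rho>0_def by (metis UNIV_I finite prod_zero)
  qed
  have cont0: "continuous_on UNIV \<rho>0"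
    unfolding \<rho>0_def b_def divide_inverse by (intro continuous_intros)
  have [measurable]: "\<rho>0 \<in> borel_measurable borel"
    using cont0 by (rule borel_measurable_continuous_onI)
  have "\<exists>C. \<forall>t. \<bar>b t\<bar> \<le> C" unfolding b_def by (rule bump_term_bounded)
  then obtain C where C: "\<And>t. \<bar>b t\<bar> \<le> C" by blast
  have "0 \<le> C" using C[of 0] by linarith
  have bd0: "\<bar>\<rho>0 x\<bar> \<le> C ^ CARD('n)" for x
    unfolding \<rho>0_def abs_prod using prod_mono[of UNIV "\<lambda>i. \<bar>b (x $ i / s)\<bar>" "\<lambda>_. C"] C
    by simp
  have "integrable lborel (\<lambda>x. indicator (cball 0 \<delta>) x *\<^sub>R \<rho>0 x)"
    by (rule borel_integrable_compact) (use cont0 continuous_on_subset in auto)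
  moreover have "(\<lambda>x. indicator (cball 0 \<delta>) x *\<^sub>R \<rho>0 x) = \<rho>0"
    using supp0 by (auto simp: fun_eq_iff indicator_def)
  ultimately have int0: "integrable lborel \<rho>0" by simp
  define m where "m = (\<integral>x. \<rho>0 x \<partial>lborel)"
  have "m \<noteq> 0"
  proof
    assume "m = 0"
    then have "AE x in lborel. \<rho>0 x = 0"
      using integral_nonneg_eq_0_iff_AE[OF int0] nonneg0 by (simp add: m_def)
    then have "{x. \<rho>0 x \<noteq> 0} \<in> null_sets lborel"
      by (subst (asm) AE_iff_null) auto
    then have "negligible {x. \<rho>0 x \<noteq> 0}"
      by (simp add: negligible_iff_null_sets null_sets_completionI)
    moreover have "open {x. \<rho>0 x \<noteq> 0}"
      using cont0 by (intro open_Collect_neq continuous_intros)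
    moreover have "\<rho>0 0 \<noteq> 0" using bp by (simp add: \<rho>0_def)
    ultimately show False using open_not_negligible by blast
  qed
  moreover have "0 \<le> m"
    unfolding m_def by (rule integral_nonneg_AE) (simp add: nonneg0)
  ultimately have m: "0 < m" by linarith
  define \<rho> where "\<rho> x = \<rho>0 x / m" for x
  let ?p = "\<lambda>_::'n. [:1::real:]" and ?k = "\<lambda>_::'n. 0::nat"
  let ?p' = "\<lambda>j. ?p(j := bump_numerator [:1:] 0)" and ?k' = "\<lambda>j. ?k(j := 2)"
  define \<rho>' where "\<rho>' x = (\<chi> j. - tensor_bump (- (1 / m) / s) x s (?p' j) (?k' j) 0)" for x :: "real^'n"
  have tens: "(\<lambda>y. \<rho> (a - y)) = tensor_bump (1 / m) a s ?p ?k" for a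
    by (simp add: fun_eq_iff \<rho>_def \<rho>0_def tensor_bump_def b_def)
  have comp: "\<rho>' x $ j = (1 / m / s) * (bump_term (bump_numerator [:1:] 0) 2 (x $ j / s) *
       (\<Prod>i\<in>UNIV - {j}. b (x $ i / s)))" for x j
  proof -
    have "(\<Prod>i\<in>UNIV - {j}. bump_term (?p' j i) (?k' j i) (x $ i / s)) = (\<Prod>i\<in>UNIV - {j}. b (x $ i / s))"
      by (intro prod.cong) (auto simp: b_def)
    then show ?thesis
      unfolding \<rho>'_def tensor_bump_def by (subst prod.remove[of _ j]) (simp_all)
  qed
  show ?thesis
  proof (intro exI[of _ \<rho>] exI[of _ \<rho>'] mollifier.intro)
    show "0 \<le> \<rho> x" for x using nonneg0 m by (simp add: \<rho>_def)
    show "\<rho> x = 0" if "\<delta> \<le> norm x" for x using supp0[OF that] by (simp add: \<rho>_def)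
    have "(\<integral>\<^sup>+x. ennreal (\<rho> x) \<partial>lborel) = ennreal (\<integral>x. \<rho> x \<partial>lborel)"
      using int0 nonneg0 m by (intro nn_integral_eq_integral) (auto simp: \<rho>_def)
    then show "(\<integral>\<^sup>+x. ennreal (\<rho> x) \<partial>lborel) = 1"
      using m by (simp add: \<rho>_def m_def)
    show "\<exists>B. \<forall>x. \<bar>\<rho> x\<bar> \<le> B"
      using bd0 m by (intro exI[of _ "C ^ CARD('n) / m"]) (auto simp: \<rho>_def divide_right_mono)
    show "continuous_on UNIV \<rho>'"
    proof -
      have "\<rho>' = (\<lambda>x. \<chi> j. (1 / m / s) * (bump_term (bump_numerator [:1:] 0) 2 (x $ j * inverse s) *
          (\<Prod>i\<in>UNIV - {j}. bump_term [:1:] 0 (x $ i * inverse s))))"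
        by (simp add: fun_eq_iff vec_eq_iff comp b_def divide_inverse)
      then show ?thesis
        by (simp only:) (intro continuous_on_vec_lambda continuous_intros)
    qed
    obtain C' where C': "\<And>t. \<bar>bump_term (bump_numerator [:1:] 0) 2 t\<bar> \<le> C'"
      using bump_term_bounded by blast
    have "norm (\<rho>' x) \<le> (\<Sum>j\<in>(UNIV::'n set). (1 / m / s) * (C' * (\<Prod>i\<in>UNIV - {j}. C)))" for x
    proof (rule order_trans[OF norm_le_l1_cart], rule sum_mono)
      fix j :: 'n
      have "\<bar>\<Prod>i\<in>UNIV - {j}. b (x $ i / s)\<bar> \<le> (\<Prod>i\<in>UNIV - {j}. C)"
        unfolding abs_prod using C by (intro prod_mono) auto
      then have "\<bar>bump_term (bump_numerator [:1:] 0) 2 (x $ j / s)\<bar> * \<bar>\<Prod>i\<in>UNIV - {j}. b (x $ i / s)\<bar>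
          \<le> C' * (\<Prod>i\<in>UNIV - {j}. C)"
        by (intro mult_mono C') (auto intro!: order_trans[OF abs_ge_zero C'[of 0]])
      then show "\<bar>\<rho>' x $ j\<bar> \<le> (1 / m / s) * (C' * (\<Prod>i\<in>UNIV - {j}. C))"
        unfolding comp abs_mult[of "1 / m / s"] abs_mult[of "bump_term _ _ _"]
        using m s by (simp only: abs_of_pos divide_pos_pos zero_less_one) (intro mult_left_mono, auto)
    qed
    then show "\<exists>B. \<forall>x. norm (\<rho>' x) \<le> B" by blast
    show "(\<rho> has_derivative (\<lambda>v. \<rho>' x \<bullet> v)) (at x)" for x
    proof -
      have 1: "((\<lambda>x::real^'n. b (x $ i / s)) has_derivative
          (\<lambda>v. (v $ i / s) * bump_term (bump_numerator [:1:] 0) 2 (x $ i / s))) (at x)" for i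
      proof -
        have "((\<lambda>x::real^'n. x $ i / s) has_derivative (\<lambda>v. v $ i / s)) (at x)"
          by (intro bounded_linear_imp_has_derivative bounded_linear_divide bounded_linear_compose[OF bounded_linear_divide bounded_linear_vec_nth])
        moreover have "(b has_derivative (\<lambda>h. h * bump_term (bump_numerator [:1:] 0) 2 (x $ i / s))) (at (x $ i / s))"
          using bump_term_has_derivative[of "[:1:]" 0 "x $ i / s"]
          by (simp add: has_field_derivative_def b_def mult_commute_abs numeral_2_eq_2)
        ultimately show ?thesis
          using has_derivative_compose[of "\<lambda>x::real^'n. x $ i / s"] by blast
      qed
      have "((\<lambda>x. \<rho>0 x * (1 / m)) has_derivative
          (\<lambda>v. (\<Sum>i\<in>UNIV. (v $ i / s) * bump_term (bump_numerator [:1:] 0) 2 (x $ i / s) * (\<Prod>j\<in>UNIV - {i}. b (x $ j / s))) * (1 / m))) (at x)"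
        unfolding \<rho>0_def
        by (rule has_derivative_mult_left[OF has_derivative_prod[OF 1]])
      moreover have "(\<lambda>v. (\<Sum>i\<in>UNIV. (v $ i / s) * bump_term (bump_numerator [:1:] 0) 2 (x $ i / s) * (\<Prod>j\<in>UNIV - {i}. b (x $ j / s))) * (1 / m))
          = (\<lambda>v. \<rho>' x \<bullet> v)"
        unfolding fun_eq_iff inner_vec_def comp sum_distrib_right
        by (auto intro!: sum.cong simp: divide_inverse mult_ac)
      ultimately show ?thesis by (simp add: \<rho>_def[abs_def])
    qed
    show "partial_deriv i (\<lambda>y. \<rho> (a - y)) y = - \<rho>' (a - y) $ i" for i a y
      unfolding tens partial_deriv_tensor_bump by (simp add: \<rho>'_def tensor_bump_def numeral_2_eq_2)
    show "test_function \<Omega> (\<lambda>y. \<rho> (a - y))" if "cball a \<delta> \<subseteq> \<Omega>" for a \<Omega>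
    proof -
      have "{x. \<rho> (a - x) \<noteq> 0} \<subseteq> cball a \<delta>"
      proof safe
        fix x assume "\<rho> (a - x) \<noteq> 0"
        then have "\<not> \<delta> \<le> norm (a - x)" using supp0 by (auto simp: \<rho>_def)
        then show "x \<in> cball a \<delta>" by (simp add: dist_norm)
      qed
      then have cl: "closure {x. \<rho> (a - x) \<noteq> 0} \<subseteq> cball a \<delta>"
        by (rule closure_minimal) simp
      moreover from this have "compact (closure {x. \<rho> (a - x) \<noteq> 0})"
        by (metis bounded_cball bounded_subset closed_closure compact_eq_bounded_closed)
      moreover have "smooth_fun (\<lambda>y. \<rho> (a - y))" unfolding tens by (rule smooth_tensor_bump)
      ultimately show ?thesis using that unfolding test_function_def by blast
    qed
  qed
qed

section \<open>Mollification\<close>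

definition (in mollifier) moll :: "(real^'n \<Rightarrow> 'b::{banach,second_countable_topology}) \<Rightarrow> real^'n \<Rightarrow> 'b" where
  "moll f x = (\<integral>y. \<rho> (x - y) *\<^sub>R f y \<partial>lborel)"

context mollifier
begin

lemma measurable_kernel [measurable]: "\<rho> \<in> borel_measurable borel"
proof -
  have "continuous_on UNIV \<rho>"
    by (intro continuous_at_imp_continuous_on ballI has_derivative_continuous[OF derivative])
  then show ?thesis by (rule borel_measurable_continuous_onI)
qed

lemma integrable_kernel_mult:
  fixes f :: "real^'n \<Rightarrow> 'b::{banach,second_countable_topology}"
  assumes f: "integrable lborel f"
  shows "integrable lborel (\<lambda>y. \<rho> (x - y) *\<^sub>R f y)"
proof -
  obtain B where B: "\<And>x. \<bar>\<rho> x\<bar> \<le> B" using bounded_by(1) by blast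
  have [measurable]: "f \<in> borel_measurable borel" using f by auto
  have "integrable lborel (\<lambda>y. B *\<^sub>R norm (f y))" using f by simp
  then show ?thesis
  proof (rule Bochner_Integration.integrable_bound)
    have "\<bar>\<rho> (x - y)\<bar> * norm (f y) \<le> \<bar>B\<bar> * norm (f y)" for y
      by (intro mult_right_mono order_trans[OF B abs_ge_self]) simp
    then show "AE y in lborel. norm (\<rho> (x - y) *\<^sub>R f y) \<le> norm (B *\<^sub>R norm (f y))"
      by (simp add: abs_mult)
  qed measurable
qed

lemma mass_translate: "(\<integral>\<^sup>+x. ennreal (\<rho> (x - y)) \<partial>lborel) = 1" "(\<integral>\<^sup>+x. ennreal (\<rho> (y - x)) \<partial>lborel) = 1"
  using nn_integral_lborel_translate[of "\<lambda>x. ennreal (\<rho> x)" y] mass by auto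

lemma integrable_kernel_translate:
  "integrable lborel (\<lambda>y. \<rho> (x - y))" "integrable lborel (\<lambda>y. \<rho> (y - x))"
  "(\<integral>y. \<rho> (x - y) \<partial>lborel) = 1" "(\<integral>y. \<rho> (y - x) \<partial>lborel) = 1"
proof -
  have *: "integrable lborel f \<and> (\<integral>y. f y \<partial>lborel) = 1"
    if [measurable]: "f \<in> borel_measurable borel" and "\<And>y. 0 \<le> f y" "(\<integral>\<^sup>+y. ennreal (f y) \<partial>lborel) = 1" for f :: "real^'n \<Rightarrow> real"
  proof -
    have "has_bochner_integral lborel f 1"
      using that by (intro has_bochner_integral_nn_integral) auto
    then show ?thesis by (simp add: has_bochner_integral_iff)
  qed
  show "integrable lborel (\<lambda>y. \<rho> (x - y))" "integrable lborel (\<lambda>y. \<rho> (y - x))"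
    "(\<integral>y. \<rho> (x - y) \<partial>lborel) = 1" "(\<integral>y. \<rho> (y - x) \<partial>lborel) = 1"
    using *[of "\<lambda>y. \<rho> (x - y)"] *[of "\<lambda>y. \<rho> (y - x)"] mass_translate nonneg by auto
qed

lemma measurable_moll [measurable]:
  fixes f :: "real^'n \<Rightarrow> 'b::{banach,second_countable_topology}"
  assumes [measurable]: "f \<in> borel_measurable borel"
  shows "moll f \<in> borel_measurable borel"
  unfolding moll_def by measurable

lemma nn_integral_kernel_mult:
  assumes [measurable]: "h \<in> borel_measurable borel"
  shows "(\<integral>\<^sup>+x. \<integral>\<^sup>+y. ennreal (\<rho> (x - y)) * h y \<partial>lborel \<partial>lborel) = (\<integral>\<^sup>+y. h y \<partial>lborel)"
proof -
  have "(\<integral>\<^sup>+x. \<integral>\<^sup>+y. ennreal (\<rho> (x - y)) * h y \<partial>lborel \<partial>lborel)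
      = (\<integral>\<^sup>+y. \<integral>\<^sup>+x. ennreal (\<rho> (x - y)) * h y \<partial>lborel \<partial>lborel)"
    by (rule lborel_pair.Fubini'[symmetric]) measurable
  also have "\<dots> = (\<integral>\<^sup>+y. h y \<partial>lborel)"
    by (simp add: nn_integral_multc mass_translate)
  finally show ?thesis .
qed

lemma norm_moll_le:
  fixes f :: "real^'n \<Rightarrow> 'b::{banach,second_countable_topology}"
  assumes f: "integrable lborel f"
  shows "ennreal (norm (moll f x)) \<le> (\<integral>\<^sup>+y. ennreal (\<rho> (x - y)) * ennreal (norm (f y)) \<partial>lborel)"
proof -
  have "ennreal (norm (moll f x)) \<le> (\<integral>\<^sup>+y. norm (\<rho> (x - y) *\<^sub>R f y) \<partial>lborel)"
    unfolding moll_def by (rule integral_norm_bound_ennreal[OF integrable_kernel_mult[OF f]])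
  then show ?thesis using nonneg by (simp add: ennreal_mult)
qed

lemma nn_integral_moll_le:
  fixes f :: "real^'n \<Rightarrow> 'b::{banach,second_countable_topology}"
  assumes f: "integrable lborel f"
  shows "(\<integral>\<^sup>+x. norm (moll f x) \<partial>lborel) \<le> (\<integral>\<^sup>+x. norm (f x) \<partial>lborel)"
proof -
  have [measurable]: "f \<in> borel_measurable borel" using f by auto
  have "(\<integral>\<^sup>+x. norm (moll f x) \<partial>lborel) \<le> (\<integral>\<^sup>+x. \<integral>\<^sup>+y. ennreal (\<rho> (x - y)) * ennreal (norm (f y)) \<partial>lborel \<partial>lborel)"
    by (intro nn_integral_mono norm_moll_le[OF f])
  then show ?thesis by (simp add: nn_integral_kernel_mult)
qed

text \<open>Jensen's inequality for the probability density \<open>\<rho>\<close>, integrated over the space: mollification does not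
  increase the \<open>L\<^sup>2\<close> norm.\<close>

lemma nn_integral_moll_square_le:
  fixes f :: "real^'n \<Rightarrow> 'b::{banach,second_countable_topology}"
  assumes f: "integrable lborel f"
  shows "(\<integral>\<^sup>+x. ennreal ((norm (moll f x))\<^sup>2) \<partial>lborel) \<le> (\<integral>\<^sup>+x. ennreal ((norm (f x))\<^sup>2) \<partial>lborel)"
proof -
  have [measurable]: "f \<in> borel_measurable borel" using f by auto
  have "ennreal ((norm (moll f x))\<^sup>2) \<le> (\<integral>\<^sup>+y. ennreal (\<rho> (x - y)) * ennreal ((norm (f y))\<^sup>2) \<partial>lborel)" for x
  proof -
    have "ennreal ((norm (moll f x))\<^sup>2) = (ennreal (norm (moll f x)))\<^sup>2"
      by (simp add: ennreal_power)
    also have "\<dots> \<le> (\<integral>\<^sup>+y. ennreal (\<rho> (x - y)) * ennreal (norm (f y)) \<partial>lborel)\<^sup>2"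
      by (intro power_mono norm_moll_le[OF f]) auto
    also have "(\<lambda>y. ennreal (\<rho> (x - y)) * ennreal (norm (f y)))
        = (\<lambda>y. ennreal (sqrt (\<rho> (x - y))) * ennreal (sqrt (\<rho> (x - y)) * norm (f y)))"
      using nonneg by (simp add: fun_eq_iff ennreal_mult[symmetric] mult.assoc[symmetric])
    also have "(\<integral>\<^sup>+y. ennreal (sqrt (\<rho> (x - y))) * ennreal (sqrt (\<rho> (x - y)) * norm (f y)) \<partial>lborel)\<^sup>2
       \<le> (\<integral>\<^sup>+y. (ennreal (sqrt (\<rho> (x - y))))\<^sup>2 \<partial>lborel) * (\<integral>\<^sup>+y. (ennreal (sqrt (\<rho> (x - y)) * norm (f y)))\<^sup>2 \<partial>lborel)"
      by (rule Cauchy_Schwarz_nn_integral) measurable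
    also have "(\<lambda>y. (ennreal (sqrt (\<rho> (x - y))))\<^sup>2) = (\<lambda>y. ennreal (\<rho> (x - y)))"
      using nonneg by (simp add: fun_eq_iff ennreal_power)
    also have "(\<lambda>y. (ennreal (sqrt (\<rho> (x - y)) * norm (f y)))\<^sup>2) = (\<lambda>y. ennreal (\<rho> (x - y)) * ennreal ((norm (f y))\<^sup>2))"
      using nonneg by (simp add: fun_eq_iff ennreal_power power_mult_distrib ennreal_mult[symmetric])
    finally show ?thesis by (simp add: mass_translate)
  qed
  then have "(\<integral>\<^sup>+x. ennreal ((norm (moll f x))\<^sup>2) \<partial>lborel)
      \<le> (\<integral>\<^sup>+x. \<integral>\<^sup>+y. ennreal (\<rho> (x - y)) * ennreal ((norm (f y))\<^sup>2) \<partial>lborel \<partial>lborel)"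
    by (intro nn_integral_mono)
  then show ?thesis by (simp add: nn_integral_kernel_mult)
qed

lemma integrable_moll:
  fixes f :: "real^'n \<Rightarrow> 'b::{banach,second_countable_topology}"
  assumes f: "integrable lborel f"
  shows "integrable lborel (moll f)"
proof (rule integrableI_bounded)
  have "f \<in> borel_measurable borel" using f by auto
  then show "moll f \<in> borel_measurable lborel" by simp
  show "(\<integral>\<^sup>+x. ennreal (norm (moll f x)) \<partial>lborel) < \<infinity>"
    using nn_integral_moll_le[OF f] f by (auto simp: integrable_iff_bounded intro: le_less_trans)
qed

lemma moll_diff:
  fixes f g :: "real^'n \<Rightarrow> 'b::{banach,second_countable_topology}"
  assumes "integrable lborel f" "integrable lborel g"
  shows "moll (\<lambda>x. f x - g x) x = moll f x - moll g x"
  using assms unfolding moll_def by (simp add: scaleR_diff_right integrable_kernel_mult)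

lemma moll_eq_if_constant_near:
  fixes f :: "real^'n \<Rightarrow> 'b::{banach,second_countable_topology}"
  assumes "AE y in lborel. y \<in> ball x r \<longrightarrow> f y = c" and [measurable]: "f \<in> borel_measurable borel"
  shows "moll f x = c"
proof -
  have "moll f x = (\<integral>y. \<rho> (x - y) *\<^sub>R c \<partial>lborel)"
    unfolding moll_def
  proof (rule integral_cong_AE)
    show "AE y in lborel. \<rho> (x - y) *\<^sub>R f y = \<rho> (x - y) *\<^sub>R c"
      using assms(1)
    proof eventually_elim
      case (elim y)
      then show ?case using support[of "x - y"] by (cases "norm (x - y) < r") (auto simp: dist_norm)
    qed
  qed measurable
  then show ?thesis using integrable_kernel_translate[of x] by simp
qed

end

definition moll_error :: "(real^'n \<Rightarrow> real) \<Rightarrow> (real^'n \<Rightarrow> real) \<Rightarrow> real" where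
  "moll_error \<rho> f = (\<integral>x. \<bar>mollifier.moll \<rho> f x - f x\<bar> \<partial>lborel)"

text \<open>Mollification is a contraction in \<open>L\<^sup>1\<close>; convergence on an approximating function therefore transfers,
  at the price of twice the distance.\<close>

lemma (in mollifier) moll_error_le:
  assumes f: "integrable lborel f" and g: "integrable lborel g"
  shows "moll_error \<rho> f \<le> moll_error \<rho> g + 2 * (\<integral>x. \<bar>f x - g x\<bar> \<partial>lborel)"
proof -
  have fg: "integrable lborel (\<lambda>x. f x - g x)" using f g by simp
  have le: "(\<integral>x. \<bar>moll (\<lambda>x. f x - g x) x\<bar> \<partial>lborel) \<le> (\<integral>x. \<bar>f x - g x\<bar> \<partial>lborel)"
  proof -
    have "ennreal (\<integral>x. \<bar>moll (\<lambda>x. f x - g x) x\<bar> \<partial>lborel) \<le> ennreal (\<integral>x. \<bar>f x - g x\<bar> \<partial>lborel)"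
      using nn_integral_moll_le[OF fg] integrable_moll[OF fg] fg
      by (simp add: nn_integral_eq_integral)
    then show ?thesis by (subst (asm) ennreal_le_iff) auto
  qed
  have "moll_error \<rho> f \<le> (\<integral>x. \<bar>moll g x - g x\<bar> + (\<bar>moll (\<lambda>x. f x - g x) x\<bar> + \<bar>f x - g x\<bar>) \<partial>lborel)"
    unfolding moll_error_def
    using f g fg integrable_moll[OF f] integrable_moll[OF g] integrable_moll[OF fg]
    by (intro integral_mono) (auto simp: moll_diff[OF f g])
  also have "\<dots> = moll_error \<rho> g + ((\<integral>x. \<bar>moll (\<lambda>x. f x - g x) x\<bar> \<partial>lborel) + (\<integral>x. \<bar>f x - g x\<bar> \<partial>lborel))"
    unfolding moll_error_def using f g fg integrable_moll[OF g] integrable_moll[OF fg] by simp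
  finally show ?thesis using le by simp
qed

lemma (in mollifier) moll_indicator_bounds:
  assumes T: "T \<in> sets borel" "emeasure lborel T < \<infinity>"
  shows "moll (indicator T :: _ \<Rightarrow> real) x \<in> {0..1}"
proof -
  have i: "integrable lborel (indicator T :: _ \<Rightarrow> real)" using T by simp
  have "moll (indicator T :: _ \<Rightarrow> real) x \<le> (\<integral>y. \<rho> (x - y) \<partial>lborel)"
    unfolding moll_def using integrable_kernel_mult[OF i] integrable_kernel_translate(1) nonneg
    by (intro integral_mono) (auto simp: indicator_def)
  moreover have "0 \<le> moll (indicator T :: _ \<Rightarrow> real) x"
    unfolding moll_def using nonneg by (intro integral_nonneg_AE) auto
  ultimately show ?thesis using integrable_kernel_translate(3) by simp
qed

lemma (in mollifier) integral_moll_indicator: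
  assumes T: "T \<in> sets borel" "emeasure lborel T < \<infinity>"
  shows "(\<integral>x. moll (indicator T :: _ \<Rightarrow> real) x \<partial>lborel) = (\<integral>x. indicator T x \<partial>lborel)"
proof -
  have i: "integrable lborel (indicator T :: _ \<Rightarrow> real)" using T by simp
  have [measurable]: "T \<in> sets borel" by fact
  have 1: "ennreal (moll (indicator T :: _ \<Rightarrow> real) x) = (\<integral>\<^sup>+y. ennreal (\<rho> (x - y)) * indicator T y \<partial>lborel)" for x
  proof -
    have "(\<integral>\<^sup>+y. ennreal (\<rho> (x - y) *\<^sub>R indicator T y) \<partial>lborel) = ennreal (moll (indicator T) x)"
      unfolding moll_def by (rule nn_integral_eq_integral[OF integrable_kernel_mult[OF i]])
        (use nonneg in auto)
    then show ?thesis using nonneg by (simp add: ennreal_mult ennreal_indicator)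
  qed
  have "ennreal (\<integral>x. moll (indicator T :: _ \<Rightarrow> real) x \<partial>lborel) = (\<integral>\<^sup>+x. ennreal (moll (indicator T :: _ \<Rightarrow> real) x) \<partial>lborel)"
    using moll_indicator_bounds[OF T] integrable_moll[OF i] by (intro nn_integral_eq_integral[symmetric]) auto
  also have "\<dots> = (\<integral>\<^sup>+x. indicator T x \<partial>lborel)"
    unfolding 1 by (rule nn_integral_kernel_mult) measurable
  also have "\<dots> = ennreal (\<integral>x. indicator T x \<partial>lborel)"
    using T by (simp add: emeasure_eq_ennreal_measure)
  finally show ?thesis
    using moll_indicator_bounds[OF T] by (subst (asm) ennreal_inj) (auto intro!: integral_nonneg_AE)
qed

text \<open>Mollification preserves integrals, so the error is twice the integral of \<open>max 0 (indicator T - moll)\<close>.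
  This is dominated by the indicator of \<open>T\<close>, and at each point of the open set \<open>T\<close> it is
  zero as soon as the radius is small.\<close>

lemma moll_error_tendsto_0_open:
  assumes m: "\<And>n. mollifier (\<delta> n) (\<rho> n) (\<rho>' n)" and \<delta>: "\<delta> \<longlonglongrightarrow> 0"
    and T: "open T" "emeasure lborel T < \<infinity>"
  shows "(\<lambda>n. moll_error (\<rho> n) (indicator T)) \<longlonglongrightarrow> 0"
proof -
  let ?m = "\<lambda>n. mollifier.moll (\<rho> n) (indicator T :: _ \<Rightarrow> real)"
  have Ts: "T \<in> sets borel" using T by simp
  have i: "integrable lborel (indicator T :: _ \<Rightarrow> real)" using T by simp
  have im: "integrable lborel (?m n)" for n by (rule mollifier.integrable_moll[OF m i])
  have m01: "?m n x \<in> {0..1}" for n x by (rule mollifier.moll_indicator_bounds[OF m Ts T(2)])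
  have int: "integrable lborel (\<lambda>x. max 0 (indicator T x - ?m n x))" for n
    using i im by auto
  have eq: "moll_error (\<rho> n) (indicator T) = 2 * (\<integral>x. max 0 (indicator T x - ?m n x) \<partial>lborel)" for n
  proof -
    have "moll_error (\<rho> n) (indicator T) = (\<integral>x. (?m n x - indicator T x) + 2 * max 0 (indicator T x - ?m n x) \<partial>lborel)"
      unfolding moll_error_def by (intro Bochner_Integration.integral_cong) (auto simp: max_def)
    also have "\<dots> = ((\<integral>x. ?m n x \<partial>lborel) - (\<integral>x. indicator T x \<partial>lborel)) + 2 * (\<integral>x. max 0 (indicator T x - ?m n x) \<partial>lborel)"
      using i im int by simp
    finally show ?thesis using mollifier.integral_moll_indicator[OF m Ts T(2), of n] by simp
  qed
  have "(\<lambda>n. \<integral>x. max 0 (indicator T x - ?m n x) \<partial>lborel) \<longlonglongrightarrow> (\<integral>x. 0 \<partial>(lborel :: (real^'a) measure))"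
  proof (rule integral_dominated_convergence[where w = "indicator T"])
    show "AE x in lborel. norm (max 0 (indicator T x - ?m n x)) \<le> indicator T x" for n
      using m01[of n] by (intro AE_I2) (auto simp: indicator_def)
    show "AE x in lborel. (\<lambda>n. max 0 (indicator T x - ?m n x)) \<longlonglongrightarrow> 0"
    proof (intro AE_I2)
      fix x :: "real^'a"
      show "(\<lambda>n. max 0 (indicator T x - ?m n x)) \<longlonglongrightarrow> 0"
      proof (cases "x \<in> T")
        case True
        then obtain e where e: "0 < e" "ball x e \<subseteq> T" using T(1) open_contains_ball by blast
        have "\<forall>\<^sub>F n in sequentially. \<delta> n < e" using \<delta> e(1) by (rule order_tendstoD)
        then have "\<forall>\<^sub>F n in sequentially. max 0 (indicator T x - ?m n x) = 0"
        proof eventually_elim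
          case (elim n)
          have "?m n x = 1"
            by (rule mollifier.moll_eq_if_constant_near[OF m])
               (use elim e Ts in \<open>auto intro!: AE_I2 simp: indicator_def\<close>)
          then show ?case using True by simp
        qed
        then show ?thesis by (rule tendsto_eventually)
      next
        case False
        then have "max 0 (indicator T x - ?m n x) = 0" for n using m01[of n x] by simp
        then show ?thesis by simp
      qed
    qed
  qed (use i int in auto)
  then have "(\<lambda>n. 2 * (\<integral>x. max 0 (indicator T x - ?m n x) \<partial>lborel)) \<longlonglongrightarrow> 2 * (\<integral>x. 0 \<partial>(lborel :: (real^'a) measure))"
    by (intro tendsto_intros)
  then show ?thesis by (simp add: eq)
qed

lemma moll_error_tendsto_0_closure:
  assumes m: "\<And>n. mollifier (\<delta> n) (\<rho> n) (\<rho>' n)" and f: "integrable lborel f"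
    and "\<And>e. 0 < e \<Longrightarrow> \<exists>g. integrable lborel g \<and> (\<integral>x. \<bar>f x - g x\<bar> \<partial>lborel) \<le> e \<and> (\<lambda>n. moll_error (\<rho> n) g) \<longlonglongrightarrow> 0"
  shows "(\<lambda>n. moll_error (\<rho> n) f) \<longlonglongrightarrow> 0"
proof (rule LIMSEQ_I)
  fix e :: real assume "0 < e"
  then obtain g where g: "integrable lborel g" "(\<integral>x. \<bar>f x - g x\<bar> \<partial>lborel) \<le> e / 4" "(\<lambda>n. moll_error (\<rho> n) g) \<longlonglongrightarrow> 0"
    using assms(3)[of "e / 4"] by auto
  obtain N where N: "\<And>n. n \<ge> N \<Longrightarrow> norm (moll_error (\<rho> n) g - 0) < e / 2"
    using LIMSEQ_D[OF g(3), of "e / 2"] \<open>0 < e\<close> by auto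
  have "norm (moll_error (\<rho> n) f - 0) < e" if "n \<ge> N" for n
  proof -
    have "0 \<le> moll_error (\<rho> n) f" unfolding moll_error_def by simp
    moreover have "moll_error (\<rho> n) f \<le> moll_error (\<rho> n) g + 2 * (e / 4)"
      using mollifier.moll_error_le[OF m f g(1), of n] g(2) by linarith
    ultimately show ?thesis using N[OF that] by simp
  qed
  then show "\<exists>N. \<forall>n\<ge>N. norm (moll_error (\<rho> n) f - 0) < e" by blast
qed

text \<open>Sets of finite measure are approximated by open sets from outside, and the general case follows by
  linearity and by density of simple functions.\<close>

theorem moll_error_tendsto_0:
  assumes m: "\<And>n. mollifier (\<delta> n) (\<rho> n) (\<rho>' n)" and \<delta>: "\<delta> \<longlonglongrightarrow> 0" and f: "integrable lborel f"
  shows "(\<lambda>n. moll_error (\<rho> n) f) \<longlonglongrightarrow> 0"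
  using f
proof (induction rule: integrable_induct)
  case (base A c)
  note A = base
  have iA: "integrable lborel (\<lambda>x. indicator A x *\<^sub>R c)" using A by auto
  show ?case
  proof (rule moll_error_tendsto_0_closure[OF m iA])
    fix e :: real assume "0 < e"
    define e' where "e' = e / (\<bar>c\<bar> + 1)"
    have e': "0 < e'" using \<open>0 < e\<close> by (simp add: e'_def)
    have "A \<in> sets lebesgue" using A by auto
    then obtain T where T: "open T" "A \<subseteq> T" "emeasure lebesgue (T - A) < ennreal e'"
      using sets_lebesgue_outer_open[OF _ e'] by metis
    have [measurable]: "T \<in> sets borel" "A \<in> sets borel" using T A by auto
    have TA: "emeasure lborel (T - A) < ennreal e'" using T(3) by simp
    have "emeasure lborel T \<le> emeasure lborel A + emeasure lborel (T - A)"
      using emeasure_subadditive[of A lborel "T - A"] T(2) by (simp add: Un_absorb1)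
    also have "\<dots> < \<infinity>" using A TA by (auto simp: less_top[symmetric])
    finally have Tf: "emeasure lborel T < \<infinity>" .
    have iT: "integrable lborel (indicator T :: _ \<Rightarrow> real)" using Tf by simp
    have "(\<lambda>n. moll_error (\<rho> n) (\<lambda>x. indicator T x *\<^sub>R c)) \<longlonglongrightarrow> 0"
    proof -
      have "moll_error (\<rho> n) (\<lambda>x. indicator T x *\<^sub>R c) = \<bar>c\<bar> * moll_error (\<rho> n) (indicator T)" for n
      proof -
        have "mollifier.moll (\<rho> n) (\<lambda>x. indicator T x *\<^sub>R c) x = c * mollifier.moll (\<rho> n) (indicator T) x" for x
          unfolding mollifier.moll_def[OF m] by (subst integral_mult_right_zero[symmetric]) (simp add: mult_ac)
        then show ?thesis
          unfolding moll_error_def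
          by (subst integral_mult_right_zero[symmetric]) (simp add: abs_mult[symmetric] algebra_simps)
      qed
      then show ?thesis using tendsto_mult_right_zero[OF moll_error_tendsto_0_open[OF m \<delta> T(1) Tf]] by simp
    qed
    moreover have "(\<integral>x. \<bar>indicator A x *\<^sub>R c - indicator T x *\<^sub>R c\<bar> \<partial>lborel) \<le> e"
    proof -
      have "(\<integral>x. \<bar>indicator A x *\<^sub>R c - indicator T x *\<^sub>R c\<bar> \<partial>lborel) = (\<integral>x. \<bar>c\<bar> * indicator (T - A) x \<partial>lborel)"
        using T(2) by (intro Bochner_Integration.integral_cong) (auto simp: indicator_def)
      also have "\<dots> = \<bar>c\<bar> * measure lborel (T - A)" by simp
      also have "\<dots> \<le> \<bar>c\<bar> * e'"
      proof (intro mult_left_mono)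
        show "measure lborel (T - A) \<le> e'"
          using TA e' unfolding measure_def by (intro enn2real_leI) auto
      qed simp
      also have "\<dots> \<le> e" using \<open>0 < e\<close> by (simp add: e'_def field_simps)
      finally show ?thesis .
    qed
    ultimately show "\<exists>g. integrable lborel g \<and> (\<integral>x. \<bar>indicator A x *\<^sub>R c - g x\<bar> \<partial>lborel) \<le> e
        \<and> (\<lambda>n. moll_error (\<rho> n) g) \<longlonglongrightarrow> 0"
      using iT by (intro exI[of _ "\<lambda>x. indicator T x *\<^sub>R c"]) auto
  qed
next
  case (add f g)
  have "moll_error (\<rho> n) (\<lambda>x. f x + g x) \<le> moll_error (\<rho> n) f + moll_error (\<rho> n) g" for n
  proof -
    have *: "mollifier.moll (\<rho> n) (\<lambda>x. f x + g x) x = mollifier.moll (\<rho> n) f x + mollifier.moll (\<rho> n) g x" for x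
      unfolding mollifier.moll_def[OF m] using mollifier.integrable_kernel_mult[OF m, of f n x] mollifier.integrable_kernel_mult[OF m, of g n x] add
      by (simp add: distrib_left)
    note i = mollifier.integrable_moll[OF m add(1), of n] mollifier.integrable_moll[OF m add(2), of n] add
    have "moll_error (\<rho> n) (\<lambda>x. f x + g x)
        \<le> (\<integral>x. \<bar>mollifier.moll (\<rho> n) f x - f x\<bar> + \<bar>mollifier.moll (\<rho> n) g x - g x\<bar> \<partial>lborel)"
      unfolding moll_error_def * using i by (intro integral_mono) auto
    also have "\<dots> = moll_error (\<rho> n) f + moll_error (\<rho> n) g"
      unfolding moll_error_def using i by simp
    finally show ?thesis .
  qed
  then have le: "norm (moll_error (\<rho> n) (\<lambda>x. f x + g x)) \<le> moll_error (\<rho> n) f + moll_error (\<rho> n) g" for n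
    by (simp add: moll_error_def)
  show ?case
    by (rule Lim_null_comparison[OF always_eventually[OF allI[OF le]] tendsto_add_zero[OF add(3,4)]])
next
  case (lim f s)
  show ?case
  proof (rule moll_error_tendsto_0_closure[OF m])
    show "integrable lborel f" by fact
    have "(\<lambda>i. \<integral>x. \<bar>f x - s i x\<bar> \<partial>lborel) \<longlonglongrightarrow> (\<integral>x. 0 \<partial>(lborel :: (real^'a) measure))"
    proof (rule integral_dominated_convergence[where w = "\<lambda>x. 3 * \<bar>f x\<bar>"])
      show "AE x in lborel. (\<lambda>i. \<bar>f x - s i x\<bar>) \<longlonglongrightarrow> 0"
      proof (intro AE_I2)
        fix x
        have "(\<lambda>i. \<bar>f x - s i x\<bar>) \<longlonglongrightarrow> \<bar>f x - f x\<bar>" using lim(2) by (intro tendsto_intros) auto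
        then show "(\<lambda>i. \<bar>f x - s i x\<bar>) \<longlonglongrightarrow> 0" by simp
      qed
      show "AE x in lborel. norm \<bar>f x - s i x\<bar> \<le> 3 * \<bar>f x\<bar>" for i
      proof (intro AE_I2)
        fix x
        have "\<bar>s i x\<bar> \<le> 2 * \<bar>f x\<bar>" using lim(3)[of x i] by simp
        then show "norm \<bar>f x - s i x\<bar> \<le> 3 * \<bar>f x\<bar>" by simp
      qed
    qed (use lim in auto)
    then have L: "(\<lambda>i. \<integral>x. \<bar>f x - s i x\<bar> \<partial>lborel) \<longlonglongrightarrow> 0" by simp
    fix e :: real assume "0 < e"
    then have "\<forall>\<^sub>F i in sequentially. (\<integral>x. \<bar>f x - s i x\<bar> \<partial>lborel) < e"
      by (rule order_tendstoD(2)[OF L])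
    then obtain i where "(\<integral>x. \<bar>f x - s i x\<bar> \<partial>lborel) < e"
      by (auto simp: eventually_sequentially)
    then show "\<exists>g. integrable lborel g \<and> (\<integral>x. \<bar>f x - g x\<bar> \<partial>lborel) \<le> e \<and> (\<lambda>n. moll_error (\<rho> n) g) \<longlonglongrightarrow> 0"
      using lim by (intro exI[of _ "s i"]) auto
  qed
qed

text \<open>Convergence in \<open>L\<^sup>1\<close> gives almost everywhere convergence along a subsequence of the radii
  \<open>1 / (n + 1)\<close>.\<close>

theorem mollifiers_converge_AE:
  fixes f :: "real^'n \<Rightarrow> real"
  assumes f: "integrable lborel f"
  obtains \<delta> \<rho> \<rho>' where "\<And>n::nat. mollifier (\<delta> n) (\<rho> n) (\<rho>' n)" "\<delta> \<longlonglongrightarrow> 0"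
    "AE x in lborel. (\<lambda>n. mollifier.moll (\<rho> n) f x) \<longlonglongrightarrow> f x"
proof -
  define \<delta> where "\<delta> n = inverse (real (Suc n))" for n
  have "\<forall>n. \<exists>\<rho> \<rho>'. mollifier (\<delta> n) (\<rho> :: real^'n \<Rightarrow> real) \<rho>'"
    by (intro allI mollifier_exists) (simp add: \<delta>_def)
  then obtain \<rho> \<rho>' where m: "\<And>n. mollifier (\<delta> n) (\<rho> n :: real^'n \<Rightarrow> real) (\<rho>' n)" by metis
  have \<delta>: "\<delta> \<longlonglongrightarrow> 0" unfolding \<delta>_def by (rule LIMSEQ_inverse_real_of_nat)
  have "(\<lambda>n. \<integral>x. norm (mollifier.moll (\<rho> n) f x - f x) \<partial>lborel) \<longlonglongrightarrow> 0"
    using moll_error_tendsto_0[OF m \<delta> f] by (simp add: moll_error_def)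
  then obtain s where s: "strict_mono s" "AE x in lborel. (\<lambda>n. mollifier.moll (\<rho> (s n)) f x - f x) \<longlonglongrightarrow> 0"
    using tendsto_L1_AE_subseq[of lborel "\<lambda>n x. mollifier.moll (\<rho> n) f x - f x"]
      mollifier.integrable_moll[OF m f] f by auto
  show ?thesis
  proof (rule that[of "\<delta> \<circ> s" "\<rho> \<circ> s" "\<rho>' \<circ> s"])
    show "mollifier ((\<delta> \<circ> s) n) ((\<rho> \<circ> s) n) ((\<rho>' \<circ> s) n)" for n using m by simp
    show "(\<delta> \<circ> s) \<longlonglongrightarrow> 0" using \<delta> s(1) by (rule LIMSEQ_subseq_LIMSEQ)
    show "AE x in lborel. (\<lambda>n. mollifier.moll ((\<rho> \<circ> s) n) f x) \<longlonglongrightarrow> f x"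
      using s(2) by eventually_elim (simp add: LIM_zero_iff)
  qed
qed

section \<open>Weak derivatives along Lipschitz curves\<close>

text \<open>The weak gradient of a function on the whole space, tested inside \<open>\<Omega>\<close>. Such functions can be
  convolved with a kernel.\<close>

definition weak_gradient_on ::
  "(real^'n) set \<Rightarrow> (real^'n \<Rightarrow> real) \<Rightarrow> (real^'n \<Rightarrow> real^'n) \<Rightarrow> bool" where
  "weak_gradient_on \<Omega> f g \<longleftrightarrow> integrable lborel f \<and> integrable lborel g \<and>
     (\<forall>\<phi> i. test_function \<Omega> \<phi> \<longrightarrow>
        (\<integral>x. f x * partial_deriv i \<phi> x \<partial>lborel) = - (\<integral>x. g x $ i * \<phi> x \<partial>lborel))"

lemma has_derivative_integral_parameter:
  fixes F F' :: "real \<Rightarrow> 'a \<Rightarrow> real"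
  assumes F: "\<And>t. integrable M (F t)" and F': "F' s \<in> borel_measurable M"
    and deriv: "\<And>t y. ((\<lambda>t. F t y) has_real_derivative F' t y) (at t)"
    and bound: "\<And>t y. \<bar>F' t y\<bar> \<le> w y" and w: "integrable M w"
  shows "((\<lambda>t. \<integral>y. F t y \<partial>M) has_real_derivative (\<integral>y. F' s y \<partial>M)) (at s)"
proof -
  have "((\<lambda>t. ((\<integral>y. F t y \<partial>M) - (\<integral>y. F s y \<partial>M)) / (t - s)) \<longlongrightarrow> (\<integral>y. F' s y \<partial>M)) (at s)"
    unfolding tendsto_at_iff_sequentially
  proof (intro allI impI)
    fix X :: "nat \<Rightarrow> real" assume X: "\<forall>i. X i \<in> UNIV - {s}" "X \<longlonglongrightarrow> s"
    have "(\<lambda>i. \<integral>y. (F (X i) y - F s y) / (X i - s) \<partial>M) \<longlonglongrightarrow> (\<integral>y. F' s y \<partial>M)"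
    proof (rule integral_dominated_convergence[OF _ _ w])
      show "AE y in M. (\<lambda>i. (F (X i) y - F s y) / (X i - s)) \<longlonglongrightarrow> F' s y"
      proof (intro AE_I2)
        fix y
        have "((\<lambda>t. (F t y - F s y) / (t - s)) \<longlongrightarrow> F' s y) (at s)"
          using deriv by (simp add: has_field_derivative_iff)
        then show "(\<lambda>i. (F (X i) y - F s y) / (X i - s)) \<longlonglongrightarrow> F' s y"
          using X unfolding tendsto_at_iff_sequentially comp_def by blast
      qed
      show "AE y in M. norm ((F (X i) y - F s y) / (X i - s)) \<le> w y" for i
      proof (intro AE_I2)
        fix y
        have "norm (F (X i) y - F s y) \<le> w y * norm (X i - s)"
          by (rule field_differentiable_bound[of UNIV "\<lambda>t. F t y" "\<lambda>t. F' t y"])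
             (use deriv bound in auto)
        then show "norm ((F (X i) y - F s y) / (X i - s)) \<le> w y"
          using X(1) by (simp add: abs_divide divide_le_eq)
      qed
    qed (use F F' in auto)
    moreover have "(\<integral>y. (F (X i) y - F s y) / (X i - s) \<partial>M) = ((\<integral>y. F (X i) y \<partial>M) - (\<integral>y. F s y \<partial>M)) / (X i - s)" for i
      using F by simp
    ultimately show "((\<lambda>t. ((\<integral>y. F t y \<partial>M) - (\<integral>y. F s y \<partial>M)) / (t - s)) \<circ> X) \<longlonglongrightarrow> (\<integral>y. F' s y \<partial>M)"
      by (simp only: comp_def)
  qed
  then show ?thesis by (simp add: has_field_derivative_iff)
qed

lemma borel_measurable_vec_nth' [measurable]: "(\<lambda>x::real^'n. x $ i) \<in> borel_measurable borel"
  by (intro borel_measurable_continuous_onI continuous_intros)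

context mollifier
begin

lemma continuous_kernel: "continuous_on UNIV \<rho>"
  by (intro continuous_at_imp_continuous_on ballI has_derivative_continuous[OF derivative])

lemma measurable_kernel_gradient [measurable]: "\<rho>' \<in> borel_measurable borel"
  using continuous_gradient by (rule borel_measurable_continuous_onI)

lemma continuous_moll:
  fixes f :: "real^'n \<Rightarrow> 'b::{banach,second_countable_topology}"
  assumes f: "integrable lborel f"
  shows "continuous_on UNIV (moll f)"
proof -
  obtain B where B: "\<And>x. \<bar>\<rho> x\<bar> \<le> B" using bounded_by(1) by blast
  have [measurable]: "f \<in> borel_measurable borel" using f by auto
  show ?thesis
    unfolding continuous_on_sequentially comp_def
  proof (intro allI impI ballI)
    fix X :: "nat \<Rightarrow> real^'n" and x assume X: "(\<forall>n. X n \<in> UNIV) \<and> X \<longlonglongrightarrow> x"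
    show "(\<lambda>n. moll f (X n)) \<longlonglongrightarrow> moll f x"
      unfolding moll_def
    proof (rule integral_dominated_convergence[where w = "\<lambda>y. B * norm (f y)"])
      show "AE y in lborel. (\<lambda>n. \<rho> (X n - y) *\<^sub>R f y) \<longlonglongrightarrow> \<rho> (x - y) *\<^sub>R f y"
      proof (intro AE_I2 tendsto_scaleR tendsto_const)
        fix y
        have "(\<lambda>n. X n - y) \<longlonglongrightarrow> x - y" using X by (intro tendsto_intros) auto
        then show "(\<lambda>n. \<rho> (X n - y)) \<longlonglongrightarrow> \<rho> (x - y)"
          by (rule isCont_tendsto_compose[OF has_derivative_continuous[OF derivative]])
      qed
      show "AE y in lborel. norm (\<rho> (X n - y) *\<^sub>R f y) \<le> B * norm (f y)" for n
        by (intro AE_I2) (simp add: mult_right_mono B)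
      show "integrable lborel (\<lambda>y. B * norm (f y))" using f by simp
    qed measurable
  qed
qed

text \<open>The derivative falls on the kernel, which is a test function of the integration variable; the defining
  identity of the weak gradient moves it back to \<open>f\<close>.\<close>

lemma moll_line_derivative:
  assumes wg: "weak_gradient_on \<Omega> f g" and x: "cball (x + s *\<^sub>R v) r \<subseteq> \<Omega>"
  shows "((\<lambda>t. moll f (x + t *\<^sub>R v)) has_real_derivative (moll g (x + s *\<^sub>R v) \<bullet> v)) (at s)"
proof -
  have f: "integrable lborel f" and g: "integrable lborel g"
    using wg by (auto simp: weak_gradient_on_def)
  have [measurable]: "f \<in> borel_measurable borel" using f by auto
  obtain B where B: "\<And>x. norm (\<rho>' x) \<le> B" using bounded_by(2) by blast
  let ?p = "x + s *\<^sub>R v"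
  have "((\<lambda>t. \<integral>y. \<rho> (x + t *\<^sub>R v - y) *\<^sub>R f y \<partial>lborel) has_real_derivative
      (\<integral>y. (\<rho>' (?p - y) \<bullet> v) * f y \<partial>lborel)) (at s)"
  proof (rule has_derivative_integral_parameter[where w = "\<lambda>y. B * norm v * \<bar>f y\<bar>"])
    show "integrable lborel (\<lambda>y. \<rho> (x + t *\<^sub>R v - y) *\<^sub>R f y)" for t by (rule integrable_kernel_mult[OF f])
    show "((\<lambda>t. \<rho> (x + t *\<^sub>R v - y) *\<^sub>R f y) has_real_derivative (\<rho>' (x + t *\<^sub>R v - y) \<bullet> v) * f y) (at t)" for t y
    proof -
      have "((\<lambda>t. x + t *\<^sub>R v - y) has_derivative (\<lambda>h. h *\<^sub>R v)) (at t)"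
        by (auto intro!: derivative_eq_intros)
      from has_derivative_compose[OF this derivative]
      have "((\<lambda>t. \<rho> (x + t *\<^sub>R v - y)) has_real_derivative (\<rho>' (x + t *\<^sub>R v - y) \<bullet> v)) (at t)"
        by (simp add: has_field_derivative_def mult_commute_abs)
      then show ?thesis by (auto intro!: derivative_eq_intros)
    qed
    show "\<bar>(\<rho>' (x + t *\<^sub>R v - y) \<bullet> v) * f y\<bar> \<le> B * norm v * \<bar>f y\<bar>" for t y
      unfolding abs_mult
      by (intro mult_right_mono order_trans[OF Cauchy_Schwarz_ineq2] B) auto
  qed (use f in auto)
  moreover have "(\<integral>y. (\<rho>' (?p - y) \<bullet> v) * f y \<partial>lborel) = moll g ?p \<bullet> v"
  proof -
    have int: "integrable lborel (\<lambda>y. f y * \<rho>' (?p - y) $ i)" for i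
    proof (rule Bochner_Integration.integrable_bound)
      show "integrable lborel (\<lambda>y. f y * B)" using f by simp
      have "\<bar>\<rho>' (?p - y) $ i\<bar> \<le> \<bar>B\<bar>" for y
        using component_le_norm_cart[of "\<rho>' (?p - y)" i] B[of "?p - y"] by linarith
      then show "AE y in lborel. norm (f y * \<rho>' (?p - y) $ i) \<le> norm (f y * B)"
        by (intro AE_I2) (simp add: abs_mult mult_left_mono)
    qed measurable
    have "(\<integral>y. f y * \<rho>' (?p - y) $ i \<partial>lborel) = moll g ?p $ i" for i
    proof -
      have "(\<integral>y. f y * partial_deriv i (\<lambda>y. \<rho> (?p - y)) y \<partial>lborel) = - (\<integral>y. g y $ i * \<rho> (?p - y) \<partial>lborel)"
        using wg test_function[OF x] unfolding weak_gradient_on_def by blast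
      then have "(\<integral>y. f y * \<rho>' (?p - y) $ i \<partial>lborel) = (\<integral>y. g y $ i * \<rho> (?p - y) \<partial>lborel)"
        unfolding partial_deriv by simp
      also have "\<dots> = (\<integral>y. (\<rho> (?p - y) *\<^sub>R g y) $ i \<partial>lborel)" by (simp add: mult.commute)
      also have "\<dots> = moll g ?p $ i"
        unfolding moll_def using integral_bounded_linear[OF bounded_linear_vec_nth integrable_kernel_mult[OF g]]
        by fastforce
      finally show ?thesis .
    qed
    then have "(\<Sum>i\<in>UNIV. moll g ?p $ i * v $ i) = (\<Sum>i\<in>UNIV. (\<integral>y. f y * \<rho>' (?p - y) $ i * v $ i \<partial>lborel))"
      by (simp add: int)
    also have "\<dots> = (\<integral>y. (\<Sum>i\<in>UNIV. f y * \<rho>' (?p - y) $ i * v $ i) \<partial>lborel)"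
      using int by (intro Bochner_Integration.integral_sum[symmetric]) auto
    also have "\<dots> = (\<integral>y. (\<rho>' (?p - y) \<bullet> v) * f y \<partial>lborel)"
      by (intro Bochner_Integration.integral_cong refl)
        (simp add: inner_vec_def sum_distrib_right sum_distrib_left mult_ac)
    finally show ?thesis by (simp add: inner_vec_def)
  qed
  ultimately show ?thesis by (simp add: moll_def)
qed

end

text \<open>The composition of \<open>u\<close> with a Lipschitz curve need not be differentiable, so the fundamental theorem of
  calculus does not apply. The local estimates are added up over a fine subdivision instead.\<close>

lemma upper_gradient_Lipschitz_curve:
  fixes u :: "'a::real_normed_vector \<Rightarrow> real" and G :: "'a \<Rightarrow> real" and \<gamma> :: "real \<Rightarrow> 'a"
  assumes ab: "a \<le> b" and lip: "K-lipschitz_on {a..b} \<gamma>"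
    and G: "continuous_on UNIV G"
    and loc: "\<And>t \<eta>. t \<in> {a..b} \<Longrightarrow> 0 < \<eta> \<Longrightarrow> \<exists>d>0. \<forall>p q. dist p (\<gamma> t) < d \<and> dist q (\<gamma> t) < d \<longrightarrow> \<bar>u q - u p\<bar> \<le> (G (\<gamma> t) + \<eta>) * dist p q"
    and G0: "\<And>x. 0 \<le> G x"
  shows "\<bar>u (\<gamma> b) - u (\<gamma> a)\<bar> \<le> K * integral {a..b} (\<lambda>t. G (\<gamma> t))"
proof -
  have K: "0 \<le> K" using lip by (rule lipschitz_on_nonneg)
  have cg: "continuous_on {a..b} (\<lambda>t. G (\<gamma> t))"
    by (rule continuous_on_compose2[OF G lipschitz_on_continuous_on[OF lip]]) auto
  have int: "(\<lambda>t. G (\<gamma> t)) integrable_on {s..t}" if "a \<le> s" "t \<le> b" for s t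
    by (rule integrable_continuous_interval, rule continuous_on_subset[OF cg]) (use that in auto)
  have main: "\<bar>u (\<gamma> b) - u (\<gamma> a)\<bar> \<le> K * (integral {a..b} (\<lambda>t. G (\<gamma> t)) + 2 * \<eta> * (b - a))" if \<eta>: "0 < \<eta>" for \<eta>
  proof -
    define P where "P s t \<longleftrightarrow> (a \<le> s \<and> s \<le> t \<and> t \<le> b \<longrightarrow> \<bar>u (\<gamma> t) - u (\<gamma> s)\<bar> \<le> K * (integral {s..t} (\<lambda>t. G (\<gamma> t)) + 2 * \<eta> * (t - s)))" for s t
    have "P a b"
      using ab
    proof (induction a b rule: Bolzano)
      case (trans x y z)
      show ?case
        unfolding P_def
      proof
        assume *: "a \<le> x \<and> x \<le> z \<and> z \<le> b"
        have "integral {x..y} (\<lambda>t. G (\<gamma> t)) + integral {y..z} (\<lambda>t. G (\<gamma> t)) = integral {x..z} (\<lambda>t. G (\<gamma> t))"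
          using trans * by (intro Henstock_Kurzweil_Integration.integral_combine int) auto
        moreover have "\<bar>u (\<gamma> y) - u (\<gamma> x)\<bar> \<le> K * (integral {x..y} (\<lambda>t. G (\<gamma> t)) + 2 * \<eta> * (y - x))"
          "\<bar>u (\<gamma> z) - u (\<gamma> y)\<bar> \<le> K * (integral {y..z} (\<lambda>t. G (\<gamma> t)) + 2 * \<eta> * (z - y))"
          using trans * unfolding P_def by auto
        ultimately have "\<bar>u (\<gamma> z) - u (\<gamma> x)\<bar> \<le> K * (integral {x..y} (\<lambda>t. G (\<gamma> t)) + 2 * \<eta> * (y - x)) + K * (integral {y..z} (\<lambda>t. G (\<gamma> t)) + 2 * \<eta> * (z - y))"
          by linarith
        also have "\<dots> = K * ((integral {x..y} (\<lambda>t. G (\<gamma> t)) + integral {y..z} (\<lambda>t. G (\<gamma> t))) + 2 * \<eta> * (z - x))"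
          by (simp add: algebra_simps)
        finally show "\<bar>u (\<gamma> z) - u (\<gamma> x)\<bar> \<le> K * (integral {x..z} (\<lambda>t. G (\<gamma> t)) + 2 * \<eta> * (z - x))"
          using \<open>_ = integral {x..z} _\<close> by simp
      qed
    next
      case (local x)
      then have x: "x \<in> {a..b}" by auto
      obtain d1 where d1: "0 < d1" "\<And>p q. dist p (\<gamma> x) < d1 \<Longrightarrow> dist q (\<gamma> x) < d1 \<Longrightarrow> \<bar>u q - u p\<bar> \<le> (G (\<gamma> x) + \<eta>) * dist p q"
        using loc[OF x \<eta>] by blast
      obtain d2 where d2: "0 < d2" "\<And>t. t \<in> {a..b} \<Longrightarrow> dist t x < d2 \<Longrightarrow> dist (\<gamma> t) (\<gamma> x) < d1"
        using lipschitz_on_continuous_on[OF lip] x d1(1) unfolding continuous_on_iff by blast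
      obtain d3 where d3: "0 < d3" "\<And>t. t \<in> {a..b} \<Longrightarrow> dist t x < d3 \<Longrightarrow> dist (G (\<gamma> t)) (G (\<gamma> x)) < \<eta>"
        using cg x \<eta> unfolding continuous_on_iff by blast
      show ?case
      proof (intro exI[of _ "min d2 d3"] conjI allI impI)
        show "0 < min d2 d3" using d2 d3 by simp
        fix s t assume st: "s \<le> x \<and> x \<le> t \<and> t - s < min d2 d3"
        show "P s t"
          unfolding P_def
        proof
          assume *: "a \<le> s \<and> s \<le> t \<and> t \<le> b"
          have "\<bar>u (\<gamma> t) - u (\<gamma> s)\<bar> \<le> (G (\<gamma> x) + \<eta>) * dist (\<gamma> s) (\<gamma> t)"
            using st * by (intro d1(2) d2(2)) (auto simp: dist_real_def)
          also have "\<dots> \<le> (G (\<gamma> x) + \<eta>) * (K * dist s t)"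
            using * \<eta> G0[of "\<gamma> x"] by (intro mult_left_mono lipschitz_onD[OF lip]) auto
          also have "\<dots> = K * ((G (\<gamma> x) - \<eta>) * (t - s) + 2 * \<eta> * (t - s))"
            using * by (simp add: dist_real_def algebra_simps)
          also have "\<dots> \<le> K * (integral {s..t} (\<lambda>t. G (\<gamma> t)) + 2 * \<eta> * (t - s))"
          proof (intro mult_left_mono add_right_mono K)
            have "integral {s..t} (\<lambda>_. G (\<gamma> x) - \<eta>) \<le> integral {s..t} (\<lambda>t. G (\<gamma> t))"
            proof (rule integral_le)
              fix r assume "r \<in> {s..t}"
              then have "dist (G (\<gamma> r)) (G (\<gamma> x)) < \<eta>"
                using st * by (intro d3(2)) (auto simp: dist_real_def)
              then show "G (\<gamma> x) - \<eta> \<le> G (\<gamma> r)" by (simp add: dist_real_def)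
            qed (use * in \<open>auto intro!: int\<close>)
            then show "(G (\<gamma> x) - \<eta>) * (t - s) \<le> integral {s..t} (\<lambda>t. G (\<gamma> t))"
              using * by (simp add: mult.commute)
          qed
          finally show "\<bar>u (\<gamma> t) - u (\<gamma> s)\<bar> \<le> K * (integral {s..t} (\<lambda>t. G (\<gamma> t)) + 2 * \<eta> * (t - s))" .
        qed
      qed
    qed
    then show ?thesis using ab by (simp add: P_def)
  qed
  show ?thesis
  proof (rule field_le_epsilon)
    fix e :: real assume "0 < e"
    define \<eta> where "\<eta> = e / (2 * K * (b - a) + 1)"
    have pos: "0 < 2 * K * (b - a) + 1" using K ab by (simp add: add_nonneg_pos)
    then have "0 < \<eta>" using \<open>0 < e\<close> by (simp add: \<eta>_def)
    have "K * (2 * \<eta> * (b - a)) = \<eta> * (2 * K * (b - a))" by simp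
    also have "\<dots> \<le> \<eta> * (2 * K * (b - a) + 1)" using \<open>0 < \<eta>\<close> by (intro mult_left_mono) auto
    also have "\<dots> = e" using pos by (simp add: \<eta>_def)
    finally show "\<bar>u (\<gamma> b) - u (\<gamma> a)\<bar> \<le> K * integral {a..b} (\<lambda>t. G (\<gamma> t)) + e"
      using main[OF \<open>0 < \<eta>\<close>] by (simp add: distrib_left)
  qed
qed

text \<open>The mollified function is continuously differentiable where the mollification ball fits into the
  domain, so the mean value theorem on short segments gives the local estimate required for the
  integration along the curve.\<close>

lemma (in mollifier) moll_upper_gradient:
  fixes a b :: real
  assumes wg: "weak_gradient_on \<Omega> f g" and ab: "a \<le> b" and lip: "K-lipschitz_on {a..b} \<gamma>"
    and near: "\<And>t. t \<in> {a..b} \<Longrightarrow> \<exists>e>0. cball (\<gamma> t) (r + e) \<subseteq> \<Omega>"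
  shows "\<bar>moll f (\<gamma> b) - moll f (\<gamma> a)\<bar> \<le> K * integral {a..b} (\<lambda>t. norm (moll g (\<gamma> t)))"
proof (rule upper_gradient_Lipschitz_curve[OF ab lip])
  have g: "integrable lborel g" using wg by (simp add: weak_gradient_on_def)
  show cont: "continuous_on UNIV (\<lambda>x. norm (moll g x))"
    by (intro continuous_intros continuous_moll[OF g])
  fix t \<eta> :: real assume t: "t \<in> {a..b}" and \<eta>: "0 < \<eta>"
  obtain e where e: "0 < e" "cball (\<gamma> t) (r + e) \<subseteq> \<Omega>" using near[OF t] by blast
  obtain d where d: "0 < d" "\<And>x. dist x (\<gamma> t) < d \<Longrightarrow> dist (norm (moll g x)) (norm (moll g (\<gamma> t))) < \<eta>"
    using cont \<eta> unfolding continuous_on_iff by (metis UNIV_I)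
  show "\<exists>d>0. \<forall>p q. dist p (\<gamma> t) < d \<and> dist q (\<gamma> t) < d \<longrightarrow>
      \<bar>moll f q - moll f p\<bar> \<le> (norm (moll g (\<gamma> t)) + \<eta>) * dist p q"
  proof (intro exI[of _ "min d e"] conjI allI impI)
    fix p q assume pq: "dist p (\<gamma> t) < min d e \<and> dist q (\<gamma> t) < min d e"
    have seg: "p + s *\<^sub>R (q - p) \<in> ball (\<gamma> t) (min d e)" if "s \<in> {0..1}" for s
    proof -
      have "(1 - s) *\<^sub>R p + s *\<^sub>R q \<in> ball (\<gamma> t) (min d e)"
        using pq that by (intro convexD[OF convex_ball]) (auto simp: dist_commute)
      then show ?thesis by (simp add: algebra_simps)
    qed
    have "norm (moll f (p + 1 *\<^sub>R (q - p)) - moll f (p + 0 *\<^sub>R (q - p))) \<le> ((norm (moll g (\<gamma> t)) + \<eta>) * dist p q) * norm (1 - 0 :: real)"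
    proof (rule field_differentiable_bound[of "{0..1}" _ "\<lambda>s. moll g (p + s *\<^sub>R (q - p)) \<bullet> (q - p)"])
      fix s :: real assume s: "s \<in> {0..1}"
      have "cball (p + s *\<^sub>R (q - p)) r \<subseteq> cball (\<gamma> t) (r + e)"
        using seg[OF s] by (auto simp: cball_subset_cball_iff dist_commute)
      then have sub: "cball (p + s *\<^sub>R (q - p)) r \<subseteq> \<Omega>" using e by blast
      show "((\<lambda>s. moll f (p + s *\<^sub>R (q - p))) has_field_derivative moll g (p + s *\<^sub>R (q - p)) \<bullet> (q - p)) (at s within {0..1})"
        by (rule has_field_derivative_at_within[OF moll_line_derivative[OF wg sub]])
      have "norm (moll g (p + s *\<^sub>R (q - p)) \<bullet> (q - p)) \<le> norm (moll g (p + s *\<^sub>R (q - p))) * norm (q - p)"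
        using Cauchy_Schwarz_ineq2 by simp
      also have "\<dots> \<le> (norm (moll g (\<gamma> t)) + \<eta>) * norm (q - p)"
        using d(2)[of "p + s *\<^sub>R (q - p)"] seg[OF s]
        by (intro mult_right_mono) (auto simp: dist_commute dist_real_def)
      finally show "norm (moll g (p + s *\<^sub>R (q - p)) \<bullet> (q - p)) \<le> (norm (moll g (\<gamma> t)) + \<eta>) * dist p q"
        by (simp add: dist_norm norm_minus_commute)
    qed auto
    then show "\<bar>moll f q - moll f p\<bar> \<le> (norm (moll g (\<gamma> t)) + \<eta>) * dist p q" by simp
  qed (use d e in simp)
qed simp

section \<open>Volume distortion and contraction of convex sets\<close>

lemma cube_emeasure:
  fixes u v :: "'a::euclidean_space"
  assumes "\<And>i. i \<in> Basis \<Longrightarrow> v \<bullet> i - u \<bullet> i = s" "0 \<le> s"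
  shows "emeasure lborel (cbox u v) = ennreal (s ^ DIM('a))" "emeasure lborel (box u v) = ennreal (s ^ DIM('a))"
proof -
  have "u \<bullet> i \<le> v \<bullet> i" if "i \<in> Basis" for i using assms(1)[OF that] assms(2) by linarith
  then show "emeasure lborel (cbox u v) = ennreal (s ^ DIM('a))" "emeasure lborel (box u v) = ennreal (s ^ DIM('a))"
    using assms by (simp_all add: inner_diff_left)
qed

text \<open>The preimage of a cube of side \<open>s\<close> has diameter at most \<open>K n s\<close>, where \<open>n\<close> is the dimension, and lies in
  a cube centred at any of its points whose side is twice this bound.\<close>

lemma expansive_vimage_cube:
  fixes \<Phi> :: "'a::euclidean_space \<Rightarrow> 'a"
  assumes K: "0 \<le> K" and exp: "\<And>w w'. w \<in> W \<Longrightarrow> w' \<in> W \<Longrightarrow> dist w w' \<le> K * dist (\<Phi> w) (\<Phi> w')"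
    and cube: "\<And>i. i \<in> Basis \<Longrightarrow> v \<bullet> i - u \<bullet> i = s" and s: "0 \<le> s"
    and sets: "{w \<in> W. \<Phi> w \<in> cbox u v} \<in> sets borel"
  shows "emeasure lborel {w \<in> W. \<Phi> w \<in> cbox u v} \<le> ennreal ((2 * K * DIM('a)) ^ DIM('a)) * emeasure lborel (cbox u v)"
proof (cases "{w \<in> W. \<Phi> w \<in> cbox u v} = {}")
  case False
  then obtain w0 where w0: "w0 \<in> W" "\<Phi> w0 \<in> cbox u v" by blast
  define R where "R = K * (DIM('a) * s)"
  have R: "0 \<le> R" using K s by (simp add: R_def)
  have "{w \<in> W. \<Phi> w \<in> cbox u v} \<subseteq> cbox (w0 - R *\<^sub>R One) (w0 + R *\<^sub>R One)"
  proof
    fix w assume w: "w \<in> {w \<in> W. \<Phi> w \<in> cbox u v}"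
    have "dist (\<Phi> w) (\<Phi> w0) \<le> (\<Sum>i\<in>Basis. \<bar>(\<Phi> w - \<Phi> w0) \<bullet> i\<bar>)"
      unfolding dist_norm by (rule norm_le_l1)
    also have "\<dots> \<le> (\<Sum>i\<in>(Basis::'a set). s)"
    proof (rule sum_mono)
      fix i :: 'a assume i: "i \<in> Basis"
      show "\<bar>(\<Phi> w - \<Phi> w0) \<bullet> i\<bar> \<le> s"
        using w w0(2) cube[OF i] i by (auto simp: mem_box inner_diff_left abs_le_iff) (smt (verit))+
    qed
    finally have "dist (\<Phi> w) (\<Phi> w0) \<le> DIM('a) * s" by simp
    then have "dist w w0 \<le> R"
      using exp[of w w0] w w0(1) mult_left_mono[OF _ K] unfolding R_def by (force intro: order_trans)
    then have "\<bar>(w - w0) \<bullet> i\<bar> \<le> R" if "i \<in> Basis" for i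
      using Basis_le_norm[OF that, of "w - w0"] by (simp add: dist_norm)
    then show "w \<in> cbox (w0 - R *\<^sub>R One) (w0 + R *\<^sub>R One)"
      by (auto simp: mem_box inner_diff_left inner_add_left abs_le_iff) (smt (verit))+
  qed
  then have "emeasure lborel {w \<in> W. \<Phi> w \<in> cbox u v} \<le> emeasure lborel (cbox (w0 - R *\<^sub>R One) (w0 + R *\<^sub>R One))"
    by (intro emeasure_mono) auto
  also have "\<dots> = ennreal ((2 * R) ^ DIM('a))"
    using R by (intro cube_emeasure) (auto simp: inner_diff_left inner_add_left)
  also have "(2 * R) ^ DIM('a) = (2 * K * DIM('a)) ^ DIM('a) * s ^ DIM('a)"
    by (simp add: R_def power_mult_distrib[symmetric] mult_ac)
  also have "ennreal ((2 * K * DIM('a)) ^ DIM('a) * s ^ DIM('a)) = ennreal ((2 * K * DIM('a)) ^ DIM('a)) * emeasure lborel (cbox u v)"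
  proof -
    have "emeasure lborel (cbox u v) = ennreal (s ^ DIM('a))"
      using cube s by (rule cube_emeasure(1))
    then show ?thesis using K s by (simp add: ennreal_mult)
  qed
  finally show ?thesis .
next
  case True
  then show ?thesis by (metis emeasure_empty zero_le)
qed

lemma emeasure_UN_le_count_space:
  assumes I: "countable I" and sets: "\<And>i. i \<in> I \<Longrightarrow> X i \<in> sets M"
  shows "emeasure M (\<Union>i\<in>I. X i) \<le> (\<integral>\<^sup>+i. emeasure M (X i) \<partial>count_space I)"
proof -
  have U: "(\<Union>i\<in>I. X i) \<in> sets M" using I sets by (intro sets.countable_UN') auto
  have "emeasure M (\<Union>i\<in>I. X i) = (\<integral>\<^sup>+x. indicator (\<Union>i\<in>I. X i) x \<partial>M)" using U by simp
  also have "\<dots> \<le> (\<integral>\<^sup>+x. \<integral>\<^sup>+i. indicator (X i) x \<partial>count_space I \<partial>M)"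
  proof (rule nn_integral_mono)
    fix x
    show "indicator (\<Union>i\<in>I. X i) x \<le> (\<integral>\<^sup>+i. indicator (X i) x \<partial>count_space I)"
    proof (cases "x \<in> (\<Union>i\<in>I. X i)")
      case True
      then obtain i where i: "i \<in> I" "x \<in> X i" by blast
      show ?thesis using nn_integral_ge_point[OF i(1), of "\<lambda>i. indicator (X i) x"] i True
        by (simp add: indicator_def)
    qed simp
  qed
  also have "\<dots> = (\<integral>\<^sup>+i. \<integral>\<^sup>+x. indicator (X i) x \<partial>M \<partial>count_space I)"
    using I sets by (intro nn_integral_count_space_nn_integral) auto
  also have "\<dots> = (\<integral>\<^sup>+i. emeasure M (X i) \<partial>count_space I)"
    using sets by (intro nn_integral_cong) auto
  finally show ?thesis .
qed

text \<open>Cover \<open>E\<close>, within an open set of almost the same measure, by cubes with disjoint interiors and add up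
  the estimates for the cubes.\<close>

lemma expansive_vimage_bounded:
  fixes \<Phi> :: "'a::euclidean_space \<Rightarrow> 'a"
  assumes K: "0 \<le> K" and exp: "\<And>w w'. w \<in> W \<Longrightarrow> w' \<in> W \<Longrightarrow> dist w w' \<le> K * dist (\<Phi> w) (\<Phi> w')"
    and cont: "continuous_on W \<Phi>" and W: "W \<in> sets borel"
    and E: "E \<in> sets borel" "bounded E"
  shows "emeasure lborel {w \<in> W. \<Phi> w \<in> E} \<le> ennreal ((2 * K * DIM('a)) ^ DIM('a)) * emeasure lborel E"
proof -
  let ?C = "ennreal ((2 * K * DIM('a)) ^ DIM('a))"
  have vim: "{w \<in> W. \<Phi> w \<in> A} \<in> sets borel" if "A \<in> sets borel" for A
  proof -
    have "\<Phi> \<in> borel_measurable (restrict_space borel W)"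
      using cont by (rule borel_measurable_continuous_on_restrict)
    then have "\<Phi> -` A \<inter> space (restrict_space borel W) \<in> sets (restrict_space borel W)"
      using that by (rule measurable_sets)
    moreover have "\<Phi> -` A \<inter> space (restrict_space borel W) = {w \<in> W. \<Phi> w \<in> A}"
      by (auto simp: space_restrict_space)
    ultimately show ?thesis using W by (simp add: sets_restrict_space_iff)
  qed
  obtain B where B: "0 < B" "E \<subseteq> cbox (- (B *\<^sub>R One)) (B *\<^sub>R One)"
  proof -
    obtain b where b: "0 < b" "\<And>x. x \<in> E \<Longrightarrow> norm x \<le> b"
      using E(2) bounded_pos by blast
    have "E \<subseteq> cbox (- (b *\<^sub>R One)) (b *\<^sub>R One)"
    proof
      fix x assume "x \<in> E"
      then have "\<bar>x \<bullet> i\<bar> \<le> b" if "i \<in> Basis" for i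
        using Basis_le_norm[OF that, of x] b(2) by fastforce
      then show "x \<in> cbox (- (b *\<^sub>R One)) (b *\<^sub>R One)"
        by (auto simp: mem_box abs_le_iff) (smt (verit))
    qed
    then show thesis using that b(1) by blast
  qed
  have open_le: "emeasure lborel {w \<in> W. \<Phi> w \<in> E} \<le> ?C * emeasure lborel T" if T: "open T" "E \<subseteq> T" for T
  proof -
    have ga: "gauge (\<lambda>x. if x \<in> T then T else UNIV)" using T(1) by (simp add: gauge_def)
    have ne: "box (- (B *\<^sub>R One)) (B *\<^sub>R One :: 'a) \<noteq> {}" using B(1) by (simp add: box_ne_empty)
    obtain \<D> where \<D>: "countable \<D>" "\<And>K. K \<in> \<D> \<Longrightarrow> interior K \<noteq> {} \<and> (\<exists>c d. K = cbox c d)"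
      "pairwise (\<lambda>A B. interior A \<inter> interior B = {}) \<D>"
      "\<And>K. K \<in> \<D> \<Longrightarrow> \<exists>x \<in> E \<inter> K. K \<subseteq> (if x \<in> T then T else UNIV)"
      "\<And>u v. cbox u v \<in> \<D> \<Longrightarrow> \<exists>n. \<forall>i \<in> Basis. v \<bullet> i - u \<bullet> i = ((B *\<^sub>R One) \<bullet> i - (- (B *\<^sub>R One)) \<bullet> i) / 2^n"
      "E \<subseteq> \<Union>\<D>"
      using covering_lemma[OF B(2) ne ga] by metis
    have KT: "K \<subseteq> T" if "K \<in> \<D>" for K using \<D>(4)[OF that] T(2) by (auto split: if_splits)
    have cube: "emeasure lborel {w \<in> W. \<Phi> w \<in> Q} \<le> ?C * emeasure lborel (interior Q)" if Q: "Q \<in> \<D>" for Q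
    proof -
      obtain u v where uv: "Q = cbox u v" using \<D>(2)[OF Q] by blast
      obtain n where n: "\<And>i. i \<in> Basis \<Longrightarrow> v \<bullet> i - u \<bullet> i = 2 * B / 2 ^ n"
        using \<D>(5) Q uv by fastforce
      have s: "0 \<le> 2 * B / 2 ^ n" using B(1) by simp
      have "emeasure lborel {w \<in> W. \<Phi> w \<in> cbox u v} \<le> ?C * emeasure lborel (cbox u v)"
        by (rule expansive_vimage_cube[OF K exp n s]) (auto intro: vim)
      also have "emeasure lborel (cbox u v) = emeasure lborel (box u v)"
        using cube_emeasure[OF n s] by simp
      finally show ?thesis by (simp add: uv interior_cbox)
    qed
    have "{w \<in> W. \<Phi> w \<in> E} \<subseteq> (\<Union>Q\<in>\<D>. {w \<in> W. \<Phi> w \<in> Q})" using \<D>(6) by blast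
    moreover have Qb: "{w \<in> W. \<Phi> w \<in> Q} \<in> sets borel" if "Q \<in> \<D>" for Q using \<D>(2)[OF that] by (auto intro: vim)
    ultimately have "emeasure lborel {w \<in> W. \<Phi> w \<in> E} \<le> emeasure lborel (\<Union>Q\<in>\<D>. {w \<in> W. \<Phi> w \<in> Q})"
      using \<D>(1) by (intro emeasure_mono) (auto intro!: sets.countable_UN')
    also have "\<dots> \<le> (\<integral>\<^sup>+Q. emeasure lborel {w \<in> W. \<Phi> w \<in> Q} \<partial>count_space \<D>)"
      by (rule emeasure_UN_le_count_space[OF \<D>(1)]) (use Qb in simp)
    also have "\<dots> \<le> (\<integral>\<^sup>+Q. ?C * emeasure lborel (interior Q) \<partial>count_space \<D>)"
      using cube by (intro nn_integral_mono) auto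
    also have "\<dots> = ?C * (\<integral>\<^sup>+Q. emeasure lborel (interior Q) \<partial>count_space \<D>)"
      by (rule nn_integral_cmult) simp
    also have "(\<integral>\<^sup>+Q. emeasure lborel (interior Q) \<partial>count_space \<D>) = emeasure lborel (\<Union>Q\<in>\<D>. interior Q)"
      by (rule emeasure_UN_countable[symmetric])
         (use \<D>(1,3) in \<open>auto simp: disjoint_family_on_def pairwise_def\<close>)
    also have "?C * emeasure lborel (\<Union>Q\<in>\<D>. interior Q) \<le> ?C * emeasure lborel T"
      using KT interior_subset T(1) by (intro mult_left_mono emeasure_mono) fastforce+
    finally show ?thesis .
  qed
  have fin: "emeasure lborel E < \<infinity>"
    using emeasure_mono[OF B(2), of lborel] emeasure_lborel_cbox_finite by (auto intro: le_less_trans)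
  show ?thesis
  proof (rule ennreal_le_epsilon)
    fix e :: real assume e: "0 < e"
    define e' where "e' = e / ((2 * K * DIM('a)) ^ DIM('a) + 1)"
    have pos: "0 < (2 * K * DIM('a)) ^ DIM('a) + 1" using K by (simp add: add_nonneg_pos)
    have e': "0 < e'" using e pos by (simp add: e'_def)
    have "E \<in> sets lebesgue" using E by auto
    then obtain T where T: "open T" "E \<subseteq> T" "emeasure lebesgue (T - E) < ennreal e'"
      using sets_lebesgue_outer_open[OF _ e'] by metis
    have "emeasure lborel T \<le> emeasure lborel E + emeasure lborel (T - E)"
      using emeasure_subadditive[of E lborel "T - E"] E T(1,2) by (simp add: Un_absorb1)
    also have "\<dots> \<le> emeasure lborel E + ennreal e'"
      using T(1,3) E by (intro add_left_mono) auto
    finally have "?C * emeasure lborel T \<le> ?C * (emeasure lborel E + ennreal e')"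
      by (rule mult_left_mono) simp
    also have "\<dots> = ?C * emeasure lborel E + ennreal ((2 * K * DIM('a)) ^ DIM('a) * e')"
      using e' K by (simp add: distrib_left ennreal_mult)
    also have "\<dots> \<le> ?C * emeasure lborel E + ennreal e"
    proof (intro add_left_mono ennreal_leI)
      have "(2 * K * DIM('a)) ^ DIM('a) * e' \<le> ((2 * K * DIM('a)) ^ DIM('a) + 1) * e'"
        using e' by (intro mult_right_mono) auto
      also have "\<dots> = e" using pos by (simp add: e'_def)
      finally show "(2 * K * DIM('a)) ^ DIM('a) * e' \<le> e" .
    qed
    finally show "emeasure lborel {w \<in> W. \<Phi> w \<in> E} \<le> ?C * emeasure lborel E + ennreal e"
      using open_le[OF T(1,2)] by (rule order_trans[rotated])
  qed
qed

lemma nn_integral_expansive_le: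
  fixes \<Phi> :: "'a::euclidean_space \<Rightarrow> 'a"
  assumes K: "0 \<le> K" and exp: "\<And>w w'. w \<in> W \<Longrightarrow> w' \<in> W \<Longrightarrow> dist w w' \<le> K * dist (\<Phi> w) (\<Phi> w')"
    and cont: "continuous_on W \<Phi>" and W: "W \<in> sets borel" and bd: "bounded (\<Phi> ` W)"
    and h: "h \<in> borel_measurable borel"
  shows "(\<integral>\<^sup>+w\<in>W. h (\<Phi> w) \<partial>lborel) \<le> ennreal ((2 * K * DIM('a)) ^ DIM('a)) * (\<integral>\<^sup>+x. h x \<partial>lborel)"
proof -
  let ?C = "ennreal ((2 * K * DIM('a)) ^ DIM('a))"
  have [measurable]: "\<Phi> \<in> borel_measurable (restrict_space lborel W)"
    using borel_measurable_continuous_on_restrict[OF cont] by (simp add: measurable_cong_sets sets_restrict_space cong: measurable_cong_sets)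
  let ?N = "distr (restrict_space lborel W) borel \<Phi>"
  obtain b where b: "\<And>w. w \<in> W \<Longrightarrow> norm (\<Phi> w) \<le> b"
    using bd bounded_iff by (metis imageI)
  have "?N \<le> scale_measure ?C lborel"
  proof (subst le_measure)
    show "\<forall>A\<in>sets ?N. emeasure ?N A \<le> emeasure (scale_measure ?C lborel) A"
    proof
      fix A assume "A \<in> sets ?N"
      then have A: "A \<in> sets borel" by simp
      have "emeasure ?N A = emeasure (restrict_space lborel W) (\<Phi> -` A \<inter> space (restrict_space lborel W))"
        using A by (subst emeasure_distr) auto
      also have "\<Phi> -` A \<inter> space (restrict_space lborel W) = {w \<in> W. \<Phi> w \<in> A}"
        by (auto simp: space_restrict_space)
      also have "emeasure (restrict_space lborel W) {w \<in> W. \<Phi> w \<in> A} = emeasure lborel {w \<in> W. \<Phi> w \<in> A}"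
        using W by (intro emeasure_restrict_space) auto
      also have "{w \<in> W. \<Phi> w \<in> A} = {w \<in> W. \<Phi> w \<in> A \<inter> cball 0 b}" using b by auto
      also have "emeasure lborel {w \<in> W. \<Phi> w \<in> A \<inter> cball 0 b} \<le> ?C * emeasure lborel (A \<inter> cball 0 b)"
        using A by (intro expansive_vimage_bounded[OF K exp cont W]) (auto intro: bounded_Int)
      also have "\<dots> \<le> ?C * emeasure lborel A"
        using A by (intro mult_left_mono emeasure_mono) auto
      finally show "emeasure ?N A \<le> emeasure (scale_measure ?C lborel) A" by simp
    qed
  qed simp
  then have "nn_integral ?N h \<le> nn_integral (scale_measure ?C lborel) h"
    by (intro nn_integral_mono_measure) auto
  also have "nn_integral (scale_measure ?C lborel) h = ?C * (\<integral>\<^sup>+x. h x \<partial>lborel)"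
    using h by (simp add: nn_integral_scale_measure)
  also have "nn_integral ?N h = (\<integral>\<^sup>+w\<in>W. h (\<Phi> w) \<partial>lborel)"
    using h W by (subst nn_integral_distr) (auto simp: nn_integral_restrict_space)
  finally show ?thesis .
qed

lemma AE_expansive:
  fixes \<Phi> :: "'a::euclidean_space \<Rightarrow> 'a"
  assumes K: "0 \<le> K" and exp: "\<And>w w'. w \<in> W \<Longrightarrow> w' \<in> W \<Longrightarrow> dist w w' \<le> K * dist (\<Phi> w) (\<Phi> w')"
    and cont: "continuous_on W \<Phi>" and W: "W \<in> sets borel" and bd: "bounded (\<Phi> ` W)"
    and P: "AE x in lborel. P x"
  shows "AE w in lborel. w \<in> W \<longrightarrow> P (\<Phi> w)"
proof -
  obtain N where N: "{x. \<not> P x} \<subseteq> N" "N \<in> null_sets lborel"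
    using P by (auto elim!: AE_E simp: null_sets_def)
  have [measurable]: "(\<lambda>w. indicator W w * indicator N (\<Phi> w) :: ennreal) \<in> borel_measurable lborel"
  proof -
    have "\<Phi> \<in> borel_measurable (restrict_space borel W)"
      by (rule borel_measurable_continuous_on_restrict[OF cont])
    then have "(\<lambda>w. indicator N (\<Phi> w) :: ennreal) \<in> borel_measurable (restrict_space borel W)"
      using N(2) by (intro measurable_compose[OF _ borel_measurable_indicator]) auto
    then show ?thesis
      using W by (subst (asm) borel_measurable_restrict_space_iff_ennreal) (auto simp: mult.commute)
  qed
  have "(\<integral>\<^sup>+w\<in>W. indicator N (\<Phi> w) \<partial>lborel) \<le> ennreal ((2 * K * DIM('a)) ^ DIM('a)) * (\<integral>\<^sup>+x. indicator N x \<partial>lborel)"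
    using N(2) by (intro nn_integral_expansive_le[OF K exp cont W bd]) auto
  also have "(\<integral>\<^sup>+x. indicator N x \<partial>lborel) = 0"
    using N(2) by (subst nn_integral_indicator) (auto simp: null_sets_def)
  also have "ennreal ((2 * K * DIM('a)) ^ DIM('a)) * 0 = 0" by simp
  finally have "(\<integral>\<^sup>+w. indicator W w * indicator N (\<Phi> w) \<partial>lborel) = 0"
    by (simp add: mult.commute)
  then have "AE w in lborel. indicator W w * indicator N (\<Phi> w) = (0::ennreal)"
    by (subst (asm) nn_integral_0_iff_AE) auto
  then show ?thesis
    by eventually_elim (use N(1) in \<open>auto simp: indicator_def split: if_splits\<close>)
qed

text \<open>Contracting a convex set towards one of its points. The weight \<open>t ^ (DIM('a) - 1)\<close> leaves, after
  the substitution \<open>w = z + t (y - z)\<close>, the kernel \<open>t\<^sup>-\<^sup>3\<close>, whose integral from \<open>norm (w - z) / (2 R)\<close>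
  cancels the factor \<open>norm (w - z)\<^sup>2\<close>.\<close>

lemma cone_integral_le:
  fixes z :: "'a::euclidean_space" and Q :: "'a \<Rightarrow> ennreal"
  assumes W: "convex W" "W \<subseteq> ball a R" and z: "z \<in> W" and \<tau>: "0 < \<tau>"
    and Q[measurable]: "Q \<in> borel_measurable borel"
  shows "(\<integral>\<^sup>+y. indicator (interior W) y * (\<integral>\<^sup>+t. indicator {\<tau>..1} t *
      (ennreal (t ^ (DIM('a) - 1) * (norm (y - z))\<^sup>2) * Q (z + t *\<^sub>R (y - z))) \<partial>lborel) \<partial>lborel)
     \<le> ennreal (2 * R\<^sup>2) * (\<integral>\<^sup>+w. indicator (interior W) w * Q w \<partial>lborel)"
proof -
  let ?d = "DIM('a)"
  define I where "I = interior W"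
  have [measurable]: "I \<in> sets borel" by (simp add: I_def)
  have R: "0 < R" using z W(2) by (metis ball_eq_empty empty_iff not_le subsetD)
  have diam: "norm (y - z) < 2 * R" if "y \<in> W" for y
  proof -
    have "dist y z \<le> dist y a + dist a z" by (rule dist_triangle)
    then show ?thesis using that z W(2) by (auto simp: dist_norm subset_iff norm_minus_commute) (smt (verit) norm_minus_commute)
  qed
  let ?F = "\<lambda>y t. indicator I y * (indicator {\<tau>..1} t * (ennreal (t ^ (?d - 1) * (norm (y - z))\<^sup>2) * Q (z + t *\<^sub>R (y - z))))"
  let ?G = "\<lambda>w t. indicator I w * Q w * (indicator {\<tau>..1} t * ((if norm (w - z) / (2 * R) \<le> t then 1 else 0) * ennreal ((norm (w - z))\<^sup>2 / t ^ 3)))"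
  have "(\<integral>\<^sup>+y. indicator I y * (\<integral>\<^sup>+t. indicator {\<tau>..1} t * (ennreal (t ^ (?d - 1) * (norm (y - z))\<^sup>2) * Q (z + t *\<^sub>R (y - z))) \<partial>lborel) \<partial>lborel)
      = (\<integral>\<^sup>+y. \<integral>\<^sup>+t. ?F y t \<partial>lborel \<partial>lborel)"
    by (intro nn_integral_cong) (simp add: nn_integral_cmult)
  also have "\<dots> = (\<integral>\<^sup>+t. \<integral>\<^sup>+y. ?F y t \<partial>lborel \<partial>lborel)"
    by (rule lborel_pair.Fubini'[symmetric]) measurable
  also have "\<dots> \<le> (\<integral>\<^sup>+t. \<integral>\<^sup>+w. ?G w t \<partial>lborel \<partial>lborel)"
  proof (rule nn_integral_mono)
    fix t :: real
    show "(\<integral>\<^sup>+y. ?F y t \<partial>lborel) \<le> (\<integral>\<^sup>+w. ?G w t \<partial>lborel)"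
    proof (cases "t \<in> {\<tau>..1}")
      case True
      then have t: "0 < t" "t \<le> 1" using \<tau> by auto
      have "(\<integral>\<^sup>+y. ?F y t \<partial>lborel) = ennreal (\<bar>1 / t\<bar> ^ ?d) * (\<integral>\<^sup>+w. ?F ((z - (1 / t) *\<^sub>R z) + (1 / t) *\<^sub>R w) t \<partial>lborel)"
        using t by (intro nn_integral_lborel_affine) auto
      also have "\<dots> = (\<integral>\<^sup>+w. ennreal (\<bar>1 / t\<bar> ^ ?d) * ?F ((z - (1 / t) *\<^sub>R z) + (1 / t) *\<^sub>R w) t \<partial>lborel)"
        by (rule nn_integral_cmult[symmetric]) measurable
      also have "\<dots> \<le> (\<integral>\<^sup>+w. ?G w t \<partial>lborel)"
      proof (rule nn_integral_mono)
        fix w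
        define y where "y = (z - (1 / t) *\<^sub>R z) + (1 / t) *\<^sub>R w"
        have yz: "y - z = (1 / t) *\<^sub>R (w - z)" by (simp add: y_def algebra_simps)
        have w: "w = z + t *\<^sub>R (y - z)" using t by (simp add: yz)
        show "ennreal (\<bar>1 / t\<bar> ^ ?d) * ?F ((z - (1 / t) *\<^sub>R z) + (1 / t) *\<^sub>R w) t \<le> ?G w t"
        proof (cases "y \<in> I")
          case yI: True
          have "y - (1 - t) *\<^sub>R (y - z) \<in> I"
          proof (cases "t = 1")
            case False
            have "y - (1 - t) *\<^sub>R (y - z) = z - (- t) *\<^sub>R (y - z)" by (simp add: algebra_simps)
            moreover have "z - t *\<^sub>R (z - y) \<in> interior W"
              using mem_interior_convex_shrink[OF W(1), of y z t] yI z t by (simp add: I_def)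
            ultimately show ?thesis by (simp add: I_def algebra_simps)
          qed (use yI in simp)
          then have wI: "w \<in> I" by (simp add: w algebra_simps)
          have "norm (y - z) < 2 * R" using yI interior_subset by (intro diam) (auto simp: I_def)
          then have "norm (w - z) / (2 * R) \<le> t"
          proof -
            have "norm (w - z) = t * norm (y - z)" using t by (simp add: yz)
            also have "\<dots> \<le> t * (2 * R)"
              using \<open>norm (y - z) < 2 * R\<close> t by (intro mult_left_mono) auto
            finally show ?thesis using R by (simp add: divide_le_eq)
          qed
          then have "?G w t = Q w * ennreal ((norm (w - z))\<^sup>2 / t ^ 3)" using wI True by simp
          moreover have "ennreal (\<bar>1 / t\<bar> ^ ?d) * ?F y t = ennreal ((1 / t) ^ ?d * (t ^ (?d - 1) * (norm (y - z))\<^sup>2)) * Q w"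
            using yI True t by (simp add: w[symmetric] ennreal_mult mult_ac)
          moreover have "(1 / t) ^ ?d * (t ^ (?d - 1) * (norm (y - z))\<^sup>2) = (norm (w - z))\<^sup>2 / t ^ 3"
          proof -
            have "t ^ ?d = t * t ^ (?d - 1)" by (simp add: power_eq_if[of t ?d])
            then have "(1 / t) ^ ?d * t ^ (?d - 1) = 1 / t" using t by (simp add: power_divide)
            then have "(1 / t) ^ ?d * (t ^ (?d - 1) * (norm (y - z))\<^sup>2) = 1 / t * (norm (y - z))\<^sup>2"
              by (metis mult.assoc)
            also have "\<dots> = (norm (w - z))\<^sup>2 / t ^ 3"
              using t by (simp add: yz power_divide power3_eq_cube power2_eq_square)
            finally show ?thesis .
          qed
          ultimately show ?thesis unfolding y_def[symmetric] by (simp add: mult.commute)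
        next
          case False
          then show ?thesis unfolding y_def[symmetric] by simp
        qed
      qed
      finally show ?thesis .
    qed simp
  qed
  also have "\<dots> = (\<integral>\<^sup>+w. \<integral>\<^sup>+t. ?G w t \<partial>lborel \<partial>lborel)"
    by (rule lborel_pair.Fubini') measurable
  also have "\<dots> \<le> (\<integral>\<^sup>+w. indicator I w * Q w * ennreal (2 * R\<^sup>2) \<partial>lborel)"
  proof (rule nn_integral_mono)
    fix w
    have "(\<integral>\<^sup>+t. ?G w t \<partial>lborel) = indicator I w * Q w * (\<integral>\<^sup>+t. indicator {\<tau>..1} t * ((if norm (w - z) / (2 * R) \<le> t then 1 else 0) * ennreal ((norm (w - z))\<^sup>2 / t ^ 3)) \<partial>lborel)"
      by (rule nn_integral_cmult) measurable
    also have "\<dots> \<le> indicator I w * Q w * ennreal (2 * R\<^sup>2)"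
    proof (rule mult_left_mono)
      show "(\<integral>\<^sup>+t. indicator {\<tau>..1} t * ((if norm (w - z) / (2 * R) \<le> t then 1 else 0) * ennreal ((norm (w - z))\<^sup>2 / t ^ 3)) \<partial>lborel) \<le> ennreal (2 * R\<^sup>2)"
      proof (cases "w = z")
        case False
        define m where "m = norm (w - z)"
        define s where "s = m / (2 * R)"
        have m: "0 < m" using False by (simp add: m_def)
        have s: "0 < s" using m R by (simp add: s_def)
        have "(\<integral>\<^sup>+t. indicator {\<tau>..1} t * ((if s \<le> t then 1 else 0) * ennreal (m\<^sup>2 / t ^ 3)) \<partial>lborel)
            \<le> (\<integral>\<^sup>+t. ennreal (m\<^sup>2 / t ^ 3) * indicator {s..} t \<partial>lborel)"
          by (intro nn_integral_mono) (auto simp: indicator_def)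
        also have "\<dots> = ennreal (0 - (- (m\<^sup>2 / (2 * s\<^sup>2))))"
        proof (rule nn_integral_FTC_atLeast)
          show "((\<lambda>t. - (m\<^sup>2 / (2 * t\<^sup>2))) has_real_derivative m\<^sup>2 / t ^ 3) (at t)" if "s \<le> t" for t
          proof -
            have t: "0 < t" using s that by simp
            show ?thesis
              using t by (auto intro!: derivative_eq_intros simp: divide_simps)
                (simp_all add: power2_eq_square power3_eq_cube power4_eq_xxxx algebra_simps)
          qed
          show "((\<lambda>t. - (m\<^sup>2 / (2 * t\<^sup>2))) \<longlongrightarrow> 0) at_top" by real_asymp
        qed (use s in auto)
        also have "0 - (- (m\<^sup>2 / (2 * s\<^sup>2))) = 2 * R\<^sup>2"
          using m R by (simp add: s_def power_divide power2_eq_square field_simps)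
        finally show ?thesis by (simp add: m_def s_def)
      qed simp
    qed simp
    finally show "(\<integral>\<^sup>+t. ?G w t \<partial>lborel) \<le> indicator I w * Q w * ennreal (2 * R\<^sup>2)" .
  qed
  also have "\<dots> = ennreal (2 * R\<^sup>2) * (\<integral>\<^sup>+w. indicator I w * Q w \<partial>lborel)"
    by (subst nn_integral_multc) (auto simp: mult.commute)
  finally show ?thesis by (simp add: I_def)
qed

text \<open>If \<open>f\<close> vanishes on the image of the contracted copy \<open>z + \<tau> (W - z)\<close>, then \<open>f (\<Phi> y)\<close> is the increment
  of \<open>f\<close> along the image of the segment from \<open>z + \<tau> (y - z)\<close> to \<open>y\<close>. The Cauchy--Schwarz inequality with the
  weights \<open>t\<^sup>1\<^sup>-\<^sup>d\<close> and \<open>t\<^sup>d\<^sup>-\<^sup>1\<close>, where \<open>d\<close> is the dimension, reduces the claim to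
  the integral over the contractions of \<open>W\<close>. The increment is taken for the mollifications of \<open>f\<close>, which are
  regular along the segment once the radius is small enough for this \<open>y\<close>; Fatou's lemma
  passes to the limit although that radius depends on \<open>y\<close>, and Jensen's inequality bounds the mollified gradients by \<open>g\<close>.\<close>

theorem cone_vanishing_estimate:
  fixes \<Phi> :: "real^'n \<Rightarrow> real^'n" and W :: "(real^'n) set"
  assumes W: "convex W" "W \<subseteq> ball a R" and z: "z \<in> W" and \<tau>: "0 < \<tau>" "\<tau> \<le> 1"
    and lip: "K-lipschitz_on (interior W) \<Phi>"
    and exp: "\<And>w w'. w \<in> interior W \<Longrightarrow> w' \<in> interior W \<Longrightarrow> dist w w' \<le> K * dist (\<Phi> w) (\<Phi> w')"
    and \<Omega>: "open \<Omega>" "\<Phi> ` interior W \<subseteq> \<Omega>" and wg: "weak_gradient_on \<Omega> f g"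
    and V: "open V" "\<And>y. y \<in> interior W \<Longrightarrow> \<Phi> (z + \<tau> *\<^sub>R (y - z)) \<in> V"
    and f0: "AE x in lborel. x \<in> V \<longrightarrow> f x = 0"
  shows "(\<integral>\<^sup>+y. indicator (interior W) y * ennreal ((f (\<Phi> y))\<^sup>2) \<partial>lborel)
    \<le> ennreal ((2 * K * CARD('n)) ^ CARD('n) * (2 * R\<^sup>2) * K\<^sup>2)
      * (\<integral>\<^sup>+t. indicator {\<tau>..1} t * ennreal (1 / t ^ (CARD('n) - 1)) \<partial>lborel)
      * (\<integral>\<^sup>+x. ennreal ((norm (g x))\<^sup>2) \<partial>lborel)"
proof -
  define I where "I = interior W"
  define d where "d = CARD('n) - 1"
  have [measurable]: "I \<in> sets borel" by (simp add: I_def)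
  have K: "0 \<le> K" using lip by (rule lipschitz_on_nonneg)
  have cont: "continuous_on I \<Phi>" using lip unfolding I_def by (rule lipschitz_on_continuous_on)
  have f: "integrable lborel f" and g: "integrable lborel g" using wg by (auto simp: weak_gradient_on_def)
  have [measurable]: "f \<in> borel_measurable borel" "g \<in> borel_measurable borel" using f g by auto
  have bdI: "bounded I" using W(2) interior_subset unfolding I_def
    by (meson bounded_ball bounded_subset)
  have bd: "bounded (\<Phi> ` I)"
    using lip bdI unfolding I_def
    by (intro bounded_uniformly_continuous_image lipschitz_on_uniformly_continuous)
  have comp_meas: "(\<lambda>w. indicator I w * h (\<Phi> w)) \<in> borel_measurable borel"
    if "h \<in> borel_measurable borel" for h :: "_ \<Rightarrow> ennreal"
  proof -
    have "\<Phi> \<in> borel_measurable (restrict_space borel I)"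
      by (rule borel_measurable_continuous_on_restrict[OF cont])
    then have "(\<lambda>w. h (\<Phi> w)) \<in> borel_measurable (restrict_space borel I)"
      using that by (rule measurable_compose)
    then show ?thesis
      by (subst (asm) borel_measurable_restrict_space_iff_ennreal) (auto simp: mult.commute I_def)
  qed
  have seg: "z + t *\<^sub>R (y - z) \<in> I" if "y \<in> I" "0 < t" "t \<le> 1" for y t
  proof -
    have "z - t *\<^sub>R (z - y) \<in> interior W"
      using mem_interior_convex_shrink[OF W(1), of y z t] that z by (simp add: I_def)
    then show ?thesis by (simp add: I_def algebra_simps)
  qed
  obtain \<delta> \<rho> \<rho>' where m: "\<And>n::nat. mollifier (\<delta> n) (\<rho> n) (\<rho>' n)" and \<delta>: "\<delta> \<longlonglongrightarrow> 0"
    and conv: "AE x in lborel. (\<lambda>n. mollifier.moll (\<rho> n) f x) \<longlonglongrightarrow> f x"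
    using mollifiers_converge_AE[OF f] by blast
  define v where "v n y = mollifier.moll (\<rho> n) f (\<Phi> y)" for n y
  define G where "G n x = mollifier.moll (\<rho> n) g x" for n x
  have Gm[measurable]: "G n \<in> borel_measurable borel" for n
    unfolding G_def[abs_def] by (rule mollifier.measurable_moll[OF m]) simp
  define Q where "Q n w = indicator I w * ennreal ((norm (G n (\<Phi> w)))\<^sup>2)" for n w
  have Qm[measurable]: "Q n \<in> borel_measurable borel" for n
    unfolding Q_def[abs_def] by (rule comp_meas[of "\<lambda>x. ennreal ((norm (G n x))\<^sup>2)"]) measurable
  define J where "J = (\<integral>\<^sup>+t. indicator {\<tau>..1} t * ennreal (1 / t ^ d) \<partial>lborel)"
  define H where "H n y = indicator I y * (\<integral>\<^sup>+t. indicator {\<tau>..1} t *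
      (ennreal (t ^ d * (norm (y - z))\<^sup>2) * Q n (z + t *\<^sub>R (y - z))) \<partial>lborel)" for n y
  have Hm[measurable]: "H n \<in> borel_measurable borel" for n
    unfolding H_def[abs_def] by measurable
  \<comment> \<open>the radius has to keep the balls around the curve inside \<Omega> and the ball around its initial point inside V\<close>
  have pointwise: "\<forall>\<^sub>F n in sequentially. ennreal ((v n y)\<^sup>2) \<le> ennreal (K\<^sup>2) * J * H n y" if y: "y \<in> I" for y
  proof -
    define \<gamma> where "\<gamma> t = \<Phi> (z + t *\<^sub>R (y - z))" for t
    have \<gamma>lip: "(K * norm (y - z))-lipschitz_on {\<tau>..1} \<gamma>"
    proof (rule lipschitz_onI)
      fix s t assume st: "s \<in> {\<tau>..1}" "t \<in> {\<tau>..1}"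
      have "dist (\<gamma> s) (\<gamma> t) \<le> K * dist (z + s *\<^sub>R (y - z)) (z + t *\<^sub>R (y - z))"
        unfolding \<gamma>_def using st \<tau> y by (intro lipschitz_onD[OF lip] seg[unfolded I_def]) (auto simp: I_def)
      also have "dist (z + s *\<^sub>R (y - z)) (z + t *\<^sub>R (y - z)) = norm ((s - t) *\<^sub>R (y - z))"
        by (simp add: dist_norm scaleR_diff_left)
      also have "\<dots> = norm (y - z) * dist s t" by (simp add: dist_real_def)
      finally show "dist (\<gamma> s) (\<gamma> t) \<le> K * norm (y - z) * dist s t" by (simp add: mult_ac)
    qed (use K in simp)
    have \<gamma>c: "continuous_on {\<tau>..1} \<gamma>" using \<gamma>lip by (rule lipschitz_on_continuous_on)
    have "compact (\<gamma> ` {\<tau>..1})" using \<gamma>c by (intro compact_continuous_image) auto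
    moreover have "\<gamma> ` {\<tau>..1} \<subseteq> \<Omega>"
      using seg[OF y] \<tau> \<Omega>(2) unfolding \<gamma>_def I_def by force
    ultimately obtain e1 where e1: "0 < e1" "(\<Union>x\<in>\<gamma> ` {\<tau>..1}. cball x e1) \<subseteq> \<Omega>"
      using compact_subset_open_imp_cball_epsilon_subset[OF _ \<Omega>(1)] by blast
    have "\<gamma> \<tau> \<in> V" using V(2) y by (simp add: \<gamma>_def I_def)
    then obtain e2 where e2: "0 < e2" "ball (\<gamma> \<tau>) e2 \<subseteq> V" using V(1) open_contains_ball by blast
    have "\<forall>\<^sub>F n in sequentially. \<delta> n < min (e1 / 2) e2"
      using \<delta> e1(1) e2(1) by (intro order_tendstoD) auto
    then show ?thesis
    proof eventually_elim
      case (elim n)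
      have int: "continuous_on {\<tau>..1} (\<lambda>t. norm (G n (\<gamma> t)))"
        unfolding G_def
        by (intro continuous_intros continuous_on_compose2[OF mollifier.continuous_moll[OF m g] \<gamma>c]) auto
      have v\<tau>: "mollifier.moll (\<rho> n) f (\<gamma> \<tau>) = 0"
      proof (rule mollifier.moll_eq_if_constant_near[OF m])
        have "ball (\<gamma> \<tau>) (\<delta> n) \<subseteq> V" using e2(2) elim subset_ball[of "\<delta> n" e2 "\<gamma> \<tau>"] by auto
        then show "AE x in lborel. x \<in> ball (\<gamma> \<tau>) (\<delta> n) \<longrightarrow> f x = 0"
          using f0 by (auto elim!: eventually_mono)
      qed simp
      have "\<bar>mollifier.moll (\<rho> n) f (\<gamma> 1) - mollifier.moll (\<rho> n) f (\<gamma> \<tau>)\<bar> \<le> (K * norm (y - z)) * integral {\<tau>..1} (\<lambda>t. norm (G n (\<gamma> t)))"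
        unfolding G_def
      proof (rule mollifier.moll_upper_gradient[OF m wg \<tau>(2) \<gamma>lip])
        fix t assume "t \<in> {\<tau>..1}"
        then have "cball (\<gamma> t) e1 \<subseteq> \<Omega>" using e1(2) by blast
        moreover have "cball (\<gamma> t) (\<delta> n + e1 / 2) \<subseteq> cball (\<gamma> t) e1" using elim by (intro subset_cball) simp
        ultimately show "\<exists>e>0. cball (\<gamma> t) (\<delta> n + e) \<subseteq> \<Omega>" using e1(1) by (intro exI[of _ "e1 / 2"]) auto
      qed
      then have bound: "\<bar>v n y\<bar> \<le> (K * norm (y - z)) * integral {\<tau>..1} (\<lambda>t. norm (G n (\<gamma> t)))"
        using v\<tau> by (simp add: \<gamma>_def v_def)
      let ?S = "\<integral>\<^sup>+t. indicator {\<tau>..1} t * ennreal (norm (G n (\<gamma> t))) \<partial>lborel"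
      have S: "ennreal (integral {\<tau>..1} (\<lambda>t. norm (G n (\<gamma> t)))) = ?S"
      proof -
        have "set_integrable lborel {\<tau>..1} (\<lambda>t. norm (G n (\<gamma> t)))"
          unfolding set_integrable_def by (rule borel_integrable_compact[OF _ int]) simp
        then have "(LINT t:{\<tau>..1}|lborel. norm (G n (\<gamma> t))) = integral {\<tau>..1} (\<lambda>t. norm (G n (\<gamma> t)))"
          by (rule set_borel_integral_eq_integral(2))
        moreover have "?S = ennreal (LINT t:{\<tau>..1}|lborel. norm (G n (\<gamma> t)))"
          unfolding set_lebesgue_integral_def
          using \<open>set_integrable lborel {\<tau>..1} _\<close> unfolding set_integrable_def
          by (subst nn_integral_eq_integral[symmetric]) (auto intro!: nn_integral_cong simp: indicator_def)
        ultimately show ?thesis by simp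
      qed
      have meas[measurable]: "(\<lambda>t. indicator {\<tau>..1} t * ennreal (norm (G n (\<gamma> t)))) \<in> borel_measurable borel"
      proof -
        have "(\<lambda>t. indicator {\<tau>..1} t *\<^sub>R norm (G n (\<gamma> t))) \<in> borel_measurable borel"
          by (rule borel_measurable_continuous_on_indicator[OF _ int]) simp
        then have "(\<lambda>t. ennreal (indicator {\<tau>..1} t *\<^sub>R norm (G n (\<gamma> t)))) \<in> borel_measurable borel" by measurable
        then show ?thesis by (simp add: ennreal_mult ennreal_indicator)
      qed
      have "?S\<^sup>2 = (\<integral>\<^sup>+t. (indicator {\<tau>..1} t * ennreal (sqrt (1 / t ^ d))) *
          (ennreal (sqrt (t ^ d)) * (indicator {\<tau>..1} t * ennreal (norm (G n (\<gamma> t))))) \<partial>lborel)\<^sup>2"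
      proof (rule arg_cong[where f = "\<lambda>x. x\<^sup>2"], rule nn_integral_cong)
        fix t :: real
        show "indicator {\<tau>..1} t * ennreal (norm (G n (\<gamma> t))) = (indicator {\<tau>..1} t * ennreal (sqrt (1 / t ^ d))) *
          (ennreal (sqrt (t ^ d)) * (indicator {\<tau>..1} t * ennreal (norm (G n (\<gamma> t)))))"
        proof (cases "t \<in> {\<tau>..1}")
          case True
          then have "0 < t" using \<tau> by auto
          then have "sqrt (1 / t ^ d) * sqrt (t ^ d) = 1"
            by (simp add: real_sqrt_mult[symmetric])
          then have "ennreal (sqrt (1 / t ^ d)) * ennreal (sqrt (t ^ d)) = 1"
            using \<open>0 < t\<close> by (simp add: ennreal_mult[symmetric])
          then show ?thesis using True by (simp add: mult.assoc[symmetric])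
        qed simp
      qed
      also have "\<dots> \<le> (\<integral>\<^sup>+t. (indicator {\<tau>..1} t * ennreal (sqrt (1 / t ^ d)))\<^sup>2 \<partial>lborel) *
          (\<integral>\<^sup>+t. (ennreal (sqrt (t ^ d)) * (indicator {\<tau>..1} t * ennreal (norm (G n (\<gamma> t)))))\<^sup>2 \<partial>lborel)"
        by (rule Cauchy_Schwarz_nn_integral) measurable
      also have "(\<integral>\<^sup>+t. (indicator {\<tau>..1} t * ennreal (sqrt (1 / t ^ d)))\<^sup>2 \<partial>lborel) = J"
        unfolding J_def using \<tau> by (intro nn_integral_cong) (auto simp: indicator_def ennreal_power)
      also have "(\<integral>\<^sup>+t. (ennreal (sqrt (t ^ d)) * (indicator {\<tau>..1} t * ennreal (norm (G n (\<gamma> t)))))\<^sup>2 \<partial>lborel)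
          = (\<integral>\<^sup>+t. indicator {\<tau>..1} t * (ennreal (t ^ d) * Q n (z + t *\<^sub>R (y - z))) \<partial>lborel)"
        using \<tau> seg[OF y] by (intro nn_integral_cong)
          (auto simp: indicator_def ennreal_power power_mult_distrib Q_def \<gamma>_def)
      finally have S2: "?S\<^sup>2 \<le> J * (\<integral>\<^sup>+t. indicator {\<tau>..1} t * (ennreal (t ^ d) * Q n (z + t *\<^sub>R (y - z))) \<partial>lborel)" .
      have "ennreal ((v n y)\<^sup>2) = (ennreal \<bar>v n y\<bar>)\<^sup>2" by (simp add: ennreal_power)
      also have "\<dots> \<le> (ennreal ((K * norm (y - z)) * integral {\<tau>..1} (\<lambda>t. norm (G n (\<gamma> t)))))\<^sup>2"
        using bound by (intro power_mono ennreal_leI) auto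
      also have "\<dots> = ennreal (K\<^sup>2) * ennreal ((norm (y - z))\<^sup>2) * ?S\<^sup>2"
        unfolding S[symmetric] using K
        by (subst ennreal_mult) (auto simp: power_mult_distrib ennreal_power ennreal_mult intro!: integral_nonneg integrable_continuous_interval int)
      also have "\<dots> \<le> ennreal (K\<^sup>2) * ennreal ((norm (y - z))\<^sup>2) *
         (J * (\<integral>\<^sup>+t. indicator {\<tau>..1} t * (ennreal (t ^ d) * Q n (z + t *\<^sub>R (y - z))) \<partial>lborel))"
        by (intro mult_left_mono S2) simp
      also have "\<dots> = ennreal (K\<^sup>2) * J * (ennreal ((norm (y - z))\<^sup>2) *
         (\<integral>\<^sup>+t. indicator {\<tau>..1} t * (ennreal (t ^ d) * Q n (z + t *\<^sub>R (y - z))) \<partial>lborel))"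
        by (simp add: mult_ac)
      also have "ennreal ((norm (y - z))\<^sup>2) * (\<integral>\<^sup>+t. indicator {\<tau>..1} t * (ennreal (t ^ d) * Q n (z + t *\<^sub>R (y - z))) \<partial>lborel)
          = (\<integral>\<^sup>+t. ennreal ((norm (y - z))\<^sup>2) * (indicator {\<tau>..1} t * (ennreal (t ^ d) * Q n (z + t *\<^sub>R (y - z)))) \<partial>lborel)"
        by (rule nn_integral_cmult[symmetric]) measurable
      also have "\<dots> = H n y"
        unfolding H_def using y \<tau> by (simp, intro nn_integral_cong) (auto simp: indicator_def ennreal_mult mult_ac)
      finally show ?case .
    qed
  qed
  have AEc: "AE y in lborel. y \<in> I \<longrightarrow> (\<lambda>n. v n y) \<longlonglongrightarrow> f (\<Phi> y)"
    unfolding v_def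
    by (rule AE_expansive[OF K _ cont _ bd conv]) (use exp in \<open>auto simp: I_def\<close>)
  have "(\<integral>\<^sup>+y. indicator I y * ennreal ((f (\<Phi> y))\<^sup>2) \<partial>lborel) \<le> (\<integral>\<^sup>+y. liminf (\<lambda>n. ennreal (K\<^sup>2) * J * H n y) \<partial>lborel)"
  proof (rule nn_integral_mono_AE)
    show "AE y in lborel. indicator I y * ennreal ((f (\<Phi> y))\<^sup>2) \<le> liminf (\<lambda>n. ennreal (K\<^sup>2) * J * H n y)"
      using AEc
    proof eventually_elim
      case (elim y)
      show ?case
      proof (cases "y \<in> I")
        case True
        have "(\<lambda>n. ennreal ((v n y)\<^sup>2)) \<longlonglongrightarrow> ennreal ((f (\<Phi> y))\<^sup>2)"
          using elim True by (intro tendsto_intros) auto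
        then have "ennreal ((f (\<Phi> y))\<^sup>2) = liminf (\<lambda>n. ennreal ((v n y)\<^sup>2))"
          by (intro lim_imp_Liminf[symmetric]) auto
        also have "\<dots> \<le> liminf (\<lambda>n. ennreal (K\<^sup>2) * J * H n y)"
          by (rule Liminf_mono[OF pointwise[OF True]])
        finally show ?thesis using True by simp
      qed simp
    qed
  qed
  also have "\<dots> \<le> liminf (\<lambda>n. \<integral>\<^sup>+y. ennreal (K\<^sup>2) * J * H n y \<partial>lborel)"
    by (rule nn_integral_liminf) measurable
  also have "\<dots> \<le> ennreal (K\<^sup>2) * J * (ennreal (2 * R\<^sup>2) * (ennreal ((2 * K * CARD('n)) ^ CARD('n)) * (\<integral>\<^sup>+x. ennreal ((norm (g x))\<^sup>2) \<partial>lborel)))"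
  proof (rule Liminf_le, simp, rule always_eventually, rule allI)
    fix n
    have "(\<integral>\<^sup>+y. H n y \<partial>lborel) \<le> ennreal (2 * R\<^sup>2) * (\<integral>\<^sup>+w. indicator I w * Q n w \<partial>lborel)"
      using cone_integral_le[OF W z \<tau>(1), of "Q n"] unfolding H_def I_def d_def by simp
    also have "(\<integral>\<^sup>+w. indicator I w * Q n w \<partial>lborel) = (\<integral>\<^sup>+w\<in>I. ennreal ((norm (G n (\<Phi> w)))\<^sup>2) \<partial>lborel)"
      by (intro nn_integral_cong) (auto simp: Q_def indicator_def)
    also have "ennreal (2 * R\<^sup>2) * (\<integral>\<^sup>+w\<in>I. ennreal ((norm (G n (\<Phi> w)))\<^sup>2) \<partial>lborel)
      \<le> ennreal (2 * R\<^sup>2) * (ennreal ((2 * K * DIM(real^'n)) ^ DIM(real^'n)) * (\<integral>\<^sup>+x. ennreal ((norm (G n x))\<^sup>2) \<partial>lborel))"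
      by (intro mult_left_mono nn_integral_expansive_le[OF K _ cont _ bd]) (use exp in \<open>auto simp: I_def\<close>)
    also have "\<dots> \<le> ennreal (2 * R\<^sup>2) * (ennreal ((2 * K * CARD('n)) ^ CARD('n)) * (\<integral>\<^sup>+x. ennreal ((norm (g x))\<^sup>2) \<partial>lborel))"
      using mollifier.nn_integral_moll_square_le[OF m g, of n] by (auto intro!: mult_left_mono simp: G_def)
    finally show "(\<integral>\<^sup>+y. ennreal (K\<^sup>2) * J * H n y \<partial>lborel) \<le> ennreal (K\<^sup>2) * J * (ennreal (2 * R\<^sup>2) * (ennreal ((2 * K * CARD('n)) ^ CARD('n)) * (\<integral>\<^sup>+x. ennreal ((norm (g x))\<^sup>2) \<partial>lborel)))"
      by (subst nn_integral_cmult) (auto intro: mult_left_mono)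
  qed
  also have "\<dots> = ennreal ((2 * K * CARD('n)) ^ CARD('n) * (2 * R\<^sup>2) * K\<^sup>2) * J * (\<integral>\<^sup>+x. ennreal ((norm (g x))\<^sup>2) \<partial>lborel)"
    using K by (simp add: ennreal_mult mult_ac)
  finally show ?thesis by (simp add: I_def J_def d_def)
qed

section \<open>Integration by parts and weak gradients on a compact body\<close>

lemma smooth_line_derivative:
  assumes "smooth_fun \<phi>"
  shows "((\<lambda>t. \<phi> (x + t *\<^sub>R axis i 1)) has_real_derivative partial_deriv i \<phi> (x + s *\<^sub>R axis i 1)) (at s)"
proof -
  have "foldr partial_deriv [] \<phi> = \<phi>" by simp
  then have "(\<lambda>t. \<phi> ((x + s *\<^sub>R axis i 1) + t *\<^sub>R axis i 1)) differentiable (at (0::real))"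
    using assms unfolding smooth_fun_def by metis
  then have "((\<lambda>t. \<phi> ((x + s *\<^sub>R axis i 1) + t *\<^sub>R axis i 1)) has_real_derivative partial_deriv i \<phi> (x + s *\<^sub>R axis i 1)) (at (s - s))"
    unfolding partial_deriv_def by (simp add: DERIV_deriv_iff_real_differentiable)
  then have "((\<lambda>t. \<phi> ((x + s *\<^sub>R axis i 1) + (t - s) *\<^sub>R axis i 1)) has_real_derivative partial_deriv i \<phi> (x + s *\<^sub>R axis i 1) * 1) (at s)"
    by (rule DERIV_chain2) (auto intro!: derivative_eq_intros)
  then show ?thesis by (simp add: algebra_simps)
qed

lemma continuous_partial_deriv: "smooth_fun \<phi> \<Longrightarrow> continuous_on UNIV (partial_deriv i \<phi>)"
  unfolding smooth_fun_def by (drule spec[of _ "[i]"]) simp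

lemma continuous_smooth_fun: "smooth_fun \<phi> \<Longrightarrow> continuous_on UNIV \<phi>"
  unfolding smooth_fun_def by (drule spec[of _ "[]"]) simp

lemma partial_deriv_outside_support:
  assumes "x \<notin> closure {x. \<phi> x \<noteq> 0}"
  shows "partial_deriv i \<phi> x = 0"
proof -
  have "continuous_on UNIV (\<lambda>t. x + t *\<^sub>R axis i (1::real))" by (intro continuous_intros)
  then have op: "open ((\<lambda>t. x + t *\<^sub>R axis i 1) -` (- closure {x. \<phi> x \<noteq> 0}))" (is "open ?T")
    by (rule open_vimage[rotated]) (rule open_Compl[OF closed_closure])
  have mem: "0 \<in> ?T" using assms by simp
  have zero: "\<phi> (x + t *\<^sub>R axis i 1) = 0" if "t \<in> ?T" for t
    using that closure_subset[of "{x. \<phi> x \<noteq> 0}"] by auto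
  have "((\<lambda>t. \<phi> (x + t *\<^sub>R axis i 1)) has_real_derivative 0) (at 0)"
    by (rule has_field_derivative_transform_within_open[of "\<lambda>_. 0", OF _ op mem]) (use zero in auto)
  then show ?thesis unfolding partial_deriv_def by (rule DERIV_imp_deriv)
qed

text \<open>The integral of a partial derivative of a compactly supported function vanishes, because the
  integral of the function is invariant under translations.\<close>

lemma integral_partial_derivative_zero:
  fixes u u' :: "real^'n \<Rightarrow> real"
  assumes der: "\<And>x s. ((\<lambda>t. u (x + t *\<^sub>R axis i 1)) has_real_derivative u' (x + s *\<^sub>R axis i 1)) (at s)"
    and cu: "continuous_on UNIV u" and cu': "continuous_on UNIV u'"
    and supp: "\<And>x. r \<le> norm x \<Longrightarrow> u x = 0" "\<And>x. r \<le> norm x \<Longrightarrow> u' x = 0"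
  shows "(\<integral>x. u' x \<partial>lborel) = 0"
proof -
  have [measurable]: "u \<in> borel_measurable borel" "u' \<in> borel_measurable borel"
    using cu cu' by (auto intro: borel_measurable_continuous_onI)
  have "compact (u' ` cball 0 r)" using cu' by (intro compact_continuous_image) (auto intro: continuous_on_subset)
  then obtain B where "\<forall>x\<in>u' ` cball 0 r. norm x \<le> B" using compact_imp_bounded bounded_iff by metis
  then have B: "\<bar>u' x\<bar> \<le> \<bar>B\<bar>" for x
  proof (cases "r \<le> norm x")
    case False
    then have "u' x \<in> u' ` cball 0 r" by simp
    then have "norm (u' x) \<le> B" using \<open>\<forall>x\<in>u' ` cball 0 r. norm x \<le> B\<close> by (rule bspec[rotated])
    then show ?thesis by simp
  qed (simp add: supp(2))
  have iu: "integrable lborel u"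
  proof -
    have "integrable lborel (\<lambda>x. indicator (cball 0 r) x *\<^sub>R u x)"
      by (rule borel_integrable_compact) (use cu continuous_on_subset in auto)
    moreover have "(\<lambda>x. indicator (cball 0 r) x *\<^sub>R u x) = u"
      using supp(1) by (auto simp: fun_eq_iff indicator_def)
    ultimately show ?thesis by simp
  qed
  define t where "t n = inverse (real (Suc n))" for n
  have t: "t \<longlonglongrightarrow> 0" "\<And>n. 0 < t n" "\<And>n. t n \<le> 1"
    unfolding t_def by (rule LIMSEQ_inverse_real_of_nat) (auto simp: inverse_le_1_iff)
  have tn0: "t n \<noteq> 0" for n using t(2)[of n] by simp
  have tr: "integrable lborel (\<lambda>x. u (x + v)) \<and> (\<integral>x. u (x + v) \<partial>lborel) = (\<integral>x. u x \<partial>lborel)" for v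
  proof -
    have "lborel = distr lborel borel (\<lambda>x. x + v)"
      using lborel_distr_plus[of v, symmetric] by (simp add: add.commute[of v] cong: distr_cong)
    then have "integrable (distr lborel borel (\<lambda>x. x + v)) u" "(\<integral>x. u x \<partial>lborel) = (\<integral>x. u x \<partial>distr lborel borel (\<lambda>x. x + v))"
      using iu by auto
    then show ?thesis by (simp add: integrable_distr_eq integral_distr)
  qed
  have "(\<lambda>n. \<integral>x. (u (x + t n *\<^sub>R axis i 1) - u x) / t n \<partial>lborel) \<longlonglongrightarrow> (\<integral>x. u' x \<partial>lborel)"
  proof (rule integral_dominated_convergence[where w = "\<lambda>x. indicator (cball 0 (r + 1)) x *\<^sub>R \<bar>B\<bar>"])
    show "AE x in lborel. (\<lambda>n. (u (x + t n *\<^sub>R axis i 1) - u x) / t n) \<longlonglongrightarrow> u' x"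
    proof (intro AE_I2)
      fix x
      have "((\<lambda>t. (u (x + t *\<^sub>R axis i 1) - u x) / t) \<longlongrightarrow> u' x) (at 0)"
        using der[of x 0] by (simp add: has_field_derivative_iff)
      then show "(\<lambda>n. (u (x + t n *\<^sub>R axis i 1) - u x) / t n) \<longlonglongrightarrow> u' x"
        unfolding tendsto_at_iff_sequentially comp_def by (elim allE[of _ t]) (use t tn0 in simp)
    qed
    show "AE x in lborel. norm ((u (x + t n *\<^sub>R axis i 1) - u x) / t n) \<le> indicator (cball 0 (r + 1)) x *\<^sub>R \<bar>B\<bar>" for n
    proof (intro AE_I2)
      fix x
      show "norm ((u (x + t n *\<^sub>R axis i 1) - u x) / t n) \<le> indicator (cball 0 (r + 1)) x *\<^sub>R \<bar>B\<bar>"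
      proof (cases "x \<in> cball 0 (r + 1)")
        case True
        have "norm (u (x + t n *\<^sub>R axis i 1) - u (x + 0 *\<^sub>R axis i 1)) \<le> \<bar>B\<bar> * norm (t n - 0)"
          by (rule field_differentiable_bound[of UNIV "\<lambda>t. u (x + t *\<^sub>R axis i 1)" "\<lambda>t. u' (x + t *\<^sub>R axis i 1)"])
             (use der B in auto)
        then show ?thesis using True t(2)[of n] by (simp add: abs_divide divide_le_eq)
      next
        case False
        have "norm x \<le> norm (x + t n *\<^sub>R axis i 1) + norm (t n *\<^sub>R axis i (1::real) :: real^'n)"
          using norm_triangle_ineq4[of "x + t n *\<^sub>R axis i 1" "t n *\<^sub>R axis i 1"] by simp
        also have "norm (t n *\<^sub>R axis i (1::real) :: real^'n) \<le> 1" using t(2,3)[of n] by simp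
        finally have "u (x + t n *\<^sub>R axis i 1) = 0" "u x = 0"
          using False by (auto intro!: supp)
        then show ?thesis by simp
      qed
    qed
    show "integrable lborel (\<lambda>x. indicator (cball 0 (r + 1)) x *\<^sub>R \<bar>B\<bar> :: real)"
      by (rule borel_integrable_compact) auto
  qed measurable
  moreover have "(\<integral>x. (u (x + t n *\<^sub>R axis i 1) - u x) / t n \<partial>lborel) = 0" for n
    using tr[of "t n *\<^sub>R axis i 1"] iu by simp
  ultimately have "(\<lambda>n::nat. 0) \<longlonglongrightarrow> (\<integral>x. u' x \<partial>lborel)" by (simp only:)
  then show ?thesis by (simp add: LIMSEQ_const_iff)
qed

text \<open>Fundamental lemma of the calculus of variations: the mollifications of \<open>h\<close> are integrals of \<open>h\<close>
  against test functions, so they vanish at each point of \<open>\<Omega>\<close> for small radii, and they converge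
  to \<open>h\<close> almost everywhere.\<close>

lemma AE_zero_if_test_integrals_zero:
  fixes h :: "real^'n \<Rightarrow> real"
  assumes h: "integrable lborel h" and \<Omega>: "open \<Omega>"
    and zero: "\<And>\<phi>. test_function \<Omega> \<phi> \<Longrightarrow> (\<integral>x. h x * \<phi> x \<partial>lborel) = 0"
  shows "AE x in lborel. x \<in> \<Omega> \<longrightarrow> h x = 0"
proof -
  obtain \<delta> \<rho> \<rho>' where m: "\<And>n::nat. mollifier (\<delta> n) (\<rho> n) (\<rho>' n)" and \<delta>: "\<delta> \<longlonglongrightarrow> 0"
    and conv: "AE x in lborel. (\<lambda>n. mollifier.moll (\<rho> n) h x) \<longlonglongrightarrow> h x"
    using mollifiers_converge_AE[OF h] by blast
  from conv show ?thesis
  proof eventually_elim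
    case (elim x)
    show ?case
    proof
      assume "x \<in> \<Omega>"
      then obtain e where e: "0 < e" "cball x e \<subseteq> \<Omega>" using \<Omega> open_contains_cball by blast
      have "\<forall>\<^sub>F n in sequentially. \<delta> n < e" using \<delta> e(1) by (rule order_tendstoD)
      then have "\<forall>\<^sub>F n in sequentially. mollifier.moll (\<rho> n) h x = 0"
      proof eventually_elim
        case (elim n)
        have "cball x (\<delta> n) \<subseteq> \<Omega>" using e(2) elim subset_cball[of "\<delta> n" e x] by auto
        then have "(\<integral>y. h y * \<rho> n (x - y) \<partial>lborel) = 0"
          by (intro zero mollifier.test_function[OF m])
        then show ?case by (simp add: mollifier.moll_def[OF m] mult.commute)
      qed
      then have "(\<lambda>n. mollifier.moll (\<rho> n) h x) \<longlonglongrightarrow> 0" by (rule tendsto_eventually)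
      then show "h x = 0" using elim LIMSEQ_unique by blast
    qed
  qed
qed

text \<open>Compactness and an interior point make the normalised measure of \<open>M\<close> a probability measure; the
  analysis of the Dirichlet form below is carried out for such sets.\<close>

locale compact_body =
  fixes M :: "(real^'n) set"
  assumes compact_M: "compact M" and interior_M: "interior M \<noteq> {}"
begin

definition vol :: real where "vol = measure lebesgue M"

lemma M_sets [measurable]: "M \<in> sets borel" "M \<in> sets lebesgue"
proof -
  show "M \<in> sets borel" using compact_M by (rule borel_compact)
  then show "M \<in> sets lebesgue" by auto
qed

lemma emeasure_M: "emeasure lebesgue M = ennreal vol" "0 < vol"
proof -
  have "M \<in> lmeasurable" using compact_M by (rule lmeasurable_compact)
  then show "emeasure lebesgue M = ennreal vol" unfolding vol_def by (intro emeasure_eq_measure2)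
  have "\<not> negligible (interior M)" using interior_M open_not_negligible by blast
  then have "\<not> negligible M" using interior_subset negligible_subset by blast
  then have "measure lebesgue M \<noteq> 0"
    using \<open>M \<in> lmeasurable\<close> by (simp add: negligible_iff_measure)
  then show "0 < vol" unfolding vol_def by (simp add: zero_less_measure_iff)
qed

lemma mu_eq_density: "mu M = density (lebesgue_on M) (\<lambda>_. ennreal (1 / vol))"
proof -
  have "emeasure (lebesgue_on M) M = ennreal vol"
    using emeasure_M by (subst emeasure_restrict_space) auto
  then show ?thesis
    unfolding mu_def uniform_measure_def
  proof (intro density_cong)
    show "AE x in lebesgue_on M. indicator M x / emeasure (lebesgue_on M) M = ennreal (1 / vol)"
      using emeasure_M(2) \<open>emeasure (lebesgue_on M) M = ennreal vol\<close>
      by (intro AE_I2) (simp add: space_restrict_space divide_ennreal[symmetric])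
    have "M \<in> sets (lebesgue_on M)" by (simp add: sets_restrict_space_iff)
    then show "(\<lambda>x. indicator M x / emeasure (lebesgue_on M) M) \<in> borel_measurable (lebesgue_on M)"
      unfolding divide_ennreal_def
      by (intro borel_measurable_times_ennreal borel_measurable_indicator borel_measurable_const)
  qed simp
qed

lemma space_mu [simp]: "space (mu M) = M"
  by (simp add: mu_def)

lemma sets_mu: "sets (mu M) = sets (lebesgue_on M)"
  by (simp add: mu_def)

lemma measurable_mu_iff: "f \<in> borel_measurable (mu M) \<longleftrightarrow> f \<in> borel_measurable (lebesgue_on M)"
  by (rule arg_cong[where f = "\<lambda>A. f \<in> A"], rule measurable_cong_sets) (auto simp: sets_mu)

lemma measurable_mu_iff_extend:
  fixes f :: "real^'n \<Rightarrow> real"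
  shows "f \<in> borel_measurable (mu M) \<longleftrightarrow> (\<lambda>x. indicator M x *\<^sub>R f x) \<in> borel_measurable lebesgue"
  unfolding measurable_mu_iff by (rule borel_measurable_restrict_space_iff) simp

lemma integrable_mu_iff:
  fixes f :: "real^'n \<Rightarrow> real"
  shows "integrable (mu M) f \<longleftrightarrow> integrable lebesgue (\<lambda>x. indicator M x *\<^sub>R f x)"
proof (cases "f \<in> borel_measurable (lebesgue_on M)")
  case True
  then have "integrable (mu M) f \<longleftrightarrow> integrable (lebesgue_on M) (\<lambda>x. (1 / vol) *\<^sub>R f x)"
    using emeasure_M(2) unfolding mu_eq_density by (intro integrable_density) auto
  also have "\<dots> \<longleftrightarrow> integrable (lebesgue_on M) f"
  proof
    assume "integrable (lebesgue_on M) (\<lambda>x. (1 / vol) *\<^sub>R f x)"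
    then have "integrable (lebesgue_on M) (\<lambda>x. vol *\<^sub>R ((1 / vol) *\<^sub>R f x))"
      by (rule integrable_scaleR_right)
    then show "integrable (lebesgue_on M) f" using emeasure_M(2) by simp
  qed simp
  also have "\<dots> \<longleftrightarrow> integrable lebesgue (\<lambda>x. indicator M x *\<^sub>R f x)"
    by (rule integrable_restrict_space) simp
  finally show ?thesis .
next
  case False
  then show ?thesis
    using measurable_mu_iff measurable_mu_iff_extend borel_measurable_integrable by metis
qed

lemma integral_mu:
  fixes f :: "real^'n \<Rightarrow> real"
  shows "(\<integral>x. f x \<partial>mu M) = (\<integral>x. indicator M x *\<^sub>R f x \<partial>lebesgue) / vol"
proof (cases "f \<in> borel_measurable (lebesgue_on M)")
  case True
  then have "(\<integral>x. f x \<partial>mu M) = (\<integral>x. (1 / vol) *\<^sub>R f x \<partial>lebesgue_on M)"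
    using emeasure_M(2) unfolding mu_eq_density by (intro integral_density) auto
  also have "\<dots> = (\<integral>x. f x \<partial>lebesgue_on M) / vol" by simp
  also have "(\<integral>x. f x \<partial>lebesgue_on M) = (\<integral>x. indicator M x *\<^sub>R f x \<partial>lebesgue)"
    by (rule integral_restrict_space) simp
  finally show ?thesis .
next
  case False
  then have "\<not> integrable (mu M) f" using measurable_mu_iff borel_measurable_integrable by metis
  then show ?thesis by (simp add: not_integrable_integral_eq integrable_mu_iff)
qed

lemma nn_integral_mu:
  assumes "f \<in> borel_measurable (lebesgue_on M)"
  shows "(\<integral>\<^sup>+x. f x \<partial>mu M) = ennreal (1 / vol) * (\<integral>\<^sup>+x. f x * indicator M x \<partial>lebesgue)"
  using assms unfolding mu_eq_density
  by (simp add: nn_integral_density nn_integral_cmult nn_integral_restrict_space)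

lemma AE_mu_iff: "(AE x in mu M. P x) \<longleftrightarrow> (AE x in lebesgue. x \<in> M \<longrightarrow> P x)"
  using emeasure_M(2) unfolding mu_eq_density
  by (simp add: AE_density AE_restrict_space_iff)

lemma prob_mu: "prob_space (mu M)"
  unfolding mu_def
proof (rule prob_space_uniform_measure)
  show "emeasure (lebesgue_on M) M \<noteq> 0" "emeasure (lebesgue_on M) M \<noteq> \<infinity>"
    using emeasure_M by (simp_all add: emeasure_restrict_space)
qed

lemma L2_integrable: "f \<in> L2 M \<Longrightarrow> integrable (mu M) f"
proof -
  assume f: "f \<in> L2 M"
  interpret prob_space "mu M" by (rule prob_mu)
  show "integrable (mu M) f"
  proof (rule Bochner_Integration.integrable_bound)
    show "integrable (mu M) (\<lambda>x. 1 + (f x)\<^sup>2)" using f by (simp add: L2_def)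
    have "\<bar>t\<bar> \<le> 1 + t\<^sup>2" for t :: real
    proof (cases "\<bar>t\<bar> \<le> 1")
      case False
      then have "\<bar>t\<bar> * 1 \<le> \<bar>t\<bar> * \<bar>t\<bar>" by (intro mult_left_mono) auto
      then show ?thesis by (simp add: power2_eq_square)
    qed (simp add: add_increasing2)
    then show "AE x in mu M. norm (f x) \<le> norm (1 + (f x)\<^sup>2)" by (intro AE_I2) (simp add: abs_of_nonneg)
  qed (use f in \<open>simp add: L2_def\<close>)
qed

lemma L2_mult_integrable:
  assumes "f \<in> L2 M" "g \<in> L2 M"
  shows "integrable (mu M) (\<lambda>x. f x * g x)"
proof (rule Bochner_Integration.integrable_bound)
  show "integrable (mu M) (\<lambda>x. (f x)\<^sup>2 + (g x)\<^sup>2)" using assms by (simp add: L2_def)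
  have "\<bar>s * t\<bar> \<le> s\<^sup>2 + t\<^sup>2" for s t :: real
    using sum_squares_bound[of "\<bar>s\<bar>" "\<bar>t\<bar>"] abs_ge_zero[of "s * t"] unfolding abs_mult power2_abs by linarith
  then show "AE x in mu M. norm (f x * g x) \<le> norm ((f x)\<^sup>2 + (g x)\<^sup>2)" by (intro AE_I2) (simp add: abs_of_nonneg)
  show "(\<lambda>x. f x * g x) \<in> borel_measurable (mu M)"
    using assms by (intro borel_measurable_times) (auto simp: L2_def)
qed

lemma L2_borel_version:
  assumes "f \<in> L2 M"
  obtains f' where "integrable lborel f'" "AE x in lborel. f' x = indicator M x * f x"
    "AE x in lebesgue. f' x = indicator M x * f x"
proof -
  have int: "integrable lebesgue (\<lambda>x. indicator M x * f x)"
    using L2_integrable[OF assms] unfolding integrable_mu_iff by simp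
  then obtain f' where f': "f' \<in> borel_measurable lborel" "AE x in lborel. indicator M x * f x = f' x"
    using completion_ex_borel_measurable_real[of "\<lambda>x. indicator M x * f x" lborel] by auto
  have AE: "AE x in lborel. f' x = indicator M x * f x" using f'(2) by eventually_elim simp
  then have AE': "AE x in lebesgue. f' x = indicator M x * f x" by (rule AE_completion)
  have "f' \<in> borel_measurable lebesgue" using f'(1) by (intro measurable_completion)
  then have "integrable lebesgue f'"
    using int AE' by (subst integrable_cong_AE[of _ _ "\<lambda>x. indicator M x * f x"]) auto
  then have "integrable lborel f'" using f'(1) by (simp add: integrable_completion)
  then show ?thesis using that AE AE' by blast
qed

text \<open>Functions on \<open>M\<close> are extended by zero and replaced by Borel versions, so that they can be mollified and
  composed with charts. The identity tested against \<open>\<phi>\<close> survives because \<open>\<phi>\<close> and its derivatives vanish off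
  the interior.\<close>

lemma weak_gradient_borel_version:
  assumes f: "f \<in> L2 M" and wg: "is_weak_gradient M f g"
  obtains f' g' where "weak_gradient_on (interior M) f' g'"
    "AE x in lborel. f' x = indicator M x * f x" "AE x in lborel. g' x = g x"
proof -
  obtain f' where f': "integrable lborel f'" "AE x in lborel. f' x = indicator M x * f x" "AE x in lebesgue. f' x = indicator M x * f x"
    using L2_borel_version[OF f] by blast
  have "\<forall>i. \<exists>g'. integrable lborel g' \<and> (AE x in lborel. g' x = indicator M x * g x $ i) \<and> (AE x in lebesgue. g' x = indicator M x * g x $ i)"
  proof
    fix i
    have "(\<lambda>x. g x $ i) \<in> L2 M" using wg by (simp add: is_weak_gradient_def)
    from L2_borel_version[OF this] show "\<exists>g'. integrable lborel g' \<and> (AE x in lborel. g' x = indicator M x * g x $ i) \<and> (AE x in lebesgue. g' x = indicator M x * g x $ i)"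
      by blast
  qed
  from choice[OF this] obtain gi where gi0: "\<forall>i. integrable lborel (gi i) \<and>
      (AE x in lborel. gi i x = indicator M x * g x $ i) \<and> (AE x in lebesgue. gi i x = indicator M x * g x $ i)" ..
  have gi: "integrable lborel (gi i)" "AE x in lborel. gi i x = indicator M x * g x $ i"
    "AE x in lebesgue. gi i x = indicator M x * g x $ i" for i
    using gi0 by simp_all
  have ind: "indicator M x * g x $ i = g x $ i" for x i
    using wg interior_subset[of M] unfolding is_weak_gradient_def by (cases "x \<in> interior M") (auto simp: indicator_def)
  define g' where "g' x = (\<Sum>i\<in>UNIV. gi i x *\<^sub>R axis i (1::real))" for x
  have g'i: "g' x $ i = gi i x" for x i
    by (simp add: g'_def axis_def if_distrib[of "\<lambda>t. _ * t"] cong: if_cong)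
  have ig': "integrable lborel g'" unfolding g'_def by (intro Bochner_Integration.integrable_sum integrable_scaleR_left gi)
  have AEg: "AE x in lborel. g' x = g x"
  proof -
    have "AE x in lborel. \<forall>i\<in>UNIV. gi i x = indicator M x * g x $ i"
      by (rule AE_finite_allI) (use gi in auto)
    then show ?thesis by eventually_elim (simp add: vec_eq_iff g'i ind)
  qed
  have "weak_gradient_on (interior M) f' g'"
    unfolding weak_gradient_on_def
  proof (intro conjI allI impI)
    fix \<phi> i assume \<phi>: "test_function (interior M) \<phi>"
    then have sm: "smooth_fun \<phi>" and supp: "closure {x. \<phi> x \<noteq> 0} \<subseteq> interior M"
      by (auto simp: test_function_def)
    have [measurable]: "\<phi> \<in> borel_measurable borel" "partial_deriv i \<phi> \<in> borel_measurable borel"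
      using continuous_smooth_fun[OF sm] continuous_partial_deriv[OF sm] by (auto intro: borel_measurable_continuous_onI)
    have [measurable]: "\<phi> \<in> borel_measurable lebesgue" "partial_deriv i \<phi> \<in> borel_measurable lebesgue"
      by (auto intro!: measurable_completion)
    have [measurable]: "f' \<in> borel_measurable borel" "gi i \<in> borel_measurable borel" using f' gi by auto
    have [measurable]: "f' \<in> borel_measurable lebesgue" "gi i \<in> borel_measurable lebesgue"
      by (auto intro!: measurable_completion)
    have [measurable]: "(\<lambda>x. indicator M x * f x) \<in> borel_measurable lebesgue" "(\<lambda>x. indicator M x * g x $ i) \<in> borel_measurable lebesgue"
      using f wg measurable_mu_iff_extend[of f] measurable_mu_iff_extend[of "\<lambda>x. g x $ i"] by (auto simp: L2_def is_weak_gradient_def)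
    have p0: "partial_deriv i \<phi> x = 0" "\<phi> x = 0" if "x \<notin> interior M" for x
      using that supp partial_deriv_outside_support[of x \<phi> i] closure_subset[of "{x. \<phi> x \<noteq> 0}"] by auto
    have "(\<integral>x. f' x * partial_deriv i \<phi> x \<partial>lborel) = (\<integral>x. f' x * partial_deriv i \<phi> x \<partial>lebesgue)"
      by (subst integral_completion) auto
    also have "\<dots> = (\<integral>x. (indicator M x * f x) * partial_deriv i \<phi> x \<partial>lebesgue)"
      using f'(3) by (intro integral_cong_AE) (auto elim!: eventually_mono)
    also have "\<dots> = (\<integral>x\<in>interior M. f x * partial_deriv i \<phi> x \<partial>lebesgue)"
      unfolding set_lebesgue_integral_def using p0(1) interior_subset[of M]
      by (intro Bochner_Integration.integral_cong) (auto simp: indicator_def)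
    also have "\<dots> = - (\<integral>x\<in>interior M. g x $ i * \<phi> x \<partial>lebesgue)"
      using wg \<phi> unfolding is_weak_gradient_def by blast
    also have "(\<integral>x\<in>interior M. g x $ i * \<phi> x \<partial>lebesgue) = (\<integral>x. (indicator M x * g x $ i) * \<phi> x \<partial>lebesgue)"
      unfolding set_lebesgue_integral_def using p0(2) interior_subset[of M]
      by (intro Bochner_Integration.integral_cong) (auto simp: indicator_def)
    also have "\<dots> = (\<integral>x. gi i x * \<phi> x \<partial>lebesgue)"
      using gi(3)[of i] by (intro integral_cong_AE) (auto elim!: eventually_mono)
    also have "\<dots> = (\<integral>x. g' x $ i * \<phi> x \<partial>lborel)"
      by (subst integral_completion) (auto simp: g'i)
    finally show "(\<integral>x. f' x * partial_deriv i \<phi> x \<partial>lborel) = - (\<integral>x. g' x $ i * \<phi> x \<partial>lborel)" .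
  qed (use f' ig' in auto)
  then show ?thesis using that f' AEg by blast
qed

lemma weak_gradient_unique:
  assumes f: "f \<in> L2 M" and g: "is_weak_gradient M f g1" "is_weak_gradient M f g2"
  shows "AE x in lebesgue. g1 x = g2 x"
proof -
  obtain f1 h1 where 1: "weak_gradient_on (interior M) f1 h1"
    "AE x in lborel. f1 x = indicator M x * f x" "AE x in lborel. h1 x = g1 x"
    using weak_gradient_borel_version[OF f g(1)] by blast
  obtain f2 h2 where 2: "weak_gradient_on (interior M) f2 h2"
    "AE x in lborel. f2 x = indicator M x * f x" "AE x in lborel. h2 x = g2 x"
    using weak_gradient_borel_version[OF f g(2)] by blast
  have int: "integrable lborel f1" "integrable lborel f2" "integrable lborel h1" "integrable lborel h2"
    using 1 2 by (auto simp: weak_gradient_on_def)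
  have inti: "integrable lborel (\<lambda>x. h1 x $ i)" "integrable lborel (\<lambda>x. h2 x $ i)" for i
    using int(3,4) integrable_bounded_linear[OF bounded_linear_vec_nth] by blast+
  have [measurable]: "f1 \<in> borel_measurable borel" "f2 \<in> borel_measurable borel" using int by auto
  have "AE x in lborel. x \<in> interior M \<longrightarrow> h1 x $ i - h2 x $ i = 0" for i
  proof (rule AE_zero_if_test_integrals_zero)
    show "integrable lborel (\<lambda>x. h1 x $ i - h2 x $ i)" using inti by simp
    fix \<phi> assume \<phi>: "test_function (interior M) \<phi>"
    then have sm: "smooth_fun \<phi>" and cl: "compact (closure {x. \<phi> x \<noteq> 0})" by (auto simp: test_function_def)
    have [measurable]: "\<phi> \<in> borel_measurable borel" "partial_deriv i \<phi> \<in> borel_measurable borel"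
      using continuous_smooth_fun[OF sm] continuous_partial_deriv[OF sm] by (auto intro: borel_measurable_continuous_onI)
    have "compact (\<phi> ` closure {x. \<phi> x \<noteq> 0})"
      using cl continuous_smooth_fun[OF sm] by (intro compact_continuous_image) (auto intro: continuous_on_subset)
    then obtain B where "\<forall>x\<in>\<phi> ` closure {x. \<phi> x \<noteq> 0}. norm x \<le> B" using compact_imp_bounded bounded_iff by metis
    then have B: "\<bar>\<phi> x\<bar> \<le> \<bar>B\<bar>" for x
      using closure_subset[of "{x. \<phi> x \<noteq> 0}"] by (cases "\<phi> x = 0") force+
    have ip: "integrable lborel (\<lambda>x. h x * \<phi> x)" if "integrable lborel h" for h :: "real^'n \<Rightarrow> real"
    proof (rule Bochner_Integration.integrable_bound[of _ "\<lambda>x. \<bar>B\<bar> * h x"])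
      show "integrable lborel (\<lambda>x. \<bar>B\<bar> * h x)" using that by simp
      show "AE x in lborel. norm (h x * \<phi> x) \<le> norm (\<bar>B\<bar> * h x)"
        using B by (intro AE_I2) (simp add: abs_mult mult.commute mult_right_mono)
    qed (use that in measurable)
    have "(\<integral>x. f1 x * partial_deriv i \<phi> x \<partial>lborel) = (\<integral>x. f2 x * partial_deriv i \<phi> x \<partial>lborel)"
    proof (rule integral_cong_AE)
      show "AE x in lborel. f1 x * partial_deriv i \<phi> x = f2 x * partial_deriv i \<phi> x"
        using 1(2) 2(2) by eventually_elim simp
    qed measurable
    moreover have "(\<integral>x. f1 x * partial_deriv i \<phi> x \<partial>lborel) = - (\<integral>x. h1 x $ i * \<phi> x \<partial>lborel)"
      using 1(1) \<phi> by (simp add: weak_gradient_on_def)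
    moreover have "(\<integral>x. f2 x * partial_deriv i \<phi> x \<partial>lborel) = - (\<integral>x. h2 x $ i * \<phi> x \<partial>lborel)"
      using 2(1) \<phi> by (simp add: weak_gradient_on_def)
    ultimately have "(\<integral>x. h1 x $ i * \<phi> x \<partial>lborel) = (\<integral>x. h2 x $ i * \<phi> x \<partial>lborel)"
      by linarith
    then show "(\<integral>x. (h1 x $ i - h2 x $ i) * \<phi> x \<partial>lborel) = 0"
      using ip[OF inti(1)] ip[OF inti(2)] by (simp add: left_diff_distrib)
  qed simp
  then have "AE x in lborel. \<forall>i\<in>UNIV. x \<in> interior M \<longrightarrow> h1 x $ i - h2 x $ i = 0"
    by (intro AE_finite_allI) auto
  then have "AE x in lborel. g1 x = g2 x"
    using 1(3) 2(3)
  proof eventually_elim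
    case (elim x)
    then show ?case using g by (cases "x \<in> interior M") (auto simp: is_weak_gradient_def vec_eq_iff)
  qed
  then show ?thesis by (rule AE_completion)
qed

end

context compact_body
begin

lemma continuous_L2:
  assumes "continuous_on UNIV f"
  shows "f \<in> L2 M"
proof -
  have [measurable]: "f \<in> borel_measurable borel" using assms by (rule borel_measurable_continuous_onI)
  have "integrable lborel (\<lambda>x. indicator M x *\<^sub>R (f x)\<^sup>2)"
    by (rule borel_integrable_compact[OF compact_M]) (intro continuous_intros continuous_on_subset[OF assms] subset_UNIV)
  then have "integrable lebesgue (\<lambda>x. indicator M x *\<^sub>R (f x)\<^sup>2)"
    by (simp add: integrable_completion)
  moreover have "(\<lambda>x. indicator M x *\<^sub>R f x) \<in> borel_measurable lebesgue"
    by (rule measurable_completion) simp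
  ultimately show ?thesis by (simp add: L2_def integrable_mu_iff measurable_mu_iff_extend)
qed

lemma L2_restrict_interior:
  assumes "f \<in> L2 M"
  shows "(\<lambda>x. if x \<in> interior M then f x else 0) \<in> L2 M"
proof -
  have [measurable]: "interior M \<in> sets (mu M)"
    using interior_subset[of M] by (auto simp: sets_mu sets_restrict_space_iff)
  have [measurable]: "f \<in> borel_measurable (mu M)" using assms by (simp add: L2_def)
  have m: "(\<lambda>x. if x \<in> interior M then f x else 0) \<in> borel_measurable (mu M)" by measurable
  have "integrable (mu M) (\<lambda>x. (if x \<in> interior M then f x else 0)\<^sup>2)"
    by (rule Bochner_Integration.integrable_bound[of _ "\<lambda>x. (f x)\<^sup>2"])
       (use assms m in \<open>auto simp: L2_def\<close>)
  with m show ?thesis by (simp add: L2_def)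
qed

lemma is_weak_gradient_C1:
  assumes der: "\<And>x. (f has_derivative (\<lambda>v. Df x \<bullet> v)) (at x)" and cont: "continuous_on UNIV Df"
  shows "is_weak_gradient M f (\<lambda>x. if x \<in> interior M then Df x else 0)"
  unfolding is_weak_gradient_def
proof (intro conjI allI impI)
  have cf: "continuous_on UNIV f"
    by (intro continuous_at_imp_continuous_on ballI has_derivative_continuous[OF der])
  have ci: "continuous_on UNIV (\<lambda>x. Df x $ i)" for i by (intro continuous_intros cont)
  show "(\<lambda>x. (if x \<in> interior M then Df x else 0) $ i) \<in> L2 M" for i
    using L2_restrict_interior[OF continuous_L2[OF ci]] by (simp add: if_distrib[of "\<lambda>v. v $ i"] cong: if_cong)
  fix \<phi> i assume \<phi>: "test_function (interior M) \<phi>"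
  define S where "S = closure {x. \<phi> x \<noteq> 0}"
  have sm: "smooth_fun \<phi>" and cl: "compact S" and supp: "S \<subseteq> interior M"
    using \<phi> by (auto simp: test_function_def S_def)
  have c\<phi>: "continuous_on UNIV \<phi>" and cp: "continuous_on UNIV (partial_deriv i \<phi>)"
    using continuous_smooth_fun[OF sm] continuous_partial_deriv[OF sm] by auto
  have p0: "partial_deriv i \<phi> x = 0" "\<phi> x = 0" if "x \<notin> S" for x
    using that partial_deriv_outside_support[of x \<phi> i] closure_subset[of "{x. \<phi> x \<noteq> 0}"] unfolding S_def by auto
  have int: "integrable lborel h" if "continuous_on UNIV h" "\<And>x. x \<notin> S \<Longrightarrow> h x = 0" for h :: "_ \<Rightarrow> real"
  proof -
    have "integrable lborel (\<lambda>x. indicator (S) x *\<^sub>R h x)"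
      by (rule borel_integrable_compact[OF cl continuous_on_subset[OF that(1) subset_UNIV]])
    moreover have "(\<lambda>x. indicator (S) x *\<^sub>R h x) = h"
      using that(2) by (auto simp: fun_eq_iff indicator_def)
    ultimately show ?thesis by simp
  qed
  obtain r where r: "\<And>x. x \<in> S \<Longrightarrow> norm x < r"
    using compact_imp_bounded[OF cl] bounded_pos_less by blast
  have "(\<integral>x. (Df x $ i * \<phi> x + f x * partial_deriv i \<phi> x) \<partial>lborel) = 0"
  proof (rule integral_partial_derivative_zero[where u = "\<lambda>x. f x * \<phi> x" and i = i and r = r])
    fix x s
    have "((\<lambda>t. x + t *\<^sub>R axis i (1::real)) has_derivative (\<lambda>h. h *\<^sub>R axis i 1)) (at s)"
      by (auto intro!: derivative_eq_intros)
    from has_derivative_compose[OF this der]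
    have "((\<lambda>t. f (x + t *\<^sub>R axis i 1)) has_real_derivative Df (x + s *\<^sub>R axis i 1) $ i) (at s)"
      by (simp add: has_field_derivative_def inner_axis mult_commute_abs)
    from DERIV_mult[OF this smooth_line_derivative[OF sm]]
    show "((\<lambda>t. f (x + t *\<^sub>R axis i 1) * \<phi> (x + t *\<^sub>R axis i 1)) has_real_derivative
        Df (x + s *\<^sub>R axis i 1) $ i * \<phi> (x + s *\<^sub>R axis i 1) + f (x + s *\<^sub>R axis i 1) * partial_deriv i \<phi> (x + s *\<^sub>R axis i 1)) (at s)"
      by (simp add: mult.commute add.commute)
  next
    show "continuous_on UNIV (\<lambda>x. f x * \<phi> x)" by (intro continuous_intros cf c\<phi>)
    show "continuous_on UNIV (\<lambda>x. Df x $ i * \<phi> x + f x * partial_deriv i \<phi> x)"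
      by (intro continuous_intros cont cf c\<phi> cp)
    fix x :: "real^'n" assume "r \<le> norm x"
    then have "x \<notin> S" using r[of x] by auto
    then show "f x * \<phi> x = 0" "Df x $ i * \<phi> x + f x * partial_deriv i \<phi> x = 0" using p0[of x] by auto
  qed
  moreover have i1: "integrable lborel (\<lambda>x. Df x $ i * \<phi> x)"
    by (rule int[OF continuous_on_mult[OF ci c\<phi>]]) (simp add: p0)
  moreover have i2: "integrable lborel (\<lambda>x. f x * partial_deriv i \<phi> x)"
    by (rule int[OF continuous_on_mult[OF cf cp]]) (simp add: p0)
  ultimately have "(\<integral>x. f x * partial_deriv i \<phi> x \<partial>lborel) = - (\<integral>x. Df x $ i * \<phi> x \<partial>lborel)" by simp
  moreover have "(\<integral>x\<in>interior M. f x * partial_deriv i \<phi> x \<partial>lebesgue) = (\<integral>x. f x * partial_deriv i \<phi> x \<partial>lborel)"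
  proof -
    have "(\<integral>x\<in>interior M. f x * partial_deriv i \<phi> x \<partial>lebesgue) = (\<integral>x. f x * partial_deriv i \<phi> x \<partial>lebesgue)"
      unfolding set_lebesgue_integral_def using p0 supp
      by (intro Bochner_Integration.integral_cong) (auto simp: indicator_def subset_iff)
    also have "\<dots> = (\<integral>x. f x * partial_deriv i \<phi> x \<partial>lborel)" by (rule integral_completion) (use i2 in auto)
    finally show ?thesis .
  qed
  moreover have "(\<integral>x\<in>interior M. (if x \<in> interior M then Df x else 0) $ i * \<phi> x \<partial>lebesgue) = (\<integral>x. Df x $ i * \<phi> x \<partial>lborel)"
  proof -
    have "(\<integral>x\<in>interior M. (if x \<in> interior M then Df x else 0) $ i * \<phi> x \<partial>lebesgue) = (\<integral>x. Df x $ i * \<phi> x \<partial>lebesgue)"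
      unfolding set_lebesgue_integral_def using p0 supp
      by (intro Bochner_Integration.integral_cong) (auto simp: indicator_def subset_iff)
    also have "\<dots> = (\<integral>x. Df x $ i * \<phi> x \<partial>lborel)" by (rule integral_completion) (use i1 in auto)
    finally show ?thesis .
  qed
  ultimately show "(\<integral>x\<in>interior M. f x * partial_deriv i \<phi> x \<partial>lebesgue) =
      - (\<integral>x\<in>interior M. (if x \<in> interior M then Df x else 0) $ i * \<phi> x \<partial>lebesgue)" by simp
qed simp

lemma weak_gradient_spec:
  assumes "f \<in> H1 M"
  shows "is_weak_gradient M f (weak_gradient M f)"
proof -
  obtain g where "is_weak_gradient M f g" using assms by (auto simp: H1_def)
  then show ?thesis unfolding weak_gradient_def by (rule someI[of "is_weak_gradient M f"])
qed

lemma H1_L2: "f \<in> H1 M \<Longrightarrow> f \<in> L2 M"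
  by (simp add: H1_def)

lemma weak_gradient_AE_eq:
  assumes "f \<in> L2 M" "is_weak_gradient M f g"
  shows "f \<in> H1 M" "AE x in mu M. weak_gradient M f x = g x"
proof -
  show f: "f \<in> H1 M" using assms by (auto simp: H1_def)
  have "AE x in lebesgue. weak_gradient M f x = g x"
    by (rule weak_gradient_unique[OF assms(1) weak_gradient_spec[OF f] assms(2)])
  then show "AE x in mu M. weak_gradient M f x = g x"
    unfolding AE_mu_iff by eventually_elim simp
qed

lemma weak_gradient_component_L2: "f \<in> H1 M \<Longrightarrow> (\<lambda>x. weak_gradient M f x $ i) \<in> L2 M"
  using weak_gradient_spec by (auto simp: is_weak_gradient_def)

lemma weak_gradient_inner_integrable:
  assumes "f \<in> H1 M" "g \<in> H1 M"
  shows "integrable (mu M) (\<lambda>x. weak_gradient M f x \<bullet> weak_gradient M g x)"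
  unfolding inner_vec_def
  using L2_mult_integrable[OF weak_gradient_component_L2[OF assms(1)] weak_gradient_component_L2[OF assms(2)]]
  by auto

lemma dirichlet_form_nonneg: "0 \<le> dirichlet_form M f f"
  unfolding dirichlet_form_def by (auto intro!: mult_nonneg_nonneg integral_nonneg_AE)

lemma dirichlet_form_eq:
  assumes "f \<in> L2 M" "is_weak_gradient M f g"
  shows "dirichlet_form M f f = 1 / 2 * (\<integral>x. g x \<bullet> g x \<partial>mu M)"
proof -
  have f: "f \<in> H1 M" and AE: "AE x in mu M. weak_gradient M f x = g x"
    using weak_gradient_AE_eq[OF assms] by auto
  have gm: "(\<lambda>x. g x \<bullet> g x) \<in> borel_measurable (mu M)"
    using assms(2) unfolding inner_vec_def inner_real_def
    by (intro borel_measurable_sum borel_measurable_times) (auto simp: is_weak_gradient_def L2_def)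
  have "(\<integral>x. weak_gradient M f x \<bullet> weak_gradient M f x \<partial>mu M) = (\<integral>x. g x \<bullet> g x \<partial>mu M)"
  proof (rule integral_cong_AE)
    show "(\<lambda>x. weak_gradient M f x \<bullet> weak_gradient M f x) \<in> borel_measurable (mu M)"
      using weak_gradient_inner_integrable[OF f f] by auto
    show "AE x in mu M. weak_gradient M f x \<bullet> weak_gradient M f x = g x \<bullet> g x"
      using AE by eventually_elim simp
  qed (rule gm)
  then show ?thesis by (simp add: dirichlet_form_def)
qed

lemma weak_gradient_const:
  "(\<lambda>_. c) \<in> H1 M" "AE x in mu M. weak_gradient M (\<lambda>_. c) x = 0"
proof -
  have c: "(\<lambda>_. c) \<in> L2 M" by (rule continuous_L2) simp
  have "is_weak_gradient M (\<lambda>_. c) (\<lambda>x. if x \<in> interior M then 0 else 0)"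
    by (rule is_weak_gradient_C1[where Df = "\<lambda>_. 0"]) auto
  then show "(\<lambda>_. c) \<in> H1 M" "AE x in mu M. weak_gradient M (\<lambda>_. c) x = 0"
    using weak_gradient_AE_eq[OF c, of "\<lambda>_. 0"] by auto
qed

lemma dirichlet_form_const:
  assumes "f \<in> H1 M"
  shows "dirichlet_form M f (\<lambda>_. c) = 0"
proof -
  have "(\<integral>x. weak_gradient M f x \<bullet> weak_gradient M (\<lambda>_. c) x \<partial>mu M) = (\<integral>x. 0 \<partial>mu M)"
  proof (rule integral_cong_AE)
    show "(\<lambda>x. weak_gradient M f x \<bullet> weak_gradient M (\<lambda>_. c) x) \<in> borel_measurable (mu M)"
      using weak_gradient_inner_integrable[OF assms weak_gradient_const(1)] by auto
    show "AE x in mu M. weak_gradient M f x \<bullet> weak_gradient M (\<lambda>_. c) x = 0"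
      using weak_gradient_const(2)[of c] by eventually_elim simp
  qed simp
  then show ?thesis by (simp add: dirichlet_form_def)
qed

lemma capacity_empty: "capacity M {} = 0"
proof -
  have "open_capacity M {} \<le> ennreal (dirichlet_form M (\<lambda>_. 0) (\<lambda>_. 0) + (L2_norm M (\<lambda>_. 0))\<^sup>2)"
    unfolding open_capacity_def by (rule INF_lower) (use weak_gradient_const(1) in auto)
  also have "\<dots> = 0" using dirichlet_form_const[OF weak_gradient_const(1)] by (simp add: L2_norm_def)
  finally have "open_capacity M {} = 0" by simp
  then show ?thesis
    unfolding capacity_def by (metis (mono_tags, lifting) INF_lower empty_subsetI le_zero_eq mem_Collect_eq openin_empty)
qed

lemma quasi_continuous_continuous:
  assumes "continuous_on M f"
  shows "quasi_continuous M f"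
  unfolding quasi_continuous_def using assms capacity_empty
  by (intro allI impI exI[of _ "{}"]) auto

lemma L2_norm_square: "(L2_norm M f)\<^sup>2 = (\<integral>x. (f x)\<^sup>2 \<partial>mu M)"
  by (simp add: L2_norm_def)

text \<open>The functional that defines the capacity contains the squared \<open>L\<^sup>2\<close> norm, and its competitors are at
  least 1 on a neighbourhood of the set: capacity dominates measure, so quasi-everywhere
  implies almost everywhere.\<close>

lemma vanishes_qe_on_AE:
  assumes "vanishes_qe_on M A f"
  shows "AE x in mu M. x \<in> A \<longrightarrow> f x = 0"
proof -
  interpret prob_space "mu M" by (rule prob_mu)
  obtain h where h: "AE x in mu M. h x = f x" "capacity M {x \<in> A. h x \<noteq> 0} = 0"
    using assms unfolding vanishes_qe_on_def by blast
  define B where "B = {x \<in> A. h x \<noteq> 0}"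
  have small: "\<exists>V \<in> sets (mu M). B \<subseteq> V \<and> emeasure (mu M) V \<le> ennreal e" if "0 < e" for e
  proof -
    have "capacity M B < ennreal e" using h(2) that by (simp add: B_def)
    then obtain V where V: "openin (top_of_set M) V" "B \<subseteq> V" "open_capacity M V < ennreal e"
      unfolding capacity_def INF_less_iff by auto
    then obtain u where u: "u \<in> H1 M" "AE x in mu M. x \<in> V \<longrightarrow> 1 \<le> u x"
      "ennreal (dirichlet_form M u u + (L2_norm M u)\<^sup>2) < ennreal e"
      unfolding open_capacity_def INF_less_iff by auto
    obtain T where T: "open T" "V = M \<inter> T" using V(1) by (auto simp: openin_open)
    have Vs: "V \<in> sets (mu M)" using T by (auto simp: sets_mu sets_restrict_space_iff)
    have um: "u \<in> borel_measurable (mu M)" "integrable (mu M) (\<lambda>x. (u x)\<^sup>2)"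
      using H1_L2[OF u(1)] by (auto simp: L2_def)
    have "emeasure (mu M) V = (\<integral>\<^sup>+x. indicator V x \<partial>mu M)" using Vs by simp
    also have "\<dots> \<le> (\<integral>\<^sup>+x. ennreal ((u x)\<^sup>2) \<partial>mu M)"
    proof (rule nn_integral_mono_AE)
      show "AE x in mu M. indicator V x \<le> ennreal ((u x)\<^sup>2)"
        using u(2)
      proof eventually_elim
        case (elim x)
        then show ?case
          using power_mono[of 1 "u x" 2] by (auto simp: indicator_def)
      qed
    qed
    also have "\<dots> = ennreal ((L2_norm M u)\<^sup>2)"
      unfolding L2_norm_square using um by (intro nn_integral_eq_integral) auto
    also have "\<dots> \<le> ennreal (dirichlet_form M u u + (L2_norm M u)\<^sup>2)"
      using dirichlet_form_nonneg by (intro ennreal_leI) simp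
    finally have "emeasure (mu M) V \<le> ennreal e" using u(3) by (meson less_imp_le order_trans)
    then show ?thesis using Vs V(2) by blast
  qed
  have "\<forall>n. \<exists>V. V \<in> sets (mu M) \<and> B \<subseteq> V \<and> emeasure (mu M) V \<le> ennreal (inverse (real (Suc n)))"
    using small by (meson inverse_positive_iff_positive of_nat_0_less_iff zero_less_Suc)
  from choice[OF this] obtain V where V: "\<forall>n. V n \<in> sets (mu M) \<and> B \<subseteq> V n \<and> emeasure (mu M) (V n) \<le> ennreal (inverse (real (Suc n)))" ..
  define N where "N = (\<Inter>n. V n)"
  have Ns: "N \<in> sets (mu M)" unfolding N_def using V by (intro sets.countable_INT) auto
  have "emeasure (mu M) N \<le> ennreal (inverse (real (Suc n)))" for n
    using V by (intro order_trans[OF emeasure_mono[of N "V n"]]) (auto simp: N_def)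
  moreover have "(\<lambda>n. ennreal (inverse (real (Suc n)))) \<longlonglongrightarrow> ennreal 0"
    by (intro tendsto_ennrealI LIMSEQ_inverse_real_of_nat)
  ultimately have "emeasure (mu M) N \<le> ennreal 0"
    by (intro LIMSEQ_le_const) auto
  then have "N \<in> null_sets (mu M)" using Ns by auto
  then have "AE x in mu M. x \<notin> N" by (rule AE_not_in)
  then show ?thesis
    using h(1)
  proof eventually_elim
    case (elim x)
    show ?case
    proof (intro impI, rule ccontr)
      assume "x \<in> A" "f x \<noteq> 0"
      then have "x \<in> B" using elim by (simp add: B_def)
      then have "x \<in> N" using V unfolding N_def by blast
      with elim show False by simp
    qed
  qed
qed

text \<open>The energy dominates the sum of \<open>l k\<close> times the squared coefficients (Bessel's inequality for the Dirichlet
  form), hence \<open>\<gamma>\<close> times the squared distance of \<open>f\<close> from the span of the ground state. The ground state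
  is constant, so that this distance is the variance.\<close>

theorem spectral_gap_Poincare:
  assumes gap: "neumann_spectrum_discrete_with_gap M \<gamma>" and \<gamma>: "0 < \<gamma>" and f: "f \<in> H1 M"
  shows "\<gamma> * ((\<integral>x. (f x)\<^sup>2 \<partial>mu M) - (\<integral>x. f x \<partial>mu M)\<^sup>2) \<le> dirichlet_form M f f"
proof -
  interpret prob_space "mu M" by (rule prob_mu)
  obtain e l where on: "\<And>j k :: nat. L2_inner M (e j) (e k) = (if j = k then 1 else 0)"
    and complete: "\<And>f. f \<in> L2 M \<Longrightarrow> (\<lambda>N. L2_norm M (\<lambda>x. f x - (\<Sum>k<N. L2_inner M f (e k) * e k x))) \<longlonglongrightarrow> 0"
    and gen: "\<And>k. neumann_generator M (e k) (\<lambda>x. - l k * e k x)"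
    and l: "mono l" "l 0 = 0" "\<gamma> \<le> l 1"
    using gap unfolding neumann_spectrum_discrete_with_gap_def by blast
  have eH: "e k \<in> H1 M" for k using gen by (simp add: neumann_generator_def)
  have eL: "e k \<in> L2 M" for k by (rule H1_L2[OF eH])
  have E: "dirichlet_form M (e k) v = l k * L2_inner M v (e k)" if "v \<in> H1 M" for k v
  proof -
    have "dirichlet_form M (e k) v = - L2_inner M (\<lambda>x. - l k * e k x) v"
      using gen that by (simp add: neumann_generator_def)
    also have "\<dots> = l k * (\<integral>x. e k x * v x \<partial>mu M)" by (simp add: L2_inner_def mult.assoc)
    finally show ?thesis by (simp add: L2_inner_def mult.commute)
  qed
  have lk: "\<gamma> \<le> l k" if "1 \<le> k" for k using l(1,3) that monoD by (metis order_trans)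
  have inner_int: "integrable (mu M) (\<lambda>x. u x * v x)" if "u \<in> L2 M" "v \<in> L2 M" for u v
    by (rule L2_mult_integrable[OF that])
  have sq_int: "integrable (mu M) (\<lambda>x. (u x)\<^sup>2)" if "u \<in> L2 M" for u using that by (simp add: L2_def)
  have dist: "(L2_norm M (\<lambda>x. u x - (\<Sum>k<N. L2_inner M u (e k) * e k x)))\<^sup>2
      = (\<integral>x. (u x)\<^sup>2 \<partial>mu M) - (\<Sum>k<N. (L2_inner M u (e k))\<^sup>2)" if u: "u \<in> L2 M" for u N
  proof -
    let ?c = "\<lambda>k. L2_inner M u (e k)"
    have "(\<integral>x. (u x - (\<Sum>k<N. ?c k * e k x))\<^sup>2 \<partial>mu M)
        = (\<integral>x. (u x)\<^sup>2 - 2 * (\<Sum>k<N. ?c k * (u x * e k x)) + (\<Sum>j<N. \<Sum>k<N. ?c j * ?c k * (e j x * e k x)) \<partial>mu M)"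
      by (intro Bochner_Integration.integral_cong refl)
         (simp add: power2_diff sum_distrib_left sum_distrib_right power2_eq_square[of "\<Sum>k<N. _ k"] sum_product mult_ac)
    also have "\<dots> = (\<integral>x. (u x)\<^sup>2 \<partial>mu M) - 2 * (\<Sum>k<N. ?c k * ?c k) + (\<Sum>j<N. \<Sum>k<N. ?c j * ?c k * L2_inner M (e j) (e k))"
      using sq_int[OF u] inner_int[OF u eL] inner_int[OF eL eL] by (simp add: L2_inner_def)
    also have "(\<Sum>j<N. \<Sum>k<N. ?c j * ?c k * L2_inner M (e j) (e k)) = (\<Sum>j<N. ?c j * ?c j)"
      unfolding on by (intro sum.cong refl) (simp add: if_distrib[of "\<lambda>t. _ * t"] cong: if_cong)
    finally show ?thesis unfolding L2_norm_square by (simp add: power2_eq_square)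
  qed
  have parseval: "(\<lambda>N. \<Sum>k<N. (L2_inner M u (e k))\<^sup>2) \<longlonglongrightarrow> (\<integral>x. (u x)\<^sup>2 \<partial>mu M)" if u: "u \<in> L2 M" for u
  proof -
    have "(\<lambda>N. (L2_norm M (\<lambda>x. u x - (\<Sum>k<N. L2_inner M u (e k) * e k x)))\<^sup>2) \<longlonglongrightarrow> 0\<^sup>2"
      by (intro tendsto_intros complete[OF u])
    then have "(\<lambda>N. (\<integral>x. (u x)\<^sup>2 \<partial>mu M) - ((\<integral>x. (u x)\<^sup>2 \<partial>mu M) - (\<Sum>k<N. (L2_inner M u (e k))\<^sup>2))) \<longlonglongrightarrow> (\<integral>x. (u x)\<^sup>2 \<partial>mu M) - 0\<^sup>2"
      unfolding dist[OF u] by (intro tendsto_intros)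
    then show ?thesis by simp
  qed
  \<comment> \<open>the constant 1 has no energy against any eigenfunction, so it is orthogonal to those of positive eigenvalue\<close>
  define a where "a = L2_inner M (\<lambda>_. 1) (e 0)"
  have one: "(\<lambda>_. 1) \<in> L2 M" by (rule H1_L2[OF weak_gradient_const(1)])
  have zero: "L2_inner M (\<lambda>_. 1) (e k) = 0" if "1 \<le> k" for k
    using E[OF weak_gradient_const(1), of k 1] dirichlet_form_const[OF eH, of k 1] lk[OF that] \<gamma> by auto
  have part: "(\<Sum>k<Suc N. L2_inner M (\<lambda>_. 1) (e k) * e k x) = a * e 0 x" for N x
    unfolding a_def by (subst sum.lessThan_Suc_shift) (simp add: zero)
  have "(\<lambda>N. L2_norm M (\<lambda>x. 1 - (\<Sum>k<Suc N. L2_inner M (\<lambda>_. 1) (e k) * e k x))) \<longlonglongrightarrow> 0"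
    using complete[OF one] by (rule LIMSEQ_Suc)
  then have "L2_norm M (\<lambda>x. 1 - a * e 0 x) = 0" unfolding part by (simp add: LIMSEQ_const_iff)
  then have n0: "(\<integral>x. (1 - a * e 0 x)\<^sup>2 \<partial>mu M) = 0" using L2_norm_square[of "\<lambda>x. 1 - a * e 0 x"] by simp
  have "integrable (mu M) (\<lambda>x. (1 - a * e 0 x)\<^sup>2)"
  proof -
    have "integrable (mu M) (\<lambda>x. 1 - 2 * a * (1 * e 0 x) + a\<^sup>2 * (e 0 x)\<^sup>2)"
      using sq_int[OF eL, of 0] inner_int[OF one eL, of 0] by simp
    moreover have "(\<lambda>x. 1 - 2 * a * (1 * e 0 x) + a\<^sup>2 * (e 0 x)\<^sup>2) = (\<lambda>x. (1 - a * e 0 x)\<^sup>2)"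
      by (simp add: fun_eq_iff power2_eq_square algebra_simps)
    ultimately show ?thesis by (simp only:)
  qed
  then have AE1: "AE x in mu M. a * e 0 x = 1"
    using integral_nonneg_eq_0_iff_AE[of "mu M" "\<lambda>x. (1 - a * e 0 x)\<^sup>2"] n0 by auto
  have m: "(\<integral>x. f x \<partial>mu M) = a * L2_inner M f (e 0)" if f: "f \<in> L2 M" for f
  proof -
    have [measurable]: "f \<in> borel_measurable (mu M)" "e 0 \<in> borel_measurable (mu M)" using f eL by (auto simp: L2_def)
    have "(\<integral>x. f x \<partial>mu M) = (\<integral>x. a * (f x * e 0 x) \<partial>mu M)"
    proof (rule integral_cong_AE)
      show "AE x in mu M. f x = a * (f x * e 0 x)"
        using AE1
      proof eventually_elim
        case (elim x)
        have "a * (f x * e 0 x) = f x * (a * e 0 x)" by simp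
        then show ?case using elim by simp
      qed
    qed measurable
    then show ?thesis by (simp add: L2_inner_def)
  qed
  have "a * a = 1" using m[OF one] prob_space by (simp add: a_def)
  \<comment> \<open>expand the square for the chosen representatives of the gradients; the eigenvalue equation gives the cross terms\<close>
  let ?c = "\<lambda>k. L2_inner M f (e k)"
  have fL: "f \<in> L2 M" by (rule H1_L2[OF f])
  have bessel: "(\<Sum>k<N. l k * (?c k)\<^sup>2) \<le> dirichlet_form M f f" for N
  proof -
    let ?F = "weak_gradient M f" and ?g = "\<lambda>k. weak_gradient M (e k)"
    have inn: "(\<integral>x. ?g k x \<bullet> weak_gradient M v x \<partial>mu M) = 2 * (l k * L2_inner M v (e k))" if "v \<in> H1 M" for k v
      using E[OF that, of k] by (simp add: dirichlet_form_def)
    have int: "integrable (mu M) (\<lambda>x. weak_gradient M u x \<bullet> weak_gradient M v x)" if "u \<in> H1 M" "v \<in> H1 M" for u v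
      by (rule weak_gradient_inner_integrable[OF that])
    have "0 \<le> (\<integral>x. (norm (?F x - (\<Sum>k<N. ?c k *\<^sub>R ?g k x)))\<^sup>2 \<partial>mu M)" by (rule integral_nonneg_AE) auto
    also have "\<dots> = (\<integral>x. ?F x \<bullet> ?F x - 2 * (\<Sum>k<N. ?c k * (?g k x \<bullet> ?F x)) + (\<Sum>j<N. \<Sum>k<N. ?c j * ?c k * (?g j x \<bullet> ?g k x)) \<partial>mu M)"
      by (intro Bochner_Integration.integral_cong refl)
         (simp add: power2_norm_eq_inner inner_diff_left inner_diff_right inner_sum_left inner_sum_right inner_commute sum_distrib_left sum_negf mult_ac)
    also have "\<dots> = (\<integral>x. ?F x \<bullet> ?F x \<partial>mu M) - 2 * (\<Sum>k<N. ?c k * (2 * (l k * ?c k))) + (\<Sum>j<N. \<Sum>k<N. ?c j * ?c k * (2 * (l j * L2_inner M (e k) (e j))))"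
      using int[OF f f] int[OF eH f] int[OF eH eH] inn[OF f] inn[OF eH] by simp
    also have "(\<Sum>j<N. \<Sum>k<N. ?c j * ?c k * (2 * (l j * L2_inner M (e k) (e j)))) = (\<Sum>j<N. 2 * (l j * (?c j)\<^sup>2))"
      unfolding on by (intro sum.cong refl) (simp add: if_distrib[of "\<lambda>t. _ * t"] power2_eq_square mult_ac cong: if_cong)
    also have "(\<Sum>k<N. ?c k * (2 * (l k * ?c k))) = (\<Sum>k<N. 2 * (l k * (?c k)\<^sup>2))"
      by (simp add: power2_eq_square mult_ac)
    finally show ?thesis by (simp add: dirichlet_form_def sum_distrib_left[symmetric])
  qed
  have "(\<lambda>N. \<gamma> * ((\<Sum>k<Suc N. (?c k)\<^sup>2) - (?c 0)\<^sup>2)) \<longlonglongrightarrow> \<gamma> * ((\<integral>x. (f x)\<^sup>2 \<partial>mu M) - (?c 0)\<^sup>2)"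
    by (intro tendsto_intros LIMSEQ_Suc[OF parseval[OF fL]])
  moreover have "\<gamma> * ((\<Sum>k<Suc N. (?c k)\<^sup>2) - (?c 0)\<^sup>2) \<le> dirichlet_form M f f" for N
  proof -
    have "\<gamma> * ((\<Sum>k<Suc N. (?c k)\<^sup>2) - (?c 0)\<^sup>2) = (\<Sum>k<N. \<gamma> * (?c (Suc k))\<^sup>2)"
      by (subst sum.lessThan_Suc_shift) (simp add: sum_distrib_left)
    also have "\<dots> \<le> (\<Sum>k<N. l (Suc k) * (?c (Suc k))\<^sup>2)"
      using lk by (intro sum_mono mult_right_mono) auto
    also have "\<dots> = (\<Sum>k<Suc N. l k * (?c k)\<^sup>2)"
      by (subst sum.lessThan_Suc_shift) (simp add: l)
    also have "\<dots> \<le> dirichlet_form M f f" by (rule bessel)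
    finally show ?thesis .
  qed
  ultimately have "\<gamma> * ((\<integral>x. (f x)\<^sup>2 \<partial>mu M) - (?c 0)\<^sup>2) \<le> dirichlet_form M f f"
    by (intro LIMSEQ_le_const2) auto
  moreover have "(\<integral>x. f x \<partial>mu M)\<^sup>2 = (?c 0)\<^sup>2"
    unfolding m[OF fL] power_mult_distrib using \<open>a * a = 1\<close> by (simp add: power2_eq_square)
  ultimately show ?thesis by simp
qed

end

section \<open>Intrinsic balls and logarithmic cut-offs\<close>

lemma dist_le_curve_length: "ennreal (dist (pathstart g) (pathfinish g)) \<le> curve_length g"
proof -
  let ?t = "\<lambda>i::nat. if i = 0 then 0 else (1::real)"
  have "(1, ?t) \<in> {(k :: nat, t :: nat \<Rightarrow> real). mono_on {..k} t \<and> t ` {..k} \<subseteq> {0..1}}"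
    by (auto simp: mono_on_def)
  from SUP_upper[OF this, of "\<lambda>(k, t). ennreal (\<Sum>i<k. dist (g (t i)) (g (t (Suc i))))"]
  show ?thesis by (simp add: curve_length_def pathstart_def pathfinish_def)
qed

lemma intrinsic_ball_subset_ball: "intrinsic_ball M x \<epsilon> \<subseteq> ball x \<epsilon>"
proof
  fix y assume "y \<in> intrinsic_ball M x \<epsilon>"
  then have lt: "intrinsic_dist M x y < ennreal \<epsilon>" by (simp add: intrinsic_ball_def)
  have "ennreal (dist x y) \<le> intrinsic_dist M x y"
    unfolding intrinsic_dist_def by (rule INF_greatest) (use dist_le_curve_length in auto)
  then have "ennreal (dist x y) < ennreal \<epsilon>" using lt by (rule le_less_trans)
  then show "y \<in> ball x \<epsilon>" by (simp add: ennreal_less_iff)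
qed

lemma curve_length_le_Lipschitz:
  assumes lip: "K-lipschitz_on {0..1} g"
  shows "curve_length g \<le> ennreal K"
  unfolding curve_length_def
proof (rule SUP_least, clarify)
  fix k :: nat and t :: "nat \<Rightarrow> real"
  assume t: "mono_on {..k} t" "t ` {..k} \<subseteq> {0..1}"
  have K: "0 \<le> K" using lip by (rule lipschitz_on_nonneg)
  have "(\<Sum>i<k. dist (g (t i)) (g (t (Suc i)))) \<le> (\<Sum>i<k. K * (t (Suc i) - t i))"
  proof (rule sum_mono)
    fix i assume i: "i \<in> {..<k}"
    then have "t i \<le> t (Suc i)" using t(1) by (auto simp: mono_on_def)
    moreover have "t i \<in> {0..1}" "t (Suc i) \<in> {0..1}"
      using i by (auto intro!: t(2)[THEN subsetD] imageI simp del: atLeastAtMost_iff)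
    then have "dist (g (t i)) (g (t (Suc i))) \<le> K * dist (t i) (t (Suc i))"
      by (rule lipschitz_onD[OF lip])
    ultimately show "dist (g (t i)) (g (t (Suc i))) \<le> K * (t (Suc i) - t i)" by (simp add: dist_real_def)
  qed
  also have "\<dots> = K * (t k - t 0)"
    by (simp add: sum_distrib_left[symmetric] sum_lessThan_telescope)
  also have "\<dots> \<le> K * 1"
  proof (intro mult_left_mono K)
    have "t k \<in> {0..1}" "t 0 \<in> {0..1}" using t(2) by auto
    then show "t k - t 0 \<le> 1" by simp
  qed
  finally show "ennreal (\<Sum>i<k. dist (g (t i)) (g (t (Suc i)))) \<le> ennreal K" by (intro ennreal_leI) simp
qed

text \<open>The image of the segment from \<open>z\<close> to \<open>w\<close> is a curve in \<open>M\<close>, and its length is at most its Lipschitz constant.\<close>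

lemma intrinsic_dist_convex_image:
  fixes \<Phi> :: "'a::real_normed_vector \<Rightarrow> real^'n"
  assumes W: "convex W" and lip: "K-lipschitz_on W \<Phi>" and sub: "\<Phi> ` W \<subseteq> M" and zw: "z \<in> W" "w \<in> W"
  shows "intrinsic_dist M (\<Phi> z) (\<Phi> w) \<le> ennreal (K * dist z w)"
proof -
  define g where "g t = \<Phi> (z + t *\<^sub>R (w - z))" for t :: real
  have K: "0 \<le> K" using lip by (rule lipschitz_on_nonneg)
  have seg: "z + t *\<^sub>R (w - z) \<in> W" if "t \<in> {0..1}" for t
  proof -
    have "(1 - t) *\<^sub>R z + t *\<^sub>R w \<in> W" using that zw by (intro convexD[OF W]) auto
    then show ?thesis by (simp add: algebra_simps)
  qed
  have gl: "(K * dist z w)-lipschitz_on {0..1} g"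
  proof (rule lipschitz_onI)
    fix s t :: real assume st: "s \<in> {0..1}" "t \<in> {0..1}"
    have "dist (g s) (g t) \<le> K * dist (z + s *\<^sub>R (w - z)) (z + t *\<^sub>R (w - z))"
      unfolding g_def using st by (intro lipschitz_onD[OF lip] seg)
    also have "dist (z + s *\<^sub>R (w - z)) (z + t *\<^sub>R (w - z)) = norm ((s - t) *\<^sub>R (w - z))"
      by (simp add: dist_norm scaleR_diff_left)
    also have "\<dots> = dist z w * dist s t" by (simp add: dist_real_def dist_norm norm_minus_commute)
    finally show "dist (g s) (g t) \<le> K * dist z w * dist s t" by (simp add: mult_ac)
  qed (use K in simp)
  have len: "curve_length g \<le> ennreal (K * dist z w)" by (rule curve_length_le_Lipschitz[OF gl])
  have "rectifiable g"
    unfolding rectifiable_def path_def using lipschitz_on_continuous_on[OF gl] len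
    by (auto intro: le_less_trans)
  moreover have "path_image g \<subseteq> M" using seg sub by (auto simp: path_image_def g_def)
  moreover have "pathstart g = \<Phi> z" "pathfinish g = \<Phi> w" by (auto simp: pathstart_def pathfinish_def g_def)
  ultimately have "intrinsic_dist M (\<Phi> z) (\<Phi> w) \<le> curve_length g"
    unfolding intrinsic_dist_def by (intro INF_lower) simp
  then show ?thesis using len by (rule order_trans)
qed

text \<open>A \<open>C\<^sup>1\<close> step from 0 to 1 whose derivative is the hat function on \<open>[1, 3]\<close>.\<close>

definition hat :: "real \<Rightarrow> real" where
  "hat s = max 0 (s - 1) - 2 * max 0 (s - 2) + max 0 (s - 3)"

definition step :: "real \<Rightarrow> real" where
  "step s = ((max 0 (s - 1))\<^sup>2 - 2 * (max 0 (s - 2))\<^sup>2 + (max 0 (s - 3))\<^sup>2) / 2"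

lemma positive_part_square_derivative:
  "((\<lambda>s. (max 0 (s - c))\<^sup>2) has_real_derivative 2 * max 0 (t - c)) (at t)"
proof -
  consider "t < c" | "t = c" | "c < t" by linarith
  then show ?thesis
  proof cases
    case 1
    have "((\<lambda>s. 0) has_real_derivative 0) (at t)" by simp
    then have "((\<lambda>s. (max 0 (s - c))\<^sup>2) has_real_derivative 0) (at t)"
      by (rule has_field_derivative_transform_within_open[OF _ open_lessThan[of c]]) (use 1 in auto)
    then show ?thesis using 1 by simp
  next
    case 2
    have "((\<lambda>s. (max 0 (s - c))\<^sup>2) has_real_derivative 0) (at t)"
    proof (rule has_derivative_zero_of_le_square[where C = 1])
      fix s
      show "\<bar>(max 0 (s - c))\<^sup>2 - (max 0 (t - c))\<^sup>2\<bar> \<le> 1 * (s - t)\<^sup>2"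
        using 2 by (cases "c \<le> s") (auto simp: max_def)
    qed
    then show ?thesis using 2 by simp
  next
    case 3
    have "((\<lambda>s. (s - c)\<^sup>2) has_real_derivative 2 * (t - c)) (at t)"
      by (auto intro!: derivative_eq_intros)
    then have "((\<lambda>s. (max 0 (s - c))\<^sup>2) has_real_derivative 2 * (t - c)) (at t)"
      by (rule has_field_derivative_transform_within_open[OF _ open_greaterThan[of c]]) (use 3 in auto)
    then show ?thesis using 3 by simp
  qed
qed

lemma step_derivative: "(step has_real_derivative hat t) (at t)"
proof -
  have "((\<lambda>s. ((max 0 (s - 1))\<^sup>2 - 2 * (max 0 (s - 2))\<^sup>2 + (max 0 (s - 3))\<^sup>2) / 2) has_real_derivative
     (2 * max 0 (t - 1) - 2 * (2 * max 0 (t - 2)) + 2 * max 0 (t - 3)) / 2) (at t)"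
    by (intro DERIV_cdivide DERIV_add DERIV_diff DERIV_cmult positive_part_square_derivative)
  moreover have "(2 * max 0 (t - 1) - 2 * (2 * max 0 (t - 2)) + 2 * max 0 (t - 3)) / 2 = hat t"
    by (simp add: hat_def add_divide_distrib diff_divide_distrib)
  ultimately show ?thesis by (simp only: step_def[abs_def])
qed

lemma step_eq: "s \<le> 1 \<Longrightarrow> step s = 0" "3 \<le> s \<Longrightarrow> step s = 1"
  by (auto simp: step_def power2_eq_square field_simps)

lemma hat_bounds: "0 \<le> hat s" "hat s \<le> 1" "s \<le> 1 \<Longrightarrow> hat s = 0" "3 \<le> s \<Longrightarrow> hat s = 0"
  by (auto simp: hat_def max_def)

lemma continuous_hat: "continuous_on A hat"
  unfolding hat_def[abs_def] by (intro continuous_intros)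

text \<open>The average of the steps across the annuli of radii \<open>2\<^sup>k \<epsilon>\<close>: a discrete logarithmic cut-off.\<close>

definition cutoff :: "'a::real_inner \<Rightarrow> real \<Rightarrow> nat \<Rightarrow> 'a \<Rightarrow> real" where
  "cutoff x \<epsilon> N y = (\<Sum>k<N. step ((y - x) \<bullet> (y - x) / (2 ^ k * \<epsilon>)\<^sup>2)) / real N"

definition cutoff_gradient :: "'a::real_inner \<Rightarrow> real \<Rightarrow> nat \<Rightarrow> 'a \<Rightarrow> 'a" where
  "cutoff_gradient x \<epsilon> N y =
     (1 / real N) *\<^sub>R (\<Sum>k<N. (hat ((y - x) \<bullet> (y - x) / (2 ^ k * \<epsilon>)\<^sup>2) * (2 / (2 ^ k * \<epsilon>)\<^sup>2)) *\<^sub>R (y - x))"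

lemma cutoff_has_derivative: "(cutoff x \<epsilon> N has_derivative (\<lambda>v. cutoff_gradient x \<epsilon> N y \<bullet> v)) (at y)"
proof -
  have "((\<lambda>y. step ((y - x) \<bullet> (y - x) / c)) has_derivative
      (\<lambda>v. (hat ((y - x) \<bullet> (y - x) / c) * (2 / c)) *\<^sub>R (y - x) \<bullet> v)) (at y)" for c
  proof -
    have "((\<lambda>y. (y - x) \<bullet> (y - x) * (1 / c)) has_derivative (\<lambda>v. (2 * ((y - x) \<bullet> v)) * (1 / c))) (at y)"
      by (intro has_derivative_mult_left) (auto intro!: derivative_eq_intros simp: inner_commute)
    moreover have "(step has_derivative (\<lambda>h. h * hat ((y - x) \<bullet> (y - x) * (1 / c)))) (at ((y - x) \<bullet> (y - x) * (1 / c)))"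
      using step_derivative by (simp add: has_field_derivative_def mult_commute_abs)
    ultimately have "((\<lambda>y. step ((y - x) \<bullet> (y - x) * (1 / c))) has_derivative
        (\<lambda>v. (2 * ((y - x) \<bullet> v)) * (1 / c) * hat ((y - x) \<bullet> (y - x) * (1 / c)))) (at y)"
      using has_derivative_compose by blast
    then show ?thesis by (simp add: mult_ac)
  qed
  then have "((\<lambda>y. (\<Sum>k<N. step ((y - x) \<bullet> (y - x) / (2 ^ k * \<epsilon>)\<^sup>2)) * (1 / real N)) has_derivative
     (\<lambda>v. (\<Sum>k<N. (hat ((y - x) \<bullet> (y - x) / (2 ^ k * \<epsilon>)\<^sup>2) * (2 / (2 ^ k * \<epsilon>)\<^sup>2)) *\<^sub>R (y - x) \<bullet> v) * (1 / real N))) (at y)"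
    by (intro has_derivative_mult_left has_derivative_sum)
  then show ?thesis
    by (simp add: cutoff_def[abs_def] cutoff_gradient_def inner_sum_left)
qed

lemma continuous_cutoff_gradient: "continuous_on A (cutoff_gradient x \<epsilon> N)"
proof -
  have "continuous_on A (\<lambda>y. hat ((y - x) \<bullet> (y - x) * c))" for c
    by (rule continuous_on_compose2[OF continuous_hat[of UNIV]]) (auto intro!: continuous_intros)
  then show ?thesis
    unfolding cutoff_gradient_def[abs_def] divide_inverse by (intro continuous_intros)
qed

lemma cutoff_near:
  assumes \<epsilon>: "0 < \<epsilon>" and y: "dist x y < \<epsilon>"
  shows "cutoff x \<epsilon> N y = 0"
proof -
  have "(y - x) \<bullet> (y - x) / (2 ^ k * \<epsilon>)\<^sup>2 \<le> 1" for k
  proof -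
    have "norm (y - x) \<le> 1 * \<epsilon>" using y by (simp add: dist_norm norm_minus_commute)
    also have "\<dots> \<le> 2 ^ k * \<epsilon>" using \<epsilon> by (intro mult_right_mono) auto
    finally have "(norm (y - x))\<^sup>2 \<le> (2 ^ k * \<epsilon>)\<^sup>2" by (intro power_mono) auto
    then show ?thesis using \<epsilon> by (simp add: power2_norm_eq_inner divide_le_eq)
  qed
  then show ?thesis by (simp add: cutoff_def step_eq(1))
qed

lemma cutoff_far:
  assumes \<epsilon>: "0 < \<epsilon>" and N: "1 \<le> N" and y: "2 ^ N * \<epsilon> \<le> dist x y"
  shows "cutoff x \<epsilon> N y = 1"
proof -
  have "3 \<le> (y - x) \<bullet> (y - x) / (2 ^ k * \<epsilon>)\<^sup>2" if "k < N" for k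
  proof -
    have "2 ^ Suc k * \<epsilon> \<le> 2 ^ N * \<epsilon>" using \<epsilon> that by (intro mult_right_mono power_increasing) auto
    then have "2 * (2 ^ k * \<epsilon>) \<le> norm (y - x)" using y by (simp add: dist_norm norm_minus_commute)
    then have "(2 * (2 ^ k * \<epsilon>))\<^sup>2 \<le> (norm (y - x))\<^sup>2" using \<epsilon> by (intro power_mono) auto
    then have "4 * (2 ^ k * \<epsilon>)\<^sup>2 \<le> (y - x) \<bullet> (y - x)" by (simp add: power_mult_distrib power2_norm_eq_inner)
    then have "3 * (2 ^ k * \<epsilon>)\<^sup>2 \<le> (y - x) \<bullet> (y - x)" using zero_le_power2[of "2 ^ k * \<epsilon>"] by linarith
    then show ?thesis using \<epsilon> by (simp add: le_divide_eq)
  qed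
  then show ?thesis using N by (simp add: cutoff_def step_eq(2))
qed

text \<open>The gradients of the steps have disjoint supports, so their squares add up.\<close>

lemma cutoff_gradient_bound:
  assumes \<epsilon>: "0 < \<epsilon>"
  shows "cutoff_gradient x \<epsilon> N y \<bullet> cutoff_gradient x \<epsilon> N y
    \<le> (1 / (real N)\<^sup>2) * (\<Sum>k<N. 12 / (2 ^ k * \<epsilon>)\<^sup>2 * indicator (ball x (2 * (2 ^ k * \<epsilon>))) y)"
proof -
  define a where "a k = (hat ((y - x) \<bullet> (y - x) / (2 ^ k * \<epsilon>)\<^sup>2) * (2 / (2 ^ k * \<epsilon>)\<^sup>2)) *\<^sub>R (y - x)" for k :: nat
  define b where "b k = 12 / (2 ^ k * \<epsilon>)\<^sup>2 * indicator (ball x (2 * (2 ^ k * \<epsilon>))) y" for k :: nat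
  have b0: "0 \<le> b k" for k by (simp add: b_def)
  have supp: "(2 ^ k * \<epsilon>)\<^sup>2 < (norm (y - x))\<^sup>2 \<and> (norm (y - x))\<^sup>2 < 3 * (2 ^ k * \<epsilon>)\<^sup>2" if "a k \<noteq> 0" for k
  proof -
    have "\<not> (y - x) \<bullet> (y - x) / (2 ^ k * \<epsilon>)\<^sup>2 \<le> 1" "\<not> 3 \<le> (y - x) \<bullet> (y - x) / (2 ^ k * \<epsilon>)\<^sup>2"
      using that hat_bounds(3,4) unfolding a_def by fastforce+
    moreover have "0 < (2 ^ k * \<epsilon>)\<^sup>2" using \<epsilon> by simp
    ultimately show ?thesis
      by (simp add: not_le less_divide_eq divide_less_eq power2_norm_eq_inner)
  qed
  have uniq: "a j = 0" if "a k \<noteq> 0" "j \<noteq> k" for j k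
  proof (rule ccontr)
    assume aj: "a j \<noteq> 0"
    have False if "i < i'" "a i \<noteq> 0" "a i' \<noteq> 0" for i i'
    proof -
      have "2 ^ Suc i * \<epsilon> \<le> 2 ^ i' * \<epsilon>" using \<epsilon> that(1) by (intro mult_right_mono power_increasing) auto
      then have "(2 * (2 ^ i * \<epsilon>))\<^sup>2 \<le> (2 ^ i' * \<epsilon>)\<^sup>2" using \<epsilon> by (intro power_mono) auto
      then have "4 * (2 ^ i * \<epsilon>)\<^sup>2 \<le> (2 ^ i' * \<epsilon>)\<^sup>2" by (simp add: power_mult_distrib)
      then show False using supp[OF that(2)] supp[OF that(3)] zero_le_power2[of "2 ^ i * \<epsilon>"] by linarith
    qed
    then show False using that aj by (meson linorder_neqE_nat)
  qed
  have single: "a k \<bullet> a k \<le> b k" for k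
  proof (cases "a k = 0")
    case False
    define s where "s = (2 ^ k * \<epsilon>)\<^sup>2"
    have s: "0 < s" using \<epsilon> by (simp add: s_def)
    have sk: "(norm (y - x))\<^sup>2 < 3 * s" using supp[OF False] by (simp add: s_def)
    also have "3 * s \<le> (2 * (2 ^ k * \<epsilon>))\<^sup>2" using s by (simp add: s_def power_mult_distrib)
    finally have "norm (y - x) < 2 * (2 ^ k * \<epsilon>)" by (rule power2_less_imp_less) (use \<epsilon> in simp)
    then have ind: "y \<in> ball x (2 * (2 ^ k * \<epsilon>))" by (simp add: dist_norm norm_minus_commute)
    let ?h = "hat ((y - x) \<bullet> (y - x) / s)"
    have "a k \<bullet> a k = ?h\<^sup>2 * (4 / s\<^sup>2) * (norm (y - x))\<^sup>2"
    proof -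
      have "a k = (?h * (2 / s)) *\<^sub>R (y - x)" by (simp only: a_def s_def)
      then show ?thesis by (simp add: power2_norm_eq_inner power2_eq_square[of ?h] power2_eq_square[of s])
    qed
    also have "\<dots> \<le> 1 * (4 / s\<^sup>2) * (3 * s)"
      using hat_bounds(1,2) sk s by (intro mult_mono power_le_one) auto
    also have "\<dots> = 12 / s" using s by (simp add: power2_eq_square)
    finally show ?thesis using ind by (simp add: b_def s_def)
  qed (simp add: b0)
  have "(\<Sum>k<N. a k) \<bullet> (\<Sum>k<N. a k) \<le> (\<Sum>k<N. b k)"
  proof (cases "\<exists>k<N. a k \<noteq> 0")
    case True
    then obtain k where k: "k < N" "a k \<noteq> 0" by blast
    have "(\<Sum>j<N. a j) = (\<Sum>j\<in>{k}. a j)"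
      by (rule sum.mono_neutral_right) (use k uniq[OF k(2)] in auto)
    then have "(\<Sum>k<N. a k) \<bullet> (\<Sum>k<N. a k) \<le> b k" using single by simp
    also have "\<dots> \<le> (\<Sum>k<N. b k)" using k(1) b0 by (intro member_le_sum) auto
    finally show ?thesis .
  next
    case False
    then have "(\<Sum>k<N. a k) = 0" by (intro sum.neutral) auto
    then show ?thesis using b0 by (simp add: sum_nonneg)
  qed
  then have "(1 / (real N)\<^sup>2) * ((\<Sum>k<N. a k) \<bullet> (\<Sum>k<N. a k)) \<le> (1 / (real N)\<^sup>2) * (\<Sum>k<N. b k)"
    by (intro mult_left_mono) auto
  then show ?thesis by (simp add: cutoff_gradient_def a_def b_def power2_eq_square)
qed

context compact_body
begin

lemma ball_Int_sets_mu: "ball x s \<inter> M \<in> sets (mu M)"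
  by (simp add: sets_mu sets_restrict_space_iff)

text \<open>The cut-off is continuous, so it is its own quasi-continuous version. Its energy is a sum of terms
  \<open>(2\<^sup>k \<epsilon>)\<^sup>-\<^sup>2\<close> times the volume of a ball of radius \<open>2\<^sup>k\<^sup>+\<^sup>1 \<epsilon>\<close>, and its norm is at least
  \<open>1 / sqrt 2\<close> because the exceptional ball carries at most half of the mass.\<close>

lemma principal_eigenvalue_le_cutoff:
  assumes \<epsilon>: "0 < \<epsilon>" and N: "1 \<le> N" and A: "A \<subseteq> ball x \<epsilon>"
    and C: "0 \<le> C" and vol_le: "\<And>s. 0 < s \<Longrightarrow> s \<le> 2 ^ N * \<epsilon> \<Longrightarrow> measure (mu M) (ball x s \<inter> M) \<le> C * s ^ CARD('n)"
    and half: "C * (2 ^ N * \<epsilon>) ^ CARD('n) \<le> 1 / 2"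
  shows "principal_eigenvalue M A \<le> ereal (12 * C * 2 ^ CARD('n) / (real N)\<^sup>2 * (\<Sum>k<N. (2 ^ k * \<epsilon>) ^ CARD('n) / (2 ^ k * \<epsilon>)\<^sup>2))"
proof -
  interpret prob_space "mu M" by (rule prob_mu)
  let ?d = "CARD('n)"
  define f where "f = cutoff x \<epsilon> N"
  define g where "g y = (if y \<in> interior M then cutoff_gradient x \<epsilon> N y else 0)" for y
  define S where "S = (\<Sum>k<N. (2 ^ k * \<epsilon>) ^ ?d / (2 ^ k * \<epsilon>)\<^sup>2)"
  have cf: "continuous_on UNIV f"
    unfolding f_def by (intro continuous_at_imp_continuous_on ballI has_derivative_continuous[OF cutoff_has_derivative])
  have fL: "f \<in> L2 M" by (rule continuous_L2[OF cf])
  have wg: "is_weak_gradient M f g"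
    unfolding f_def g_def by (rule is_weak_gradient_C1[OF cutoff_has_derivative continuous_cutoff_gradient])
  have fH: "f \<in> H1 M" by (rule weak_gradient_AE_eq(1)[OF fL wg])
  have "dirichlet_form M f f = 1 / 2 * (\<integral>y. g y \<bullet> g y \<partial>mu M)" by (rule dirichlet_form_eq[OF fL wg])
  also have "(\<integral>y. g y \<bullet> g y \<partial>mu M) \<le> (\<integral>y. (1 / (real N)\<^sup>2) * (\<Sum>k<N. 12 / (2 ^ k * \<epsilon>)\<^sup>2 * indicator (ball x (2 * (2 ^ k * \<epsilon>)) \<inter> M) y) \<partial>mu M)"
  proof (rule integral_mono_AE')
    show "integrable (mu M) (\<lambda>y. (1 / (real N)\<^sup>2) * (\<Sum>k<N. 12 / (2 ^ k * \<epsilon>)\<^sup>2 * indicator (ball x (2 * (2 ^ k * \<epsilon>)) \<inter> M) y))"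
      using ball_Int_sets_mu by (intro integrable_mult_right Bochner_Integration.integrable_sum integrable_real_indicator) (auto simp: less_top[symmetric])
    show "AE y in mu M. g y \<bullet> g y \<le> (1 / (real N)\<^sup>2) * (\<Sum>k<N. 12 / (2 ^ k * \<epsilon>)\<^sup>2 * indicator (ball x (2 * (2 ^ k * \<epsilon>)) \<inter> M) y)"
    proof (rule AE_I2)
      fix y assume y: "y \<in> space (mu M)"
      have "g y \<bullet> g y \<le> cutoff_gradient x \<epsilon> N y \<bullet> cutoff_gradient x \<epsilon> N y" by (simp add: g_def)
      also have "\<dots> \<le> (1 / (real N)\<^sup>2) * (\<Sum>k<N. 12 / (2 ^ k * \<epsilon>)\<^sup>2 * indicator (ball x (2 * (2 ^ k * \<epsilon>))) y)"
        by (rule cutoff_gradient_bound[OF \<epsilon>])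
      also have "\<dots> = (1 / (real N)\<^sup>2) * (\<Sum>k<N. 12 / (2 ^ k * \<epsilon>)\<^sup>2 * indicator (ball x (2 * (2 ^ k * \<epsilon>)) \<inter> M) y)"
        using y by (simp add: indicator_def)
      finally show "g y \<bullet> g y \<le> (1 / (real N)\<^sup>2) * (\<Sum>k<N. 12 / (2 ^ k * \<epsilon>)\<^sup>2 * indicator (ball x (2 * (2 ^ k * \<epsilon>)) \<inter> M) y)" .
    qed
    show "AE y in mu M. 0 \<le> (1 / (real N)\<^sup>2) * (\<Sum>k<N. 12 / (2 ^ k * \<epsilon>)\<^sup>2 * indicator (ball x (2 * (2 ^ k * \<epsilon>)) \<inter> M) y)"
      by (intro AE_I2 mult_nonneg_nonneg sum_nonneg) auto
  qed
  also have "\<dots> = (1 / (real N)\<^sup>2) * (\<Sum>k<N. 12 / (2 ^ k * \<epsilon>)\<^sup>2 * measure (mu M) (ball x (2 * (2 ^ k * \<epsilon>)) \<inter> M))"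
  proof -
    have "integrable (mu M) (indicator (ball x (2 * (2 ^ k * \<epsilon>)) \<inter> M) :: _ \<Rightarrow> real)" for k
      using ball_Int_sets_mu by (intro integrable_real_indicator) (auto simp: less_top[symmetric])
    moreover have "(\<integral>y. indicator (ball x (2 * (2 ^ k * \<epsilon>)) \<inter> M) y \<partial>mu M) = measure (mu M) (ball x (2 * (2 ^ k * \<epsilon>)) \<inter> M)" for k
      using ball_Int_sets_mu by (simp add: Int_absorb2)
    ultimately show ?thesis by simp
  qed
  also have "\<dots> \<le> (1 / (real N)\<^sup>2) * (\<Sum>k<N. 12 / (2 ^ k * \<epsilon>)\<^sup>2 * (C * (2 * (2 ^ k * \<epsilon>)) ^ ?d))"
  proof (intro mult_left_mono sum_mono)
    fix k assume "k \<in> {..<N}"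
    then have "2 ^ Suc k * \<epsilon> \<le> 2 ^ N * \<epsilon>" using \<epsilon> by (intro mult_right_mono power_increasing) auto
    then show "measure (mu M) (ball x (2 * (2 ^ k * \<epsilon>)) \<inter> M) \<le> C * (2 * (2 ^ k * \<epsilon>)) ^ ?d"
      using \<epsilon> by (intro vol_le) auto
  qed auto
  also have "\<dots> = 12 * C * 2 ^ ?d / (real N)\<^sup>2 * S"
    unfolding S_def sum_distrib_left by (intro sum.cong refl) (simp add: power_mult_distrib)
  finally have E: "dirichlet_form M f f \<le> 1 / 2 * (12 * C * 2 ^ ?d / (real N)\<^sup>2 * S)" by simp
  have n2: "1 / 2 \<le> (L2_norm M f)\<^sup>2"
  proof -
    let ?B = "ball x (2 ^ N * \<epsilon>) \<inter> M"
    have "1 / 2 \<le> 1 - measure (mu M) ?B" using vol_le[of "2 ^ N * \<epsilon>"] half \<epsilon> by simp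
    also have "\<dots> = measure (mu M) (space (mu M) - ?B)" by (rule prob_compl[symmetric]) (rule ball_Int_sets_mu)
    also have "\<dots> = (\<integral>y. indicator (space (mu M) - ?B) y \<partial>mu M)"
      using ball_Int_sets_mu by (subst Bochner_Integration.integral_indicator) (auto simp: Int_absorb1 Diff_Int_distrib intro!: arg_cong[where f = "measure (mu M)"])
    also have "\<dots> \<le> (\<integral>y. (f y)\<^sup>2 \<partial>mu M)"
    proof (rule integral_mono)
      show "integrable (mu M) (indicator (space (mu M) - ?B) :: _ \<Rightarrow> real)"
        by (intro integrable_real_indicator sets.compl_sets ball_Int_sets_mu) (simp add: emeasure_eq_measure)
      show "integrable (mu M) (\<lambda>y. (f y)\<^sup>2)" using fL by (simp add: L2_def)
      fix y assume "y \<in> space (mu M)"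
      then show "indicator (space (mu M) - ?B) y \<le> (f y)\<^sup>2"
        using cutoff_far[OF \<epsilon> N, of x y] by (auto simp: indicator_def f_def not_less)
    qed
    finally show ?thesis by (simp add: L2_norm_square)
  qed
  have "vanishes_qe_on M A f"
    unfolding vanishes_qe_on_def
  proof (intro exI[of _ f] conjI)
    show "quasi_continuous M f" using cf by (intro quasi_continuous_continuous) (auto intro: continuous_on_subset)
    have "f y = 0" if "y \<in> A" for y unfolding f_def using that A by (intro cutoff_near[OF \<epsilon>]) auto
    then have "{y \<in> A. f y \<noteq> 0} = {}" by auto
    then show "capacity M {y \<in> A. f y \<noteq> 0} = 0" using capacity_empty by (simp only:)
  qed simp
  moreover have "\<not> (AE y in mu M. f y = 0)"
  proof
    assume "AE y in mu M. f y = 0"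
    then have "(\<integral>y. (f y)\<^sup>2 \<partial>mu M) = 0" by (intro integral_eq_zero_AE) (auto elim!: eventually_mono)
    then show False using n2 by (simp add: L2_norm_square)
  qed
  ultimately have "principal_eigenvalue M A \<le> ereal (dirichlet_form M f f / (L2_norm M f)\<^sup>2)"
    unfolding principal_eigenvalue_def using fH by (intro INF_lower) simp
  also have "\<dots> \<le> ereal (12 * C * 2 ^ ?d / (real N)\<^sup>2 * S)"
  proof -
    have "dirichlet_form M f f \<le> (12 * C * 2 ^ ?d / (real N)\<^sup>2 * S) * (1 / 2)" using E by simp
    also have "\<dots> \<le> (12 * C * 2 ^ ?d / (real N)\<^sup>2 * S) * (L2_norm M f)\<^sup>2"
      using C \<epsilon> n2 by (intro mult_left_mono) (auto simp: S_def intro!: mult_nonneg_nonneg divide_nonneg_nonneg sum_nonneg)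
    finally have le: "dirichlet_form M f f \<le> (12 * C * 2 ^ ?d / (real N)\<^sup>2 * S) * (L2_norm M f)\<^sup>2" .
    have "0 < (L2_norm M f)\<^sup>2" using n2 by linarith
    with le have "dirichlet_form M f f / (L2_norm M f)\<^sup>2 \<le> 12 * C * 2 ^ ?d / (real N)\<^sup>2 * S"
      by (simp only: pos_divide_le_eq)
    then show ?thesis by simp
  qed
  finally show ?thesis by (simp only: S_def)
qed

end

text \<open>The number of annuli: one in dimension at least three, about \<open>log (1 / \<epsilon>)\<close> in the plane.\<close>

lemma cutoff_scale_exists:
  fixes d :: nat and C R0 :: real
  assumes d: "2 \<le> d" and C: "0 < C" and R0: "0 < R0"
  shows "\<exists>C'>0. \<exists>\<epsilon>0>0. \<forall>\<epsilon>. 0 < \<epsilon> \<and> \<epsilon> < \<epsilon>0 \<longrightarrow> (\<exists>N\<ge>1. 2 ^ N * \<epsilon> < R0 \<and> C * (2 ^ N * \<epsilon>) ^ d \<le> 1 / 2 \<and>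
     12 * C * 2 ^ d / (real N)\<^sup>2 * (\<Sum>k<N. (2 ^ k * \<epsilon>) ^ d / (2 ^ k * \<epsilon>)\<^sup>2) \<le> C' * kappa d \<epsilon>)"
proof -
  define R where "R = min (min 1 (R0 / 2)) (1 / (2 * C))"
  have R: "0 < R" "R \<le> 1" "R < R0" "C * R \<le> 1 / 2"
  proof -
    show "0 < R" "R \<le> 1" using C R0 by (auto simp: R_def)
    have "R \<le> R0 / 2" by (simp add: R_def)
    then show "R < R0" using R0 by simp
    have "R \<le> 1 / (2 * C)" by (simp add: R_def)
    then show "C * R \<le> 1 / 2" using C by (simp add: le_divide_eq mult_ac)
  qed
  have ok: "2 ^ N * \<epsilon> < R0 \<and> C * (2 ^ N * \<epsilon>) ^ d \<le> 1 / 2" if "0 < \<epsilon>" "2 ^ N * \<epsilon> \<le> R" for N and \<epsilon> :: real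
  proof -
    have "(2 ^ N * \<epsilon>) ^ d \<le> (2 ^ N * \<epsilon>) ^ 1" using that R d by (intro power_decreasing) auto
    also have "\<dots> \<le> R" using that by simp
    finally have "C * (2 ^ N * \<epsilon>) ^ d \<le> C * R" using C by (intro mult_left_mono) auto
    then show ?thesis using that R by linarith
  qed
  have R2: "R\<^sup>2 \<le> R" using R by (simp add: power2_eq_square mult_left_le)
  define C' where "C' = 24 * C * 2 ^ d"
  have C': "0 < C'" using C by (simp add: C'_def)
  \<comment> \<open>in the plane, \<open>\<epsilon> \<le> R\<^sup>2 / 4\<close> leaves at least \<open>ln (1 / \<epsilon>) / 2\<close> dyadic annuli between \<open>\<epsilon>\<close> and \<open>R\<close>\<close>
  show ?thesis
  proof (rule exI[of _ C'], rule conjI[OF C'], rule exI[of _ "R\<^sup>2 / 4"], intro conjI allI impI)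
    show "0 < R\<^sup>2 / 4" using R by simp
    fix \<epsilon> :: real assume \<epsilon>: "0 < \<epsilon> \<and> \<epsilon> < R\<^sup>2 / 4"
    then have e0: "0 < \<epsilon>" "\<epsilon> < R\<^sup>2 / 4" by auto
    show "\<exists>N\<ge>1. 2 ^ N * \<epsilon> < R0 \<and> C * (2 ^ N * \<epsilon>) ^ d \<le> 1 / 2 \<and>
       12 * C * 2 ^ d / (real N)\<^sup>2 * (\<Sum>k<N. (2 ^ k * \<epsilon>) ^ d / (2 ^ k * \<epsilon>)\<^sup>2) \<le> C' * kappa d \<epsilon>"
    proof (cases "d = 2")
      case False
      then have "d - 2 + 2 = d" using d by simp
      then have "\<epsilon> ^ d = \<epsilon> ^ (d - 2) * \<epsilon>\<^sup>2" by (metis power_add)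
      then have "\<epsilon> ^ d / \<epsilon>\<^sup>2 = \<epsilon> ^ (d - 2)" using \<epsilon> by simp
      moreover have "12 * C * 2 ^ d * \<epsilon> ^ (d - 2) \<le> C' * \<epsilon> ^ (d - 2)"
        using C \<epsilon> by (intro mult_right_mono) (auto simp: C'_def)
      moreover have "2 ^ 1 * \<epsilon> \<le> R" using e0 R2 R(1) by simp
      ultimately show ?thesis
        using ok[of \<epsilon> 1] \<epsilon> False by (intro exI[of _ 1]) (auto simp: kappa_def)
    next
      case True
      define N where "N = nat \<lfloor>log 2 (R / \<epsilon>)\<rfloor>"
      have \<epsilon>1: "\<epsilon> < 1" "0 < \<epsilon>" using e0 R2 R(1,2) by linarith+
      have lnp: "0 < ln (1 / \<epsilon>)" using \<epsilon>1 by simp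
      have ln2: "0 < ln (2::real)" "ln (2::real) \<le> 1" using ln_le_minus_one[of "2::real"] by auto
      have half: "ln (1 / \<epsilon>) / 2 \<le> log 2 (R / \<epsilon>) - 1"
      proof -
        have "4 * \<epsilon> \<le> R\<^sup>2" using \<epsilon> by simp
        then have "ln (4 * \<epsilon>) \<le> ln (R\<^sup>2)" using \<epsilon>1 R by (subst ln_le_cancel_iff) auto
        then have "ln 4 + ln \<epsilon> \<le> 2 * ln R" using \<epsilon>1 R by (simp add: ln_mult ln_realpow)
        moreover have "ln (4::real) = 2 * ln 2" using ln_realpow[of 2 2] by simp
        ultimately have "ln 2 + ln \<epsilon> / 2 \<le> ln R" by simp
        then have "- ln \<epsilon> / 2 \<le> ln (R / \<epsilon>) - ln 2" using \<epsilon>1 R by (simp add: ln_div)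
        then have "(- ln \<epsilon> / 2) / ln 2 \<le> (ln (R / \<epsilon>) - ln 2) / ln 2" using ln2 by (intro divide_right_mono) auto
        also have "\<dots> = log 2 (R / \<epsilon>) - 1" using ln2 by (simp add: log_def diff_divide_distrib)
        finally have 1: "(- ln \<epsilon> / 2) / ln 2 \<le> log 2 (R / \<epsilon>) - 1" .
        have "0 \<le> - ln \<epsilon> / 2" using \<epsilon>1 by simp
        then have "(- ln \<epsilon> / 2) * ln 2 \<le> (- ln \<epsilon> / 2) * 1" using ln2 by (intro mult_left_mono)
        then have "- ln \<epsilon> / 2 \<le> (- ln \<epsilon> / 2) / ln 2" by (subst pos_le_divide_eq[OF ln2(1)]) simp
        then show ?thesis using 1 \<epsilon>1 by (simp add: ln_div)
      qed
      then have pos: "0 < log 2 (R / \<epsilon>)" using lnp by linarith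
      have N_gt: "log 2 (R / \<epsilon>) - 1 < real N"
        unfolding N_def using pos by linarith
      have N_le: "real N \<le> log 2 (R / \<epsilon>)"
        unfolding N_def using pos by (simp add: of_nat_nat)
      have N1: "1 \<le> N" using N_gt half lnp by (cases N) auto
      have "2 powr (real N) \<le> 2 powr (log 2 (R / \<epsilon>))" using N_le by (intro powr_mono) auto
      then have "2 ^ N \<le> R / \<epsilon>" using R \<epsilon>1 by (simp add: powr_realpow)
      then have small: "2 ^ N * \<epsilon> \<le> R" using \<epsilon>1 by (simp add: le_divide_eq)
      have NL: "ln (1 / \<epsilon>) / 2 \<le> real N" using N_gt half by linarith
      have "(\<Sum>k<N. (2 ^ k * \<epsilon>) ^ d / (2 ^ k * \<epsilon>)\<^sup>2) = real N" using True \<epsilon>1 by simp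
      then have "12 * C * 2 ^ d / (real N)\<^sup>2 * (\<Sum>k<N. (2 ^ k * \<epsilon>) ^ d / (2 ^ k * \<epsilon>)\<^sup>2) = 12 * C * 2 ^ d * (1 / real N)"
        using N1 by (simp add: power2_eq_square)
      also have "\<dots> \<le> 12 * C * 2 ^ d * (2 * kappa d \<epsilon>)"
      proof (intro mult_left_mono)
        have "1 / real N \<le> 1 / (ln (1 / \<epsilon>) / 2)" using NL lnp N1 by (intro divide_left_mono mult_pos_pos) auto
        also have "1 / (ln (1 / \<epsilon>) / 2) = 2 * kappa d \<epsilon>"
          unfolding kappa_def if_P[OF True] by (simp only: inverse_eq_divide divide_divide_eq_right mult_1_left times_divide_eq_right mult_1_right)
        finally show "1 / real N \<le> 2 * kappa d \<epsilon>" .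
      qed (use C in auto)
      also have "\<dots> = C' * kappa d \<epsilon>" by (simp add: C'_def)
      finally show ?thesis using ok[OF \<epsilon>1(2) small] N1 by blast
    qed
  qed
qed

section \<open>The energy of functions that vanish on a small ball\<close>

text \<open>The integral of the contraction weight \<open>t\<^sup>1\<^sup>-\<^sup>d\<close> is where the function \<open>kappa\<close> comes from: a logarithm in
  the plane and a power in higher dimensions.\<close>

lemma contraction_weight_le:
  fixes d :: nat and R :: real
  assumes d: "2 \<le> d" and R: "0 < R"
  shows "\<exists>C>0. \<exists>\<epsilon>0>0. \<epsilon>0 \<le> R \<and>
    (\<forall>\<epsilon>. 0 < \<epsilon> \<and> \<epsilon> < \<epsilon>0 \<longrightarrow> 0 < kappa d \<epsilon> \<and> kappa d \<epsilon> \<le> 1 \<and>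
      (\<integral>\<^sup>+t. indicator {\<epsilon> / R..1} t * ennreal (1 / t ^ (d - 1)) \<partial>lborel) \<le> ennreal (C / kappa d \<epsilon>))"
proof -
  \<comment> \<open>below \<open>exp (- 1)\<close> the function \<open>kappa\<close> is at most 1; below \<open>1 / R\<close> the radius \<open>R\<close> at most doubles the logarithm\<close>
  define \<epsilon>0 where "\<epsilon>0 = min (min R (1 / R)) (exp (- 1))"
  have e0: "0 < \<epsilon>0" "\<epsilon>0 \<le> R" "\<epsilon>0 \<le> 1 / R" "\<epsilon>0 \<le> exp (- 1)" using R by (auto simp: \<epsilon>0_def)
  have key: "0 < kappa d \<epsilon> \<and> kappa d \<epsilon> \<le> 1 \<and>
      (\<integral>\<^sup>+t. indicator {\<epsilon> / R..1} t * ennreal (1 / t ^ (d - 1)) \<partial>lborel) \<le> ennreal (max 2 (R ^ (d - 2)) / kappa d \<epsilon>)"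
    if \<epsilon>: "0 < \<epsilon>" "\<epsilon> < \<epsilon>0" for \<epsilon>
  proof -
    define \<tau> where "\<tau> = \<epsilon> / R"
    have \<tau>: "0 < \<tau>" "\<tau> \<le> 1" using \<epsilon> e0 R by (auto simp: \<tau>_def)
    have le_e: "\<epsilon> < exp (- 1)" using \<epsilon> e0 by linarith
    have "ln \<epsilon> < ln (exp (- 1))" using \<epsilon>(1) le_e by (subst ln_less_cancel_iff) auto
    then have lne: "1 < ln (1 / \<epsilon>)" using \<epsilon>(1) by (simp add: ln_div)
    have "exp (- 1) \<le> (1::real)" by simp
    then have lt1: "\<epsilon> < 1" using le_e by linarith
    show ?thesis
    proof (cases "d = 2")
      case True
      have k: "kappa d \<epsilon> = 1 / ln (1 / \<epsilon>)" using True by (simp add: kappa_def inverse_eq_divide)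
      have "(\<integral>\<^sup>+t. ennreal (1 / t) * indicator {\<tau>..1} t \<partial>lborel) = ennreal (ln 1 - ln \<tau>)"
        using \<tau> by (intro nn_integral_FTC_Icc) (auto intro!: derivative_eq_intros)
      moreover have "ln 1 - ln \<tau> \<le> 2 * ln (1 / \<epsilon>)"
      proof -
        have "\<epsilon> \<le> 1 / R" using \<epsilon> e0 by linarith
        then have "R \<le> 1 / \<epsilon>" using \<epsilon> R by (simp add: field_simps)
        then have "ln R \<le> ln (1 / \<epsilon>)" using R \<epsilon> by (subst ln_le_cancel_iff) auto
        then show ?thesis using \<epsilon> R by (simp add: \<tau>_def ln_div)
      qed
      moreover have "2 * ln (1 / \<epsilon>) \<le> max 2 (R ^ (d - 2)) / kappa d \<epsilon>"
        using lne unfolding k by (simp add: mult_right_mono)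
      ultimately have "(\<integral>\<^sup>+t. ennreal (1 / t) * indicator {\<tau>..1} t \<partial>lborel) \<le> ennreal (max 2 (R ^ (d - 2)) / kappa d \<epsilon>)"
        by (simp only:) (intro ennreal_leI, linarith)
      then show ?thesis using lne True unfolding k by (simp add: \<tau>_def mult.commute divide_le_eq)
    next
      case False
      define m where "m = d - 2"
      have m: "1 \<le> m" "d - 1 = Suc m" using d False by (auto simp: m_def)
      have k: "kappa d \<epsilon> = \<epsilon> ^ m" using False by (simp add: kappa_def m_def)
      have "(\<integral>\<^sup>+t. ennreal (1 / t ^ (d - 1)) * indicator {\<tau>..1} t \<partial>lborel) = ennreal (- (1 / (real m * 1 ^ m)) - - (1 / (real m * \<tau> ^ m)))"
      proof (rule nn_integral_FTC_Icc)
        fix t assume "t \<in> {\<tau>..1}"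
        then have t: "0 < t" using \<tau> by auto
        have "((\<lambda>t. - (1 / (real m * t ^ m))) has_real_derivative - (- (real m * (real m * t ^ (m - 1))) / ((real m * t ^ m) * (real m * t ^ m)))) (at t)"
          using t m(1) by (auto intro!: derivative_eq_intros)
        moreover have "- (- (real m * (real m * t ^ (m - 1))) / ((real m * t ^ m) * (real m * t ^ m))) = 1 / t ^ (d - 1)"
        proof -
          have "t ^ m = t * t ^ (m - 1)" using m(1) by (simp add: power_eq_if)
          then show ?thesis using t m by (simp add: m(2))
        qed
        ultimately show "((\<lambda>t. - (1 / (real m * t ^ m))) has_real_derivative 1 / t ^ (d - 1)) (at t)" by simp
        show "0 \<le> 1 / t ^ (d - 1)" using t by simp
      qed (use \<tau> in auto)
      also have "\<dots> \<le> ennreal (max 2 (R ^ (d - 2)) / kappa d \<epsilon>)"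
      proof (rule ennreal_leI)
        have "- (1 / (real m * 1 ^ m)) - - (1 / (real m * \<tau> ^ m)) \<le> 1 / (real m * \<tau> ^ m)" by simp
        also have "\<dots> \<le> 1 / (1 * \<tau> ^ m)"
          using m(1) \<tau> by (intro divide_left_mono mult_right_mono mult_pos_pos) auto
        also have "\<dots> = R ^ m / \<epsilon> ^ m" using R by (simp add: \<tau>_def power_divide)
        also have "\<dots> \<le> max 2 (R ^ (d - 2)) / kappa d \<epsilon>"
          unfolding k using \<epsilon> by (intro divide_right_mono) (auto simp: m_def)
        finally show "- (1 / (real m * 1 ^ m)) - - (1 / (real m * \<tau> ^ m)) \<le> max 2 (R ^ (d - 2)) / kappa d \<epsilon>" .
      qed
      finally show ?thesis using \<epsilon> lt1 unfolding k by (simp add: \<tau>_def mult.commute power_le_one)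
    qed
  qed
  have "0 < max 2 (R ^ (d - 2))" by simp
  then show ?thesis using e0(1,2) key by blast
qed

lemma ball_emeasure_lower:
  fixes b :: "real^'n"
  assumes r: "0 < r"
  shows "ennreal ((r / CARD('n)) ^ CARD('n)) \<le> emeasure lborel (ball b r)"
proof -
  define h where "h = r / (2 * CARD('n))"
  have h: "0 < h" using r by (simp add: h_def)
  have "box (b - h *\<^sub>R One) (b + h *\<^sub>R One) \<subseteq> ball b r"
  proof
    fix x assume x: "x \<in> box (b - h *\<^sub>R One) (b + h *\<^sub>R One)"
    have "dist b x \<le> (\<Sum>i\<in>Basis. \<bar>(b - x) \<bullet> i\<bar>)" unfolding dist_norm by (rule norm_le_l1)
    also have "\<dots> \<le> (\<Sum>i\<in>(Basis :: (real^'n) set). h)"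
    proof (rule sum_mono)
      fix i :: "real^'n" assume "i \<in> Basis"
      then show "\<bar>(b - x) \<bullet> i\<bar> \<le> h"
        using x by (fastforce simp: mem_box inner_diff_left inner_add_left abs_le_iff)
    qed
    also have "\<dots> = r / 2" by (simp add: h_def)
    finally show "x \<in> ball b r" using r by simp
  qed
  then have "emeasure lborel (box (b - h *\<^sub>R One) (b + h *\<^sub>R One)) \<le> emeasure lborel (ball b r)"
    by (intro emeasure_mono) auto
  also have "emeasure lborel (box (b - h *\<^sub>R One) (b + h *\<^sub>R One)) = ennreal ((2 * h) ^ DIM(real^'n))"
    using h by (intro cube_emeasure(2)) (auto simp: inner_diff_left inner_add_left)
  also have "(2 * h) ^ DIM(real^'n) = (r / CARD('n)) ^ CARD('n)" by (simp add: h_def)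
  finally show ?thesis .
qed

lemma ball_emeasure_upper:
  fixes b :: "real^'n"
  assumes r: "0 \<le> r"
  shows "emeasure lborel (ball b r) \<le> ennreal ((2 * r) ^ CARD('n))"
proof -
  have "ball b r \<subseteq> cbox (b - r *\<^sub>R One) (b + r *\<^sub>R One)"
  proof
    fix x assume "x \<in> ball b r"
    then have "\<bar>(x - b) \<bullet> i\<bar> \<le> r" if "i \<in> Basis" for i
      using Basis_le_norm[OF that, of "x - b"] by (simp add: dist_norm norm_minus_commute)
    then show "x \<in> cbox (b - r *\<^sub>R One) (b + r *\<^sub>R One)"
      by (fastforce simp: mem_box inner_diff_left inner_add_left abs_le_iff)
  qed
  then have "emeasure lborel (ball b r) \<le> emeasure lborel (cbox (b - r *\<^sub>R One) (b + r *\<^sub>R One))"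
    by (intro emeasure_mono) auto
  also have "\<dots> = ennreal ((2 * r) ^ DIM(real^'n))"
    using r by (intro cube_emeasure(1)) (auto simp: inner_diff_left inner_add_left)
  finally show ?thesis by simp
qed

context compact_body
begin

lemma nn_integral_lborel_eq_mu:
  assumes h: "h \<in> borel_measurable (mu M)" "\<And>x. 0 \<le> h x" "integrable (mu M) h"
    and eq: "AE x in lborel. h' x = indicator M x * h x"
    and h': "h' \<in> borel_measurable borel"
  shows "(\<integral>\<^sup>+x. ennreal (h' x) \<partial>lborel) = ennreal (vol * (\<integral>x. h x \<partial>mu M))"
proof -
  have eq': "AE x in lebesgue. h' x = indicator M x * h x" using eq by (rule AE_completion)
  have "(\<integral>\<^sup>+x. ennreal (h' x) \<partial>lborel) = (\<integral>\<^sup>+x. ennreal (h' x) \<partial>lebesgue)"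
    by (rule nn_integral_completion[symmetric])
  also have "\<dots> = (\<integral>\<^sup>+x. ennreal (indicator M x * h x) \<partial>lebesgue)"
    using eq' by (intro nn_integral_cong_AE) (auto elim!: eventually_mono)
  also have "\<dots> = ennreal (\<integral>x. indicator M x * h x \<partial>lebesgue)"
    using h integrable_mu_iff[of h] by (intro nn_integral_eq_integral) auto
  also have "(\<integral>x. indicator M x * h x \<partial>lebesgue) = vol * (\<integral>x. h x \<partial>mu M)"
    using emeasure_M(2) by (simp add: integral_mu)
  finally show ?thesis .
qed

text \<open>The quantitative lower bound, for a convex set in a bi-Lipschitz chart. The contraction estimate
  bounds the function on the image of the chart, the spectral gap bounds its variance, and a set of
  fixed volume compares the mean with both.\<close>

lemma chart_lower_bound:
  fixes \<Phi> :: "real^'n \<Rightarrow> real^'n"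
  assumes W: "convex W" "W \<subseteq> ball a r" "ball b (r / 2) \<subseteq> W" and r: "0 < r" and L: "1 \<le> L"
    and lip: "L-lipschitz_on W \<Phi>"
    and exp: "\<And>w w'. w \<in> W \<Longrightarrow> w' \<in> W \<Longrightarrow> dist w w' \<le> L * dist (\<Phi> w) (\<Phi> w')"
    and \<Phi>M: "\<Phi> ` W \<subseteq> M" and z: "z \<in> W"
    and gap: "neumann_spectrum_discrete_with_gap M \<gamma>" and \<gamma>: "0 < \<gamma>"
    and \<epsilon>: "0 < \<epsilon>" "\<epsilon> \<le> 2 * r * L"
    and J: "(\<integral>\<^sup>+t. indicator {\<epsilon> / (2 * r * L)..1} t * ennreal (1 / t ^ (CARD('n) - 1)) \<partial>lborel) \<le> ennreal J" "0 \<le> J"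
    and f: "f \<in> H1 M" and f0: "vanishes_qe_on M (intrinsic_ball M (\<Phi> z) \<epsilon>) f"
  shows "(L2_norm M f)\<^sup>2 \<le> (1 / \<gamma> + vol / (r / 2 / CARD('n)) ^ CARD('n) * (2 * L * CARD('n)) ^ CARD('n)
      * (8 * r\<^sup>2 * L\<^sup>2 * J + 2 / \<gamma>)) * dirichlet_form M f f"
proof -
  let ?d = "CARD('n)"
  define I where "I = interior W"
  define E where "E = dirichlet_form M f f"
  define m where "m = (\<integral>x. f x \<partial>mu M)"
  define K2 where "K2 = (2 * L * ?d) ^ ?d"
  define v0 where "v0 = (r / 2 / ?d) ^ ?d"
  have K2: "0 \<le> K2" using L by (simp add: K2_def)
  have v0: "0 < v0" using r by (simp add: v0_def)
  have L0: "0 \<le> L" using L by simp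
  have IW: "I \<subseteq> W" by (simp add: I_def interior_subset)
  have Is[measurable]: "I \<in> sets borel" by (simp add: I_def)
  have lipI: "L-lipschitz_on I \<Phi>" using lip IW by (rule lipschitz_on_subset)
  have contI: "continuous_on I \<Phi>" using lipI by (rule lipschitz_on_continuous_on)
  have expI: "dist w w' \<le> L * dist (\<Phi> w) (\<Phi> w')" if "w \<in> I" "w' \<in> I" for w w' using exp that IW by blast
  have inj: "inj_on \<Phi> I"
  proof (rule inj_onI)
    fix w w' assume "w \<in> I" "w' \<in> I" "\<Phi> w = \<Phi> w'"
    then show "w = w'" using expI[of w w'] by simp
  qed
  have open_im: "open (\<Phi> ` T)" if "open T" "T \<subseteq> I" for T
    using that contI inj by (intro invariance_of_domain) (auto intro: continuous_on_subset inj_on_subset)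
  have \<Phi>int: "\<Phi> ` I \<subseteq> interior M"
    using open_im[of I] \<Phi>M IW by (intro interior_maximal) (auto simp: I_def)
  have bd: "bounded (\<Phi> ` I)" using \<Phi>int compact_M interior_subset[of M]
    by (meson bounded_subset compact_imp_bounded order_trans)
  define \<tau> where "\<tau> = \<epsilon> / (2 * r * L)"
  have \<tau>: "0 < \<tau>" "\<tau> \<le> 1" using \<epsilon> r L by (auto simp: \<tau>_def)
  define V where "V = \<Phi> ` (I \<inter> ball z (\<epsilon> / L))"
  have V: "open V" unfolding V_def by (rule open_im) (auto simp: I_def)
  have VM: "V \<subseteq> M" using \<Phi>M IW by (auto simp: V_def)
  have inV: "\<Phi> (z + \<tau> *\<^sub>R (y - z)) \<in> V" if y: "y \<in> I" for y
  proof -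
    have "z - \<tau> *\<^sub>R (z - y) \<in> I"
      unfolding I_def using y z \<tau> by (intro mem_interior_convex_shrink[OF W(1)]) (auto simp: I_def)
    then have 1: "z + \<tau> *\<^sub>R (y - z) \<in> I" by (simp add: algebra_simps)
    have "dist y z \<le> dist y a + dist a z" by (rule dist_triangle)
    also have "\<dots> < r + r" using y z IW W(2) by (intro add_strict_mono) (auto simp: dist_commute)
    finally have "norm (y - z) < 2 * r" by (simp add: dist_norm)
    then have "\<tau> * norm (y - z) < \<tau> * (2 * r)" using \<tau> by (intro mult_strict_left_mono)
    also have "\<tau> * (2 * r) = \<epsilon> / L" using r by (simp add: \<tau>_def)
    finally have "dist z (z + \<tau> *\<^sub>R (y - z)) < \<epsilon> / L" using \<tau> by (simp add: dist_norm)
    then show ?thesis using 1 by (auto simp: V_def)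
  qed
  have Vball: "V \<subseteq> intrinsic_ball M (\<Phi> z) \<epsilon>"
  proof
    fix p assume "p \<in> V"
    then obtain w where w: "w \<in> I" "dist z w < \<epsilon> / L" "p = \<Phi> w" by (auto simp: V_def)
    have "intrinsic_dist M (\<Phi> z) (\<Phi> w) \<le> ennreal (L * dist z w)"
      using w(1) IW by (intro intrinsic_dist_convex_image[OF W(1) lip \<Phi>M z]) auto
    also have "\<dots> < ennreal \<epsilon>"
      using w(2) L \<epsilon> by (intro ennreal_lessI) (simp_all add: less_divide_eq mult.commute)
    finally show "p \<in> intrinsic_ball M (\<Phi> z) \<epsilon>" using w VM \<open>p \<in> V\<close> by (auto simp: intrinsic_ball_def)
  qed
  have fL: "f \<in> L2 M" by (rule H1_L2[OF f])
  have fsq: "integrable (mu M) (\<lambda>x. (f x)\<^sup>2)" and fm[measurable]: "f \<in> borel_measurable (mu M)"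
    using fL by (auto simp: L2_def)
  have fint: "integrable (mu M) f" by (rule L2_integrable[OF fL])
  obtain f' g' where fg: "weak_gradient_on (interior M) f' g'"
    "AE x in lborel. f' x = indicator M x * f x" "AE x in lborel. g' x = weak_gradient M f x"
    using weak_gradient_borel_version[OF fL weak_gradient_spec[OF f]] by blast
  have [measurable]: "f' \<in> borel_measurable borel" "g' \<in> borel_measurable borel"
    using fg(1) by (auto simp: weak_gradient_on_def dest: borel_measurable_integrable)
  have van: "AE x in lborel. x \<in> V \<longrightarrow> f' x = 0"
  proof -
    have [measurable]: "V \<in> sets borel" using V by simp
    have "AE x in mu M. x \<in> intrinsic_ball M (\<Phi> z) \<epsilon> \<longrightarrow> f x = 0" by (rule vanishes_qe_on_AE[OF f0])
    then have "AE x in lebesgue. x \<in> M \<longrightarrow> x \<in> intrinsic_ball M (\<Phi> z) \<epsilon> \<longrightarrow> f x = 0"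
      by (simp add: AE_mu_iff)
    moreover have "AE x in lebesgue. f' x = indicator M x * f x" using fg(2) by (rule AE_completion)
    ultimately have "AE x in lebesgue. x \<in> V \<longrightarrow> f' x = 0"
    proof eventually_elim
      case (elim x)
      then show ?case using Vball VM by auto
    qed
    then show ?thesis by (simp add: AE_completion_iff)
  qed
  have grad: "(\<integral>\<^sup>+x. ennreal ((norm (g' x))\<^sup>2) \<partial>lborel) = ennreal (vol * (2 * E))"
  proof -
    have "(\<integral>\<^sup>+x. ennreal ((norm (g' x))\<^sup>2) \<partial>lborel) = ennreal (vol * (\<integral>x. weak_gradient M f x \<bullet> weak_gradient M f x \<partial>mu M))"
    proof (rule nn_integral_lborel_eq_mu)
      show i: "integrable (mu M) (\<lambda>x. weak_gradient M f x \<bullet> weak_gradient M f x)"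
        by (rule weak_gradient_inner_integrable[OF f f])
      then show "(\<lambda>x. weak_gradient M f x \<bullet> weak_gradient M f x) \<in> borel_measurable (mu M)" by auto
      show "AE x in lborel. (norm (g' x))\<^sup>2 = indicator M x * (weak_gradient M f x \<bullet> weak_gradient M f x)"
        using fg(3)
      proof eventually_elim
        case (elim x)
        have "weak_gradient M f x = 0" if "x \<notin> M"
          using weak_gradient_spec[OF f] that interior_subset[of M] by (auto simp: is_weak_gradient_def)
        then show ?case using elim by (auto simp: indicator_def power2_norm_eq_inner)
      qed
    qed auto
    then show ?thesis by (simp add: E_def dirichlet_form_def)
  qed
  have E0: "0 \<le> E" by (simp add: E_def dirichlet_form_nonneg)
  have vol: "0 < vol" by (rule emeasure_M(2))
  have small: "(\<integral>\<^sup>+y. indicator I y * ennreal ((f' (\<Phi> y))\<^sup>2) \<partial>lborel) \<le> ennreal (K2 * (2 * r\<^sup>2) * L\<^sup>2 * J * (vol * (2 * E)))"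
  proof -
    have "(\<integral>\<^sup>+y. indicator I y * ennreal ((f' (\<Phi> y))\<^sup>2) \<partial>lborel)
      \<le> ennreal (K2 * (2 * r\<^sup>2) * L\<^sup>2) * (\<integral>\<^sup>+t. indicator {\<tau>..1} t * ennreal (1 / t ^ (?d - 1)) \<partial>lborel) * (\<integral>\<^sup>+x. ennreal ((norm (g' x))\<^sup>2) \<partial>lborel)"
      unfolding I_def K2_def
      by (rule cone_vanishing_estimate[OF W(1,2) z \<tau> lipI[unfolded I_def] expI[unfolded I_def] open_interior \<Phi>int[unfolded I_def] fg(1) V inV[unfolded I_def] van])
    also have "\<dots> \<le> ennreal (K2 * (2 * r\<^sup>2) * L\<^sup>2) * ennreal J * ennreal (vol * (2 * E))"
      unfolding grad using J(1) by (intro mult_right_mono mult_left_mono) (auto simp: \<tau>_def)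
    also have "\<dots> = ennreal (K2 * (2 * r\<^sup>2) * L\<^sup>2 * J * (vol * (2 * E)))"
    proof -
      have "ennreal P * ennreal J * ennreal Q = ennreal (P * J * Q)" if "0 \<le> P" "0 \<le> Q" for P Q
        using that J(2) by (simp add: ennreal_mult)
      then show ?thesis using K2 E0 vol by simp
    qed
    finally show ?thesis .
  qed
  interpret prob_space "mu M" by (rule prob_mu)
  define Var where "Var = (\<integral>x. (f x - m)\<^sup>2 \<partial>mu M)"
  have varint: "integrable (mu M) (\<lambda>x. (f x - m)\<^sup>2)"
    using fsq fint by (simp add: power2_diff)
  have Var: "Var = (L2_norm M f)\<^sup>2 - m\<^sup>2"
  proof -
    have "Var = (\<integral>x. (f x)\<^sup>2 - 2 * m * f x + m\<^sup>2 \<partial>mu M)"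
      unfolding Var_def by (intro Bochner_Integration.integral_cong) (auto simp: power2_diff)
    also have "\<dots> = (\<integral>x. (f x)\<^sup>2 \<partial>mu M) - 2 * m * m + m\<^sup>2"
      using fsq fint prob_space by (simp add: m_def[symmetric])
    finally show ?thesis by (simp add: L2_norm_square power2_eq_square[of m])
  qed
  have gapV: "Var \<le> E / \<gamma>"
    using spectral_gap_Poincare[OF gap \<gamma> f] \<gamma> unfolding Var E_def[symmetric] m_def[symmetric] L2_norm_square
    by (simp add: le_divide_eq mult.commute)
  have Var0: "0 \<le> Var" unfolding Var_def by (rule integral_nonneg_AE) auto
  have dev: "(\<integral>\<^sup>+y. indicator I y * ennreal ((f' (\<Phi> y) - m)\<^sup>2) \<partial>lborel) \<le> ennreal (K2 * (vol * Var))"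
  proof -
    let ?h = "\<lambda>x. indicator M x * (f' x - m)\<^sup>2"
    have [measurable]: "M \<in> sets borel" by (rule M_sets)
    have "(\<integral>\<^sup>+y. indicator I y * ennreal ((f' (\<Phi> y) - m)\<^sup>2) \<partial>lborel) = (\<integral>\<^sup>+y\<in>I. ennreal (?h (\<Phi> y)) \<partial>lborel)"
      using \<Phi>M IW by (intro nn_integral_cong) (auto simp: indicator_def)
    also have "\<dots> \<le> ennreal ((2 * L * DIM(real^'n)) ^ DIM(real^'n)) * (\<integral>\<^sup>+x. ennreal (?h x) \<partial>lborel)"
      by (rule nn_integral_expansive_le[OF L0 expI contI Is bd]) measurable
    also have "(\<integral>\<^sup>+x. ennreal (?h x) \<partial>lborel) = ennreal (vol * Var)"
      unfolding Var_def
    proof (rule nn_integral_lborel_eq_mu)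
      show "AE x in lborel. ?h x = indicator M x * (f x - m)\<^sup>2"
        using fg(2) by eventually_elim (auto simp: indicator_def)
    qed (use varint in auto)
    finally show ?thesis using K2 Var0 vol by (simp add: K2_def[symmetric] ennreal_mult)
  qed
  have size: "ennreal v0 \<le> emeasure lborel I"
  proof -
    have "ball b (r / 2) \<subseteq> I" unfolding I_def using W(3) by (intro interior_maximal) auto
    then have "emeasure lborel (ball b (r / 2)) \<le> emeasure lborel I" by (intro emeasure_mono) auto
    then show ?thesis using ball_emeasure_lower[of "r / 2" b] r unfolding v0_def by (auto intro: order_trans)
  qed
  have comp_meas: "(\<lambda>w. indicator I w * ennreal (h (\<Phi> w))) \<in> borel_measurable borel"
    if [measurable]: "h \<in> borel_measurable borel" for h :: "_ \<Rightarrow> real"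
  proof -
    have "\<Phi> \<in> borel_measurable (restrict_space borel I)"
      by (rule borel_measurable_continuous_on_restrict[OF contI])
    then have "(\<lambda>w. ennreal (h (\<Phi> w))) \<in> borel_measurable (restrict_space borel I)"
      by (rule measurable_compose) measurable
    then show ?thesis
      by (subst (asm) borel_measurable_restrict_space_iff_ennreal) (auto simp: mult.commute I_def)
  qed
  \<comment> \<open>the mean differs little from a function that is small on the chart: integrate \<open>m\<^sup>2 \<le> 2 s\<^sup>2 + 2 (s - m)\<^sup>2\<close>\<close>
  have "ennreal (m\<^sup>2 * v0) = ennreal (m\<^sup>2) * ennreal v0" using v0 by (simp add: ennreal_mult)
  also have "\<dots> \<le> ennreal (m\<^sup>2) * emeasure lborel I" by (intro mult_left_mono size) simp
  also have "\<dots> = (\<integral>\<^sup>+y. ennreal (m\<^sup>2) * indicator I y \<partial>lborel)" by (simp add: nn_integral_cmult_indicator)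
  also have "\<dots> \<le> (\<integral>\<^sup>+y. 2 * (indicator I y * ennreal ((f' (\<Phi> y))\<^sup>2)) + 2 * (indicator I y * ennreal ((f' (\<Phi> y) - m)\<^sup>2)) \<partial>lborel)"
  proof (rule nn_integral_mono)
    fix y
    have "m\<^sup>2 \<le> 2 * s\<^sup>2 + 2 * (s - m)\<^sup>2" for s
    proof -
      have "0 \<le> (2 * s - m)\<^sup>2" by simp
      then show ?thesis by (simp add: power2_eq_square algebra_simps)
    qed
    then have "ennreal (m\<^sup>2) \<le> ennreal (2 * (f' (\<Phi> y))\<^sup>2 + 2 * (f' (\<Phi> y) - m)\<^sup>2)" by (rule ennreal_leI)
    also have "\<dots> = 2 * ennreal ((f' (\<Phi> y))\<^sup>2) + 2 * ennreal ((f' (\<Phi> y) - m)\<^sup>2)"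
      by (simp add: ennreal_mult ennreal_numeral[symmetric] del: ennreal_numeral)
    finally show "ennreal (m\<^sup>2) * indicator I y \<le> 2 * (indicator I y * ennreal ((f' (\<Phi> y))\<^sup>2)) + 2 * (indicator I y * ennreal ((f' (\<Phi> y) - m)\<^sup>2))"
      by (auto simp: indicator_def)
  qed
  also have "\<dots> = 2 * (\<integral>\<^sup>+y. indicator I y * ennreal ((f' (\<Phi> y))\<^sup>2) \<partial>lborel) + 2 * (\<integral>\<^sup>+y. indicator I y * ennreal ((f' (\<Phi> y) - m)\<^sup>2) \<partial>lborel)"
    using comp_meas[of "\<lambda>x. (f' x)\<^sup>2"] comp_meas[of "\<lambda>x. (f' x - m)\<^sup>2"]
    by (simp add: nn_integral_add nn_integral_cmult)
  also have "\<dots> \<le> 2 * ennreal (K2 * (2 * r\<^sup>2) * L\<^sup>2 * J * (vol * (2 * E))) + 2 * ennreal (K2 * (vol * Var))"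
    by (intro add_mono mult_left_mono small dev) auto
  also have "\<dots> = ennreal (2 * (K2 * (2 * r\<^sup>2) * L\<^sup>2 * J * (vol * (2 * E))) + 2 * (K2 * (vol * Var)))"
  proof -
    have "2 * ennreal P + 2 * ennreal Q = ennreal (2 * P + 2 * Q)" if "0 \<le> P" "0 \<le> Q" for P Q
      using that by (simp add: ennreal_mult)
    then show ?thesis using K2 J(2) E0 vol Var0 by simp
  qed
  finally have "m\<^sup>2 * v0 \<le> 2 * (K2 * (2 * r\<^sup>2) * L\<^sup>2 * J * (vol * (2 * E))) + 2 * (K2 * (vol * Var))"
    using K2 J(2) E0 vol Var0 by (subst (asm) ennreal_le_iff) auto
  also have "\<dots> \<le> 2 * (K2 * (2 * r\<^sup>2) * L\<^sup>2 * J * (vol * (2 * E))) + 2 * (K2 * (vol * (E / \<gamma>)))"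
    using K2 vol gapV by (intro add_left_mono mult_left_mono) auto
  also have "\<dots> = vol * K2 * (8 * r\<^sup>2 * L\<^sup>2 * J + 2 / \<gamma>) * E" by (simp add: algebra_simps)
  finally have "m\<^sup>2 \<le> (vol * K2 * (8 * r\<^sup>2 * L\<^sup>2 * J + 2 / \<gamma>) * E) / v0" using v0 by (simp add: le_divide_eq)
  moreover have "(L2_norm M f)\<^sup>2 = Var + m\<^sup>2" using Var by simp
  ultimately have "(L2_norm M f)\<^sup>2 \<le> E / \<gamma> + (vol * K2 * (8 * r\<^sup>2 * L\<^sup>2 * J + 2 / \<gamma>) * E) / v0"
    using gapV by linarith
  also have "\<dots> = (1 / \<gamma> + vol / v0 * K2 * (8 * r\<^sup>2 * L\<^sup>2 * J + 2 / \<gamma>)) * E"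
    by (simp add: distrib_right)
  finally show ?thesis unfolding E_def K2_def v0_def .
qed

end

section \<open>Uniformity over the domains with given data\<close>

lemma standing_assumptions_compact_body:
  assumes "standing_assumptions D M"
  shows "compact_body M"
proof -
  obtain \<Omega> where \<Omega>: "open \<Omega>" "bounded \<Omega>" "\<Omega> \<noteq> {}" "M = closure \<Omega>"
    using assms by (auto simp: standing_assumptions_def)
  have "\<Omega> \<subseteq> interior M" using \<Omega> by (intro interior_maximal) (auto simp: closure_subset)
  then show ?thesis using \<Omega> by unfold_locales (auto simp: compact_closure)
qed

text \<open>The image of a chart is a ball or a half-ball. Both are convex, and the half-ball contains the ball of
  half the radius that touches its flat face. The point \<open>x\<close> may lie anywhere in the chart, since the
  contraction estimate holds for every centre \<open>z\<close> of the convex set.\<close>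

lemma chart_parametrisation:
  fixes M :: "(real^'n) set"
  assumes chart: "is_chart D M x U \<Psi>" and r: "0 < rad_ch D"
  shows "\<exists>(W :: (real^'n) set) a b \<Phi> z. convex W \<and> W \<subseteq> ball a (rad_ch D) \<and> ball b (rad_ch D / 2) \<subseteq> W \<and>
    (L_ch D)-lipschitz_on W \<Phi> \<and> (\<forall>w\<in>W. \<forall>w'\<in>W. dist w w' \<le> L_ch D * dist (\<Phi> w) (\<Phi> w')) \<and>
    \<Phi> ` W \<subseteq> M \<and> z \<in> W \<and> \<Phi> z = x"
proof -
  let ?r = "rad_ch D"
  have U: "U \<subseteq> M" "x \<in> U" and inj: "inj_on \<Psi> U" and lip: "(L_ch D)-lipschitz_on U \<Psi>"
    "(L_ch D)-lipschitz_on (\<Psi> ` U) (inv_into U \<Psi>)"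
    using chart interior_of_subset[of "top_of_set M" U] by (auto simp: is_chart_def)
  have shape: "convex (\<Psi> ` U) \<and> (\<exists>a b. \<Psi> ` U \<subseteq> ball a ?r \<and> ball b (?r / 2) \<subseteq> \<Psi> ` U)"
  proof (cases "infdist x (frontier M) \<ge> rho_ch D")
    case True
    then obtain a where "\<Psi> ` U = ball a ?r" using chart by (auto simp: is_chart_def)
    moreover have "ball a (?r / 2) \<subseteq> ball a ?r" using r by (intro subset_ball) simp
    ultimately show ?thesis by (metis convex_ball order_refl)
  next
    case False
    then obtain a \<nu> where \<nu>: "norm \<nu> = 1" and W: "\<Psi> ` U = {z \<in> ball a ?r. 0 \<le> (z - a) \<bullet> \<nu>}"
      using chart by (auto simp: is_chart_def)
    have "{z \<in> ball a ?r. 0 \<le> (z - a) \<bullet> \<nu>} = ball a ?r \<inter> {z. \<nu> \<bullet> z \<ge> \<nu> \<bullet> a}"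
      by (auto simp: inner_commute[of _ \<nu>] inner_diff_right)
    then have cv: "convex (\<Psi> ` U)" unfolding W by (simp add: convex_Int convex_halfspace_ge)
    define b where "b = a + (?r / 2) *\<^sub>R \<nu>"
    have "ball b (?r / 2) \<subseteq> \<Psi> ` U"
    proof
      fix w assume "w \<in> ball b (?r / 2)"
      then have wb: "norm (w - b) < ?r / 2" by (simp add: dist_norm norm_minus_commute)
      have wa: "w - a = (w - b) + (?r / 2) *\<^sub>R \<nu>" by (simp add: b_def)
      have "norm (w - a) \<le> norm (w - b) + norm ((?r / 2) *\<^sub>R \<nu>)" unfolding wa by (rule norm_triangle_ineq)
      then have "norm (w - a) < ?r" using wb \<nu> r by simp
      moreover have "0 \<le> (w - a) \<bullet> \<nu>"
      proof -
        have "\<bar>(w - b) \<bullet> \<nu>\<bar> \<le> norm (w - b)" using Cauchy_Schwarz_ineq2[of "w - b" \<nu>] \<nu> by simp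
        moreover have "(w - a) \<bullet> \<nu> = (w - b) \<bullet> \<nu> + ?r / 2"
          unfolding wa using \<nu> by (simp add: inner_add_left power2_norm_eq_inner[symmetric])
        ultimately show ?thesis using wb by linarith
      qed
      ultimately show "w \<in> \<Psi> ` U" unfolding W by (simp add: dist_norm norm_minus_commute)
    qed
    moreover have "\<Psi> ` U \<subseteq> ball a ?r" using W by auto
    ultimately show ?thesis using cv by blast
  qed
  then obtain a b where ab: "\<Psi> ` U \<subseteq> ball a ?r" "ball b (?r / 2) \<subseteq> \<Psi> ` U" by blast
  show ?thesis
  proof (rule exI[of _ "\<Psi> ` U"], rule exI[of _ a], rule exI[of _ b], rule exI[of _ "inv_into U \<Psi>"],
      rule exI[of _ "\<Psi> x"], intro conjI ballI)
    show "convex (\<Psi> ` U)" using shape by blast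
    show "inv_into U \<Psi> ` \<Psi> ` U \<subseteq> M" using U inv_into_into[of _ \<Psi> U] by fast
    show "inv_into U \<Psi> (\<Psi> x) = x" using inj U by (simp add: inv_into_f_f)
    fix w w' assume w: "w \<in> \<Psi> ` U" "w' \<in> \<Psi> ` U"
    have "dist (\<Psi> (inv_into U \<Psi> w)) (\<Psi> (inv_into U \<Psi> w')) \<le> L_ch D * dist (inv_into U \<Psi> w) (inv_into U \<Psi> w')"
      using w by (intro lipschitz_onD[OF lip(1)] inv_into_into)
    then show "dist w w' \<le> L_ch D * dist (inv_into U \<Psi> w) (inv_into U \<Psi> w')"
      using w by (simp add: f_inv_into_f)
  qed (use ab lip U in auto)
qed

text \<open>A Euclidean ball in \<open>M\<close> lies in the intrinsic ball of radius larger by the factor \<open>c_ie\<close>; this gives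
  the first bound. The second compares an intrinsic ball with the Euclidean ball around it: a
  large volume of \<open>M\<close> would make its normalised measure smaller than \<open>c_vol\<close> permits.\<close>

lemma volume_bounds:
  fixes M :: "(real^'n) set"
  assumes sa: "standing_assumptions D M" and x: "x \<in> M"
  shows "0 < s \<Longrightarrow> s < rho_ie D \<Longrightarrow> s < rho_vol D / c_ie D \<Longrightarrow>
      measure (mu M) (ball x s \<inter> M) \<le> C_vol D * c_ie D ^ CARD('n) * s ^ CARD('n)"
    and "compact_body.vol M \<le> 2 ^ CARD('n) / c_vol D"
proof -
  interpret compact_body M by (rule standing_assumptions_compact_body[OF sa])
  interpret prob_space "mu M" by (rule prob_mu)
  have c: "1 \<le> c_ie D" "0 < c_vol D" "0 < rho_vol D"
    and ie: "\<And>x y. x \<in> M \<Longrightarrow> y \<in> M \<Longrightarrow> dist x y < rho_ie D \<Longrightarrow> intrinsic_dist M x y \<le> ennreal (c_ie D * dist x y)"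
    and v: "\<And>x \<epsilon>. x \<in> M \<Longrightarrow> 0 < \<epsilon> \<Longrightarrow> \<epsilon> < rho_vol D \<Longrightarrow> c_vol D * \<epsilon> ^ CARD('n) \<le> measure (mu M) (intrinsic_ball M x \<epsilon>)
       \<and> measure (mu M) (intrinsic_ball M x \<epsilon>) \<le> C_vol D * \<epsilon> ^ CARD('n)"
    using sa by (auto simp: standing_assumptions_def)
  \<comment> \<open>a set that is not measurable would have measure 0\<close>
  have meas: "intrinsic_ball M x \<epsilon> \<in> sets (mu M)" if "0 < \<epsilon>" "\<epsilon> < rho_vol D" for \<epsilon>
  proof (rule ccontr)
    assume "intrinsic_ball M x \<epsilon> \<notin> sets (mu M)"
    then have "measure (mu M) (intrinsic_ball M x \<epsilon>) = 0" by (rule measure_notin_sets)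
    moreover have "0 < c_vol D * \<epsilon> ^ CARD('n)" using c that by simp
    ultimately show False using v[OF x that] by linarith
  qed
  show "measure (mu M) (ball x s \<inter> M) \<le> C_vol D * c_ie D ^ CARD('n) * s ^ CARD('n)"
    if s: "0 < s" "s < rho_ie D" "s < rho_vol D / c_ie D"
  proof -
    have cs: "0 < c_ie D * s" "c_ie D * s < rho_vol D" using s c by (auto simp: less_divide_eq mult.commute)
    have "ball x s \<inter> M \<subseteq> intrinsic_ball M x (c_ie D * s)"
    proof
      fix y assume y: "y \<in> ball x s \<inter> M"
      then have "intrinsic_dist M x y \<le> ennreal (c_ie D * dist x y)" using x s by (intro ie) auto
      also have "\<dots> < ennreal (c_ie D * s)" using y c s by (intro ennreal_lessI) auto
      finally show "y \<in> intrinsic_ball M x (c_ie D * s)" using y by (simp add: intrinsic_ball_def)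
    qed
    then have "measure (mu M) (ball x s \<inter> M) \<le> measure (mu M) (intrinsic_ball M x (c_ie D * s))"
      by (intro finite_measure_mono meas cs)
    also have "\<dots> \<le> C_vol D * (c_ie D * s) ^ CARD('n)" using v[OF x cs] by blast
    finally show ?thesis by (simp add: power_mult_distrib mult.assoc)
  qed
  show "vol \<le> 2 ^ CARD('n) / c_vol D"
  proof -
    define s where "s = rho_vol D / 2"
    have s: "0 < s" "s < rho_vol D" using c by (auto simp: s_def)
    have "c_vol D * s ^ CARD('n) \<le> measure (mu M) (intrinsic_ball M x s)" using v[OF x s] by blast
    also have "\<dots> \<le> measure (mu M) (ball x s \<inter> M)"
      using intrinsic_ball_subset_ball[of M x s] ball_Int_sets_mu[of x s]
      by (intro finite_measure_mono) (auto simp: intrinsic_ball_def)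
    also have "\<dots> \<le> (2 * s) ^ CARD('n) / vol"
    proof -
      have "emeasure (mu M) (ball x s \<inter> M) = (\<integral>\<^sup>+y. indicator (ball x s \<inter> M) y \<partial>mu M)"
        using ball_Int_sets_mu by simp
      also have "\<dots> = ennreal (1 / vol) * (\<integral>\<^sup>+y. indicator (ball x s \<inter> M) y * indicator M y \<partial>lebesgue)"
        using ball_Int_sets_mu[of x s] by (intro nn_integral_mu borel_measurable_indicator) (simp add: sets_mu)
      also have "\<dots> \<le> ennreal (1 / vol) * (\<integral>\<^sup>+y. indicator (ball x s) y \<partial>lebesgue)"
        by (intro mult_left_mono nn_integral_mono) (auto simp: indicator_def)
      also have "(\<integral>\<^sup>+y. indicator (ball x s) y \<partial>lebesgue) = emeasure lborel (ball x s)" by simp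
      also have "ennreal (1 / vol) * emeasure lborel (ball x s) \<le> ennreal (1 / vol) * ennreal ((2 * s) ^ CARD('n))"
        using s by (intro mult_left_mono ball_emeasure_upper) auto
      also have "\<dots> = ennreal ((2 * s) ^ CARD('n) / vol)"
        using s emeasure_M(2) by (simp add: ennreal_mult[symmetric])
      finally show ?thesis
        using s emeasure_M(2) by (simp add: emeasure_eq_measure)
    qed
    also have "\<dots> = s ^ CARD('n) * (2 ^ CARD('n) / vol)" by (simp add: power_mult_distrib)
    finally have "s ^ CARD('n) * c_vol D \<le> s ^ CARD('n) * (2 ^ CARD('n) / vol)" by (simp add: mult.commute)
    then have "c_vol D \<le> 2 ^ CARD('n) / vol" by (rule mult_left_le_imp_le) (use s in simp)
    then show ?thesis using c emeasure_M(2) by (simp add: le_divide_eq mult.commute)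
  qed
qed

lemma eigenvalue_upper_bound:
  assumes d: "2 \<le> CARD('n::finite)"
    and pos: "0 < C_vol D" "1 \<le> c_ie D" "0 < rho_ie D" "0 < rho_vol D"
  shows "\<exists>C>0. \<exists>\<epsilon>0>0. \<forall>M :: (real^'n) set. standing_assumptions D M \<longrightarrow>
      (\<forall>x\<in>M. \<forall>\<epsilon>. 0 < \<epsilon> \<and> \<epsilon> < \<epsilon>0 \<longrightarrow> principal_eigenvalue M (intrinsic_ball M x \<epsilon>) \<le> ereal (C * kappa CARD('n) \<epsilon>))"
proof -
  define C where "C = C_vol D * c_ie D ^ CARD('n)"
  define R0 where "R0 = min (rho_ie D) (rho_vol D / c_ie D)"
  have C: "0 < C" and R0: "0 < R0" using pos by (auto simp: C_def R0_def)
  obtain C' \<epsilon>0 where C': "0 < C'" "0 < \<epsilon>0" and scale: "\<And>\<epsilon>. 0 < \<epsilon> \<Longrightarrow> \<epsilon> < \<epsilon>0 \<Longrightarrow>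
      \<exists>N\<ge>1. 2 ^ N * \<epsilon> < R0 \<and> C * (2 ^ N * \<epsilon>) ^ CARD('n) \<le> 1 / 2 \<and>
      12 * C * 2 ^ CARD('n) / (real N)\<^sup>2 * (\<Sum>k<N. (2 ^ k * \<epsilon>) ^ CARD('n) / (2 ^ k * \<epsilon>)\<^sup>2) \<le> C' * kappa CARD('n) \<epsilon>"
    using cutoff_scale_exists[OF d C R0] by blast
  have "principal_eigenvalue M (intrinsic_ball M x \<epsilon>) \<le> ereal (C' * kappa CARD('n) \<epsilon>)"
    if sa: "standing_assumptions D M" and x: "x \<in> M" and \<epsilon>: "0 < \<epsilon>" "\<epsilon> < \<epsilon>0" for M :: "(real^'n) set" and x \<epsilon>
  proof -
    interpret compact_body M by (rule standing_assumptions_compact_body[OF sa])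
    obtain N where N: "1 \<le> N" "2 ^ N * \<epsilon> < R0" "C * (2 ^ N * \<epsilon>) ^ CARD('n) \<le> 1 / 2"
      "12 * C * 2 ^ CARD('n) / (real N)\<^sup>2 * (\<Sum>k<N. (2 ^ k * \<epsilon>) ^ CARD('n) / (2 ^ k * \<epsilon>)\<^sup>2) \<le> C' * kappa CARD('n) \<epsilon>"
      using scale[OF \<epsilon>] by blast
    have "principal_eigenvalue M (intrinsic_ball M x \<epsilon>)
        \<le> ereal (12 * C * 2 ^ CARD('n) / (real N)\<^sup>2 * (\<Sum>k<N. (2 ^ k * \<epsilon>) ^ CARD('n) / (2 ^ k * \<epsilon>)\<^sup>2))"
    proof (rule principal_eigenvalue_le_cutoff[OF \<epsilon>(1) N(1) intrinsic_ball_subset_ball _ _ N(3)])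
      fix s assume "0 < s" "s \<le> 2 ^ N * \<epsilon>"
      then show "measure (mu M) (ball x s \<inter> M) \<le> C * s ^ CARD('n)"
        unfolding C_def using N(2) by (intro volume_bounds(1)[OF sa x]) (auto simp: R0_def)
    qed (use C in simp)
    also have "\<dots> \<le> ereal (C' * kappa CARD('n) \<epsilon>)" using N(4) by simp
    finally show ?thesis .
  qed
  then show ?thesis using C' by blast
qed

lemma eigenvalue_lower_bound:
  assumes d: "2 \<le> CARD('n::finite)"
    and pos: "0 < rad_ch D" "1 \<le> L_ch D" "0 < gap_lb D" "0 < c_vol D"
  shows "\<exists>c>0. \<exists>\<epsilon>0>0. \<forall>M :: (real^'n) set. standing_assumptions D M \<longrightarrow>
      (\<forall>x\<in>M. \<forall>\<epsilon>. 0 < \<epsilon> \<and> \<epsilon> < \<epsilon>0 \<longrightarrow> ereal (c * kappa CARD('n) \<epsilon>) \<le> principal_eigenvalue M (intrinsic_ball M x \<epsilon>))"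
proof -
  define r L \<gamma> where "r = rad_ch D" and "L = L_ch D" and "\<gamma> = gap_lb D"
  have r: "0 < r" and L: "1 \<le> L" and \<gamma>: "0 < \<gamma>" using pos by (auto simp: r_def L_def \<gamma>_def)
  have R: "0 < 2 * r * L" using r L by simp
  obtain J \<epsilon>0 where J: "0 < J" "0 < \<epsilon>0" "\<epsilon>0 \<le> 2 * r * L" and scale: "\<And>\<epsilon>. 0 < \<epsilon> \<Longrightarrow> \<epsilon> < \<epsilon>0 \<Longrightarrow>
      0 < kappa CARD('n) \<epsilon> \<and> kappa CARD('n) \<epsilon> \<le> 1 \<and>
      (\<integral>\<^sup>+t. indicator {\<epsilon> / (2 * r * L)..1} t * ennreal (1 / t ^ (CARD('n) - 1)) \<partial>lborel) \<le> ennreal (J / kappa CARD('n) \<epsilon>)"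
    using contraction_weight_le[OF d R] by blast
  define V0 where "V0 = 2 ^ CARD('n) / c_vol D"
  define v0 where "v0 = (r / 2 / CARD('n)) ^ CARD('n)"
  define K2 where "K2 = (2 * L * CARD('n)) ^ CARD('n)"
  define B where "B = 1 / \<gamma> + V0 / v0 * K2 * (8 * r\<^sup>2 * L\<^sup>2 * J + 2 / \<gamma>)"
  have V0: "0 < V0" and v0: "0 < v0" and K2: "0 < K2" using pos r L by (auto simp: V0_def v0_def K2_def)
  have B: "0 < B" unfolding B_def using V0 v0 K2 \<gamma> J(1)
    by (intro add_pos_nonneg mult_nonneg_nonneg divide_nonneg_nonneg add_nonneg_nonneg) auto
  have "ereal (1 / B * kappa CARD('n) \<epsilon>) \<le> principal_eigenvalue M (intrinsic_ball M x \<epsilon>)"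
    if sa: "standing_assumptions D M" and x: "x \<in> M" and \<epsilon>: "0 < \<epsilon>" "\<epsilon> < \<epsilon>0" for M :: "(real^'n) set" and x \<epsilon>
  proof -
    interpret compact_body M by (rule standing_assumptions_compact_body[OF sa])
    define \<kappa> where "\<kappa> = kappa CARD('n) \<epsilon>"
    have \<kappa>: "0 < \<kappa>" "\<kappa> \<le> 1" and int: "(\<integral>\<^sup>+t. indicator {\<epsilon> / (2 * r * L)..1} t * ennreal (1 / t ^ (CARD('n) - 1)) \<partial>lborel) \<le> ennreal (J / \<kappa>)"
      using scale[OF \<epsilon>] by (auto simp: \<kappa>_def)
    have gap: "neumann_spectrum_discrete_with_gap M \<gamma>"
      using sa by (simp add: standing_assumptions_def admissible_reflecting_domain_def \<gamma>_def)
    have "\<exists>U \<Psi>. is_chart D M x U \<Psi>"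
      using sa x by (simp add: standing_assumptions_def admissible_reflecting_domain_def)
    then obtain U \<Psi> where chart: "is_chart D M x U \<Psi>" by blast
    have "\<exists>(W :: (real^'n) set) a b \<Phi> z. convex W \<and> W \<subseteq> ball a r \<and> ball b (r / 2) \<subseteq> W \<and>
        L-lipschitz_on W \<Phi> \<and> (\<forall>w\<in>W. \<forall>w'\<in>W. dist w w' \<le> L * dist (\<Phi> w) (\<Phi> w')) \<and>
        \<Phi> ` W \<subseteq> M \<and> z \<in> W \<and> \<Phi> z = x"
      unfolding r_def L_def by (rule chart_parametrisation[OF chart pos(1)])
    then obtain W :: "(real^'n) set" and a b and \<Phi> :: "real^'n \<Rightarrow> real^'n" and z where W: "convex W" "W \<subseteq> ball a r" "ball b (r / 2) \<subseteq> W"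
      "L-lipschitz_on W \<Phi>" and exp: "\<forall>w\<in>W. \<forall>w'\<in>W. dist w w' \<le> L * dist (\<Phi> w) (\<Phi> w')"
      and W': "\<Phi> ` W \<subseteq> M" "z \<in> W" "\<Phi> z = x"
      by blast
    show ?thesis
      unfolding principal_eigenvalue_def
    proof (rule INF_greatest)
      fix f assume "f \<in> {f \<in> H1 M. vanishes_qe_on M (intrinsic_ball M x \<epsilon>) f \<and> \<not> (AE x in mu M. f x = 0)}"
      then have f: "f \<in> H1 M" and van: "vanishes_qe_on M (intrinsic_ball M x \<epsilon>) f" and nz: "\<not> (AE x in mu M. f x = 0)"
        by auto
      let ?E = "dirichlet_form M f f"
      have E: "0 \<le> ?E" by (rule dirichlet_form_nonneg)
      have van': "vanishes_qe_on M (intrinsic_ball M (\<Phi> z) \<epsilon>) f" using van W'(3) by simp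
      have le: "(L2_norm M f)\<^sup>2 \<le> (1 / \<gamma> + vol / v0 * K2 * (8 * r\<^sup>2 * L\<^sup>2 * (J / \<kappa>) + 2 / \<gamma>)) * ?E"
        unfolding v0_def K2_def
        by (rule chart_lower_bound[OF W(1,2,3) r L W(4) exp[rule_format] W'(1,2) gap \<gamma> \<epsilon>(1) _ int _ f van'])
           (use \<epsilon>(2) J \<kappa> in auto)
      have coef: "\<kappa> * (1 / \<gamma> + vol / v0 * K2 * (8 * r\<^sup>2 * L\<^sup>2 * (J / \<kappa>) + 2 / \<gamma>)) \<le> B"
      proof -
        have "\<kappa> * (1 / \<gamma> + vol / v0 * K2 * (8 * r\<^sup>2 * L\<^sup>2 * (J / \<kappa>) + 2 / \<gamma>))
            = \<kappa> * (1 / \<gamma>) + vol / v0 * K2 * (8 * r\<^sup>2 * L\<^sup>2 * J + \<kappa> * (2 / \<gamma>))"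
          using \<kappa>(1) by (simp add: algebra_simps)
        also have "\<dots> \<le> 1 * (1 / \<gamma>) + V0 / v0 * K2 * (8 * r\<^sup>2 * L\<^sup>2 * J + 1 * (2 / \<gamma>))"
          using \<kappa> \<gamma> v0 K2 V0 J(1) pos(4) emeasure_M(2) volume_bounds(2)[OF sa x]
          by (intro add_mono mult_mono divide_right_mono) (auto simp: V0_def intro!: add_nonneg_nonneg mult_nonneg_nonneg divide_nonneg_nonneg)
        finally show ?thesis by (simp add: B_def)
      qed
      have "\<kappa> * (L2_norm M f)\<^sup>2 \<le> \<kappa> * ((1 / \<gamma> + vol / v0 * K2 * (8 * r\<^sup>2 * L\<^sup>2 * (J / \<kappa>) + 2 / \<gamma>)) * ?E)"
        using le \<kappa>(1) by (intro mult_left_mono) auto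
      also have "\<dots> = (\<kappa> * (1 / \<gamma> + vol / v0 * K2 * (8 * r\<^sup>2 * L\<^sup>2 * (J / \<kappa>) + 2 / \<gamma>))) * ?E" by (rule mult.assoc[symmetric])
      also have "\<dots> \<le> B * ?E" using coef E by (rule mult_right_mono)
      finally have main: "\<kappa> * (L2_norm M f)\<^sup>2 \<le> B * ?E" .
      have n0: "0 < (L2_norm M f)\<^sup>2"
      proof -
        have "(L2_norm M f)\<^sup>2 \<noteq> 0"
        proof
          assume "(L2_norm M f)\<^sup>2 = 0"
          then have "(\<integral>x. (f x)\<^sup>2 \<partial>mu M) = 0" by (simp only: L2_norm_square)
          then have "AE x in mu M. (f x)\<^sup>2 = 0"
            using H1_L2[OF f] by (subst (asm) integral_nonneg_eq_0_iff_AE) (auto simp: L2_def)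
          then show False using nz by simp
        qed
        then show ?thesis by simp
      qed
      have "1 / B * \<kappa> \<le> ?E / (L2_norm M f)\<^sup>2"
        using main n0 B by (simp add: field_simps)
      then show "ereal (1 / B * kappa CARD('n) \<epsilon>) \<le> ereal (?E / (L2_norm M f)\<^sup>2)" by (simp only: \<kappa>_def ereal_less_eq)
    qed
  qed
  moreover have "0 < 1 / B" using B by simp
  ultimately show ?thesis using J(2) by blast
qed

theorem theorem5p3:
  fixes D :: domain_data
  assumes "2 \<le> CARD('n::finite)"
  shows "\<exists>c_sh > 0. \<exists>C_sh > 0. \<exists>\<epsilon>_sh > 0.
    \<forall>M :: (real^'n) set. standing_assumptions D M \<longrightarrow>
      (\<forall>x\<in>M. \<forall>\<epsilon>. 0 < \<epsilon> \<and> \<epsilon> < \<epsilon>_sh \<longrightarrow>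
        ereal (c_sh * kappa CARD('n) \<epsilon>) \<le> principal_eigenvalue M (intrinsic_ball M x \<epsilon>) \<and>
        principal_eigenvalue M (intrinsic_ball M x \<epsilon>) \<le> ereal (C_sh * kappa CARD('n) \<epsilon>))"
proof (cases "\<exists>M :: (real^'n) set. standing_assumptions D M")
  \<comment> \<open>the constants in \<open>D\<close> are known to be positive only if some domain has these data\<close>
  case True
  then have pos: "0 < C_vol D" "1 \<le> c_ie D" "0 < rho_ie D" "0 < rho_vol D"
    "0 < rad_ch D" "1 \<le> L_ch D" "0 < gap_lb D" "0 < c_vol D"
    by (auto simp: standing_assumptions_def admissible_reflecting_domain_def)
  obtain C \<epsilon>1 where up: "0 < C" "0 < \<epsilon>1" "\<forall>M :: (real^'n) set. standing_assumptions D M \<longrightarrow>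
      (\<forall>x\<in>M. \<forall>\<epsilon>. 0 < \<epsilon> \<and> \<epsilon> < \<epsilon>1 \<longrightarrow> principal_eigenvalue M (intrinsic_ball M x \<epsilon>) \<le> ereal (C * kappa CARD('n) \<epsilon>))"
    using eigenvalue_upper_bound[OF assms pos(1-4)] by blast
  obtain c \<epsilon>2 where lo: "0 < c" "0 < \<epsilon>2" "\<forall>M :: (real^'n) set. standing_assumptions D M \<longrightarrow>
      (\<forall>x\<in>M. \<forall>\<epsilon>. 0 < \<epsilon> \<and> \<epsilon> < \<epsilon>2 \<longrightarrow> ereal (c * kappa CARD('n) \<epsilon>) \<le> principal_eigenvalue M (intrinsic_ball M x \<epsilon>))"
    using eigenvalue_lower_bound[OF assms pos(5-8)] by blast
  show ?thesis
    by (rule exI[of _ c], rule conjI[OF lo(1)], rule exI[of _ C], rule conjI[OF up(1)], rule exI[of _ "min \<epsilon>1 \<epsilon>2"])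
       (use up lo in simp)
next
  case False
  then show ?thesis by (intro exI[of _ "1::real"] conjI) auto
qed

end
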